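(* Let $\mathbf{p}\in\Bbbk^{\mathtt{I}}_+$ and $\mathtt{J}\subset\mathtt{J}_{\mathbf{p}}$. Then $B(\mathbf{p})^{\theta_{\mathtt{J}}}$ and $(B(\mathbf{p})^{\theta_{\mathtt{J}}})^{\star}$ are the injective envelope and the projective cover of $L(\mathbf{p})^{\theta_{\mathtt{J}}}$ in $\mathfrak{W}$, respectively.
   Context: Let $\Bbbk$ be an algebraically closed field of characteristic zero and $\mathtt{I}$ an infinite set with $|\mathtt{I}|<|\Bbbk|$. Let $B$ be the polynomial $\Bbbk$-algebra in the variables $x_i$, $i\in\mathtt{I}$. The infinite Weyl algebra $A$ is the subalgebra of $\mathrm{End}_{\Bbbk}(B)$ generated by all $X_i$ (multiplication by $x_i$) and all $Y_i$ (partial derivative $\partial_i$ with respect to $x_i$), $i\in\mathtt{I}$. Put $t_i:=X_iY_i$ and let $A_0\subset A$ be the (commutative) subalgebra generated by all $t_i$. Let $\Bbbk^{\mathtt{I}}$ be the additive group of all vectors $(v_i)_{i\in\mathtt{I}}$ with coefficients in $\Bbbk$, and $\mathbb{Z}_f^{\mathtt{I}}\subset\Bbbk^{\mathtt{I}}$ the subgroup of integral vectors with at most finitely many nonzero coefficients. For $\mathbf{p}\in\Bbbk^{\mathtt{I}}$ let $\mathfrak{m}_{\mathbf{p}}$ be the maximal ideal of $A_0$ generated by $t_i-p_i$, $i\in\mathtt{I}$. Modules are left modules. An $A$-module $M$ is a weight module if $M=\bigoplus_{\mathbf{p}\in\Bbbk^{\mathtt{I}}}M_{\mathbf{p}}$,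 where $M_{\mathbf{p}}=\{x\in M: t_i\cdot x=p_i x\ \forall i\in\mathtt{I}\}$. $\mathfrak{W}$ is the full subcategory of the category of all $A$-modules consisting of all weight modules. Put $P(\mathbf{p}):=A/A\mathfrak{m}_{\mathbf{p}}\in\mathfrak{W}$; it has a unique maximal submodule, and $L(\mathbf{p})$ denotes its unique simple quotient. $\Bbbk^{\mathtt{I}}_+$ is the set of all $\mathbf{p}\in\Bbbk^{\mathtt{I}}$ such that for all $i\in\mathtt{I}$, $p_i\in\mathbb{Z}$ implies $p_i\in\{0,1,2,\dots\}$. For $\mathbf{p}\in\Bbbk^{\mathtt{I}}_+$, $\mathtt{J}_{\mathbf{p}}$ is the set of all $i\in\mathtt{I}$ with $p_i\in\mathbb{Z}$. $B(\mathbf{p})$ is the $\Bbbk$-vector space with basis the formal monomials $\mathbf{x}^{\mathbf{m}}=\prod_{i\in\mathtt{I}}x_i^{m_i}$, $\mathbf{m}\in\mathbf{p}+\mathbb{Z}_f^{\mathtt{I}}$, on which $X_i$ acts by multiplication with $x_i$ and $Y_i$ acts by partial derivative with respect to $x_i$; that is, $X_i\mathbf{x}^{\mathbf{m}}=\mathbf{x}^{\mathbf{m}+\mathbf{e}_i}$ and $Y_i\mathbf{x}^{\mathbf{m}}=m_i\mathbf{x}^{\mathbf{m}-\mathbf{e}_i}$, where $\mathbf{e}_i$ is the $i$-th standard unit vector. This is a weight $A$-module with one-dimensional nonzero weight spaces. For $\mathtt{J}\subset\mathtt{I}$, $\theta_{\mathtt{J}}$ is the automorphism of $A$ with $\theta_{\mathtt{J}}(X_j)=Y_j$,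 $\theta_{\mathtt{J}}(Y_j)=-X_j$ for $j\in\mathtt{J}$ and $\theta_{\mathtt{J}}(X_i)=X_i$, $\theta_{\mathtt{J}}(Y_i)=Y_i$ for $i\notin\mathtt{J}$. For an $A$-module $M$, $M^{\theta_{\mathtt{J}}}$ is the module obtained by twisting the action by $\theta_{\mathtt{J}}$ (same space, $a$ acts as $\theta_{\mathtt{J}}(a)$); it is a weight module if and only if $M$ is. Let $\diamond$ be the involutive anti-automorphism of $A$ with $X_i^{\diamond}=Y_i$, $Y_i^{\diamond}=X_i$. For a weight module $M$ with finite dimensional weight spaces, $M^{\star}:=\bigoplus_{\mathbf{p}\in\Bbbk^{\mathtt{I}}}\mathrm{Hom}_{\Bbbk}(M_{\mathbf{p}},\Bbbk)$ with left $A$-action $(a\cdot f)(x)=f(a^{\diamond}x)$ (each $\mathrm{Hom}_{\Bbbk}(M_{\mathbf{p}},\Bbbk)$ being viewed as the functionals on $M$ vanishing on the other weight spaces). *)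

theory Defs
  imports
    "HOL-Library.Poly_Mapping"
    "HOL-Library.Equipollence"
    "HOL-Computational_Algebra.Polynomial"
    "HOL-Algebra.Generated_Rings"
    "HOL-Algebra.QuotRing"
    "HOL-Algebra.Module"
begin

text \<open>
  The locale \<^locale>\<open>module\<close> of the library requires a commutative ring. Here only its record
  type is used, whose fields \<^const>\<open>monoid.mult\<close> and \<^const>\<open>monoid.one\<close> are irrelevant
  for modules. The library's \<^locale>\<open>submodule\<close> does not depend on commutativity and is used as it is.
\<close>

locale left_module = R?: ring R + M?: abelian_group M
  for R :: "('a, 'r) ring_scheme" (structure) and M :: "('a, 'm, 'x) module_scheme" (structure) +
  assumes smult_closed:
      "\<lbrakk>a \<in> carrier R; x \<in> carrier M\<rbrakk> \<Longrightarrow> a \<odot>\<^bsub>M\<^esub> x \<in> carrier M"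
    and smult_l_distr:
      "\<lbrakk>a \<in> carrier R; b \<in> carrier R; x \<in> carrier M\<rbrakk> \<Longrightarrow>
        (a \<oplus>\<^bsub>R\<^esub> b) \<odot>\<^bsub>M\<^esub> x = a \<odot>\<^bsub>M\<^esub> x \<oplus>\<^bsub>M\<^esub> b \<odot>\<^bsub>M\<^esub> x"
    and smult_r_distr:
      "\<lbrakk>a \<in> carrier R; x \<in> carrier M; y \<in> carrier M\<rbrakk> \<Longrightarrow>
        a \<odot>\<^bsub>M\<^esub> (x \<oplus>\<^bsub>M\<^esub> y) = a \<odot>\<^bsub>M\<^esub> x \<oplus>\<^bsub>M\<^esub> a \<odot>\<^bsub>M\<^esub> y"
    and smult_assoc:
      "\<lbrakk>a \<in> carrier R; b \<in> carrier R; x \<in> carrier M\<rbrakk> \<Longrightarrow>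
        (a \<otimes>\<^bsub>R\<^esub> b) \<odot>\<^bsub>M\<^esub> x = a \<odot>\<^bsub>M\<^esub> (b \<odot>\<^bsub>M\<^esub> x)"
    and smult_one:
      "x \<in> carrier M \<Longrightarrow> \<one>\<^bsub>R\<^esub> \<odot>\<^bsub>M\<^esub> x = x"

definition left_module_hom ::
  "('a, 'x) ring_scheme \<Rightarrow> ('a, 'm, 'y) module_scheme \<Rightarrow> ('a, 'n, 'z) module_scheme \<Rightarrow> ('m \<Rightarrow> 'n) set"
  where "left_module_hom R M N =
    {h \<in> carrier M \<rightarrow> carrier N.
      (\<forall>x\<in>carrier M. \<forall>y\<in>carrier M. h (x \<oplus>\<^bsub>M\<^esub> y) = h x \<oplus>\<^bsub>N\<^esub> h y) \<and>
      (\<forall>a\<in>carrier R. \<forall>x\<in>carrier M. h (a \<odot>\<^bsub>M\<^esub> x) = a \<odot>\<^bsub>N\<^esub> h x)}"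

definition regular_module :: "('a, 'x) ring_scheme \<Rightarrow> ('a, 'a) module"
  where "regular_module R =
    \<lparr>carrier = carrier R, mult = monoid.mult R, one = monoid.one R,
     zero = ring.zero R, add = ring.add R,
     smult = monoid.mult R\<rparr>"

definition submodule_span :: "('a, 'x) ring_scheme \<Rightarrow> ('a, 'm, 'y) module_scheme \<Rightarrow> 'm set \<Rightarrow> 'm set"
  where "submodule_span R M S = \<Inter> {N. submodule N R M \<and> S \<subseteq> N}"

definition maximal_submodule :: "'m set \<Rightarrow> ('a, 'x) ring_scheme \<Rightarrow> ('a, 'm, 'y) module_scheme \<Rightarrow> bool"
  where "maximal_submodule N R M \<longleftrightarrow>
    submodule N R M \<and> N \<noteq> carrier M \<and>
    (\<forall>N'. submodule N' R M \<and> N \<subseteq> N' \<longrightarrow> N' = N \<or> N' = carrier M)"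

definition quotient_module :: "('a, 'm, 'y) module_scheme \<Rightarrow> 'm set \<Rightarrow> ('a, 'm set) module"
  where "quotient_module M N =
    \<lparr>carrier = a_rcosets\<^bsub>M\<^esub> N, mult = undefined, one = undefined,
     zero = N, add = set_add M, smult = (\<lambda>a C. \<Union>x\<in>C. N +>\<^bsub>M\<^esub> (a \<odot>\<^bsub>M\<^esub> x))\<rparr>"

definition twist :: "('a \<Rightarrow> 'a) \<Rightarrow> ('a, 'm) module \<Rightarrow> ('a, 'm) module"
  where "twist \<phi> M = M\<lparr>smult := (\<lambda>a. smult M (\<phi> a))\<rparr>"

text \<open>The index set is the universe of the type \<^typ>\<open>'i\<close>.\<close>

type_synonym ('i, 'k) mpol = "('i \<Rightarrow>\<^sub>0 nat) \<Rightarrow>\<^sub>0 'k"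
type_synonym ('i, 'k) mpol_op = "('i, 'k) mpol \<Rightarrow> ('i, 'k) mpol"

definition pm_scale :: "'k::field \<Rightarrow> ('e \<Rightarrow>\<^sub>0 'k) \<Rightarrow> ('e \<Rightarrow>\<^sub>0 'k)"
  where "pm_scale c = Poly_Mapping.map (\<lambda>a. c * a)"

definition End_ring :: "('i, 'k::field) mpol_op ring"
  where "End_ring =
    \<lparr>carrier = {T. (\<forall>f g. T (f + g) = T f + T g) \<and> (\<forall>c f. T (pm_scale c f) = pm_scale c (T f))},
     mult = (\<circ>), one = id, zero = (\<lambda>_. 0), add = (\<lambda>S T f. S f + T f)\<rparr>"

definition scal :: "'k::field \<Rightarrow> ('i, 'k) mpol_op"
  where "scal c = pm_scale c"

definition X_op :: "'i \<Rightarrow> ('i, 'k::field) mpol_op"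
  where "X_op i f = Poly_Mapping.single (Poly_Mapping.single i 1) 1 * f"

text \<open>The truncated subtraction is harmless: the coefficient vanishes when \<open>x\<^sub>i\<close> does not occur.\<close>

definition Y_op :: "'i \<Rightarrow> ('i, 'k::field) mpol_op"
  where "Y_op i f = (\<Sum>m\<in>Poly_Mapping.keys f.
    Poly_Mapping.single (m - Poly_Mapping.single i 1)
      (of_nat (Poly_Mapping.lookup m i) * Poly_Mapping.lookup f m))"

definition weyl :: "('i, 'k::field) mpol_op ring"
  where "weyl = End_ring\<lparr>carrier := generate_ring End_ring
    ({scal c |c. True} \<union> {X_op i |i. True} \<union> {Y_op i |i. True})\<rparr>"

definition t_op :: "'i \<Rightarrow> ('i, 'k::field) mpol_op"
  where "t_op i = X_op i \<otimes>\<^bsub>weyl\<^esub> Y_op i"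

definition weyl0 :: "('i, 'k::field) mpol_op ring"
  where "weyl0 = End_ring\<lparr>carrier := generate_ring End_ring ({scal c |c. True} \<union> {t_op i |i. True})\<rparr>"

definition max_ideal :: "('i \<Rightarrow> 'k::field) \<Rightarrow> ('i, 'k) mpol_op set"
  where "max_ideal p = Idl\<^bsub>weyl0\<^esub> {t_op i \<ominus>\<^bsub>weyl0\<^esub> scal (p i) |i. True}"

text \<open>
  In the next two definitions the map is determined by the stated conditions on the carrier
  of \<^const>\<open>weyl\<close>; its values elsewhere are immaterial, whence \<open>SOME\<close> instead of \<open>THE\<close>.
\<close>

definition theta :: "'i set \<Rightarrow> ('i, 'k::field) mpol_op \<Rightarrow> ('i, 'k) mpol_op"
  where "theta J = (SOME \<phi>. \<phi> \<in> ring_iso weyl weyl \<and> (\<forall>c. \<phi> (scal c) = scal c) \<and>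
    (\<forall>j\<in>J. \<phi> (X_op j) = Y_op j \<and> \<phi> (Y_op j) = \<ominus>\<^bsub>weyl\<^esub> X_op j) \<and>
    (\<forall>i. i \<notin> J \<longrightarrow> \<phi> (X_op i) = X_op i \<and> \<phi> (Y_op i) = Y_op i))"

definition diamond :: "('i, 'k::field) mpol_op \<Rightarrow> ('i, 'k) mpol_op"
  where "diamond = (SOME \<phi>. \<phi> \<in> ring_iso weyl (weyl\<lparr>mult := (\<lambda>a b. b \<otimes>\<^bsub>weyl\<^esub> a)\<rparr>) \<and>
    (\<forall>a\<in>carrier weyl. \<phi> (\<phi> a) = a) \<and> (\<forall>c. \<phi> (scal c) = scal c) \<and>
    (\<forall>i. \<phi> (X_op i) = Y_op i \<and> \<phi> (Y_op i) = X_op i))"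

definition weight_space :: "(('i, 'k::field) mpol_op, 'm) module \<Rightarrow> ('i \<Rightarrow> 'k) \<Rightarrow> 'm set"
  where "weight_space M p = {x \<in> carrier M. \<forall>i. t_op i \<odot>\<^bsub>M\<^esub> x = scal (p i) \<odot>\<^bsub>M\<^esub> x}"

definition weight_module :: "(('i, 'k::field) mpol_op, 'm) module \<Rightarrow> bool"
  where "weight_module M \<longleftrightarrow> left_module weyl M \<and>
    (\<forall>x\<in>carrier M. \<exists>!v. (\<forall>p. v p \<in> weight_space M p) \<and> finite {p. v p \<noteq> \<zero>\<^bsub>M\<^esub>} \<and>
      x = finsum M v {p. v p \<noteq> \<zero>\<^bsub>M\<^esub>})"

definition P_mod :: "('i \<Rightarrow> 'k::field) \<Rightarrow> (('i, 'k) mpol_op, ('i, 'k) mpol_op set) module"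
  where "P_mod p = quotient_module (regular_module weyl)
    (submodule_span weyl (regular_module weyl) (max_ideal p))"

definition L_mod :: "('i \<Rightarrow> 'k::field) \<Rightarrow> (('i, 'k) mpol_op, ('i, 'k) mpol_op set set) module"
  where "L_mod p = quotient_module (P_mod p) (THE N. maximal_submodule N weyl (P_mod p))"

definition kplus :: "('i \<Rightarrow> 'k::field) set"
  where "kplus = {p. \<forall>i. p i \<in> \<int> \<longrightarrow> p i \<in> \<nat>}"

definition J_of :: "('i \<Rightarrow> 'k::field) \<Rightarrow> 'i set"
  where "J_of p = {i. p i \<in> \<int>}"

definition Zf :: "('i \<Rightarrow> 'k::field) set"
  where "Zf = {v. (\<forall>i. v i \<in> \<int>) \<and> finite {i. v i \<noteq> 0}}"

text \<open>
  The space \<open>B(p)\<close> consists of the finitely supported coefficient functions on \<open>p + \<int>\<^sub>f\<close>, with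
  \<^term>\<open>Poly_Mapping.single m 1\<close> as the formal monomial of exponent \<open>m\<close>.
\<close>

definition B_carrier :: "('i \<Rightarrow> 'k::field) \<Rightarrow> (('i \<Rightarrow> 'k) \<Rightarrow>\<^sub>0 'k) set"
  where "B_carrier p = {f. Poly_Mapping.keys f \<subseteq> {\<lambda>i. p i + v i |v. v \<in> Zf}}"

definition B_X :: "'i \<Rightarrow> (('i \<Rightarrow> 'k::field) \<Rightarrow>\<^sub>0 'k) \<Rightarrow> (('i \<Rightarrow> 'k) \<Rightarrow>\<^sub>0 'k)"
  where "B_X i f = (\<Sum>m\<in>Poly_Mapping.keys f.
    Poly_Mapping.single (m(i := m i + 1)) (Poly_Mapping.lookup f m))"

definition B_Y :: "'i \<Rightarrow> (('i \<Rightarrow> 'k::field) \<Rightarrow>\<^sub>0 'k) \<Rightarrow> (('i \<Rightarrow> 'k) \<Rightarrow>\<^sub>0 'k)"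
  where "B_Y i f = (\<Sum>m\<in>Poly_Mapping.keys f.
    Poly_Mapping.single (m(i := m i - 1)) (m i * Poly_Mapping.lookup f m))"

definition B_with ::
  "('i \<Rightarrow> 'k::field) \<Rightarrow> (('i, 'k) mpol_op \<Rightarrow> (('i \<Rightarrow> 'k) \<Rightarrow>\<^sub>0 'k) \<Rightarrow> (('i \<Rightarrow> 'k) \<Rightarrow>\<^sub>0 'k)) \<Rightarrow>
    (('i, 'k) mpol_op, ('i \<Rightarrow> 'k) \<Rightarrow>\<^sub>0 'k) module"
  where "B_with p act =
    \<lparr>carrier = B_carrier p, mult = undefined, one = undefined, zero = 0, add = (+), smult = act\<rparr>"

text \<open>
  The action of the Weyl algebra is the one extending the prescribed action of scalars and
  generators; again it is determined on the carriers only.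
\<close>

definition B_mod :: "('i \<Rightarrow> 'k::field) \<Rightarrow> (('i, 'k) mpol_op, ('i \<Rightarrow> 'k) \<Rightarrow>\<^sub>0 'k) module"
  where "B_mod p = B_with p (SOME act. left_module weyl (B_with p act) \<and>
    (\<forall>f\<in>B_carrier p. (\<forall>c. act (scal c) f = pm_scale c f) \<and>
      (\<forall>i. act (X_op i) f = B_X i f \<and> act (Y_op i) f = B_Y i f)))"

text \<open>
  For a weight module \<open>M\<close>, the direct sum of the duals of the weight spaces consists of those linear
  functionals on \<open>M\<close> which vanish on all but finitely many weight spaces. They are made
  extensional so that equal functionals are equal as HOL functions.
\<close>

definition dual :: "(('i, 'k::field) mpol_op, 'm) module \<Rightarrow> (('i, 'k) mpol_op, 'm \<Rightarrow> 'k) module"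
  where "dual M =
    \<lparr>carrier = {f \<in> extensional (carrier M).
        (\<forall>x\<in>carrier M. \<forall>y\<in>carrier M. f (x \<oplus>\<^bsub>M\<^esub> y) = f x + f y) \<and>
        (\<forall>c. \<forall>x\<in>carrier M. f (scal c \<odot>\<^bsub>M\<^esub> x) = c * f x) \<and>
        finite {p. \<exists>x\<in>weight_space M p. f x \<noteq> 0}},
     mult = undefined, one = undefined,
     zero = (\<lambda>x\<in>carrier M. 0),
     add = (\<lambda>f g. \<lambda>x\<in>carrier M. f x + g x),
     smult = (\<lambda>a f. \<lambda>x\<in>carrier M. f (diamond a \<odot>\<^bsub>M\<^esub> x))\<rparr>"

text \<open>
  HOL cannot quantify over types inside a formula, so the carrier types of the test modules are
  parameters; a theorem in which they are type variables covers all test modules.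
  Weight modules are closed under submodules and quotients, so monomorphisms and
  epimorphisms among them are the injective and the surjective homomorphisms.
\<close>

definition injective_in_W ::
  "'u itself \<Rightarrow> 'v itself \<Rightarrow> (('i, 'k::field) mpol_op, 'm) module \<Rightarrow> bool"
  where "injective_in_W _ _ E \<longleftrightarrow> weight_module E \<and>
    (\<forall>(U :: (('i, 'k) mpol_op, 'u) module) (V :: (('i, 'k) mpol_op, 'v) module).
      weight_module U \<and> weight_module V \<longrightarrow>
      (\<forall>f\<in>left_module_hom weyl U V. \<forall>g\<in>left_module_hom weyl U E.
        inj_on f (carrier U) \<longrightarrow>
        (\<exists>h\<in>left_module_hom weyl V E. \<forall>x\<in>carrier U. h (f x) = g x)))"

definition projective_in_W ::
  "'u itself \<Rightarrow> 'v itself \<Rightarrow> (('i, 'k::field) mpol_op, 'm) module \<Rightarrow> bool"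
  where "projective_in_W _ _ Q \<longleftrightarrow> weight_module Q \<and>
    (\<forall>(U :: (('i, 'k) mpol_op, 'u) module) (V :: (('i, 'k) mpol_op, 'v) module).
      weight_module U \<and> weight_module V \<longrightarrow>
      (\<forall>f\<in>left_module_hom weyl U V. \<forall>g\<in>left_module_hom weyl Q V.
        f ` carrier U = carrier V \<longrightarrow>
        (\<exists>h\<in>left_module_hom weyl Q U. \<forall>x\<in>carrier Q. f (h x) = g x)))"

definition injective_envelope_in_W ::
  "'u itself \<Rightarrow> 'v itself \<Rightarrow> (('i, 'k::field) mpol_op, 'm) module \<Rightarrow>
    (('i, 'k) mpol_op, 'n) module \<Rightarrow> bool"
  where "injective_envelope_in_W \<tau> \<tau>' E M \<longleftrightarrow>
    weight_module M \<and> injective_in_W \<tau> \<tau>' E \<and>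
    (\<exists>\<iota>\<in>left_module_hom weyl M E. inj_on \<iota> (carrier M) \<and>
      (\<forall>N. submodule N weyl E \<and> N \<noteq> {\<zero>\<^bsub>E\<^esub>} \<longrightarrow> N \<inter> \<iota> ` carrier M \<noteq> {\<zero>\<^bsub>E\<^esub>}))"

definition projective_cover_in_W ::
  "'u itself \<Rightarrow> 'v itself \<Rightarrow> (('i, 'k::field) mpol_op, 'm) module \<Rightarrow>
    (('i, 'k) mpol_op, 'n) module \<Rightarrow> bool"
  where "projective_cover_in_W \<tau> \<tau>' Q M \<longleftrightarrow>
    weight_module M \<and> projective_in_W \<tau> \<tau>' Q \<and>
    (\<exists>\<pi>\<in>left_module_hom weyl Q M. \<pi> ` carrier Q = carrier M \<and>
      (\<forall>N. submodule N weyl Q \<and> N <+>\<^bsub>Q\<^esub> {x \<in> carrier Q. \<pi> x = \<zero>\<^bsub>M\<^esub>} = carrier Q \<longrightarrow>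
        N = carrier Q))"

end

theory Submission
  imports Defs
begin

text \<open>
  Monomials \<open>X\<^sup>\<alpha> Y\<^sup>\<beta>\<close> form a basis of the Weyl algebra, so any operators satisfying the Weyl relations define a
  representation. Modulo \<open>A m\<^sub>r\<close> every element of weight \<open>\<delta>\<close> is a multiple of a single monomial of weight \<open>\<delta>\<close>.

  Let \<open>E\<close> be a weight module whose weight spaces are lines for the weights in \<open>q + \<int>\<^sub>f\<close> and zero for all others,
  with a linear functional \<open>\<lambda>\<close> vanishing off \<open>E\<^sub>q\<close>, and suppose that every weight vector of \<open>E\<close> can be moved
  into \<open>E\<^sub>q\<close> by some element of \<open>A\<close>. Then homomorphisms \<open>h\<close> from a weight module \<open>V\<close> to \<open>E\<close> correspond to linear
  functionals on \<open>V\<^sub>q\<close> via \<open>h \<mapsto> \<lambda> \<circ> h\<close>, so \<open>E\<close> is injective. In the dual module \<open>\<lambda>\<close> is a generator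
  with annihilator \<open>A m\<^sub>q\<close>, so the dual is \<open>P(q)\<close>, and homomorphisms from it to \<open>V\<close> correspond to elements of \<open>V\<^sub>q\<close>.
  The submodule \<open>L\<close> of \<open>E\<close> generated by \<open>E\<^sub>q\<close> is contained in every nonzero submodule, and a submodule of
  the dual that is proper has weight-\<open>q\<close> part zero, hence lies in the kernel of the surjection onto \<open>L\<close>. The hypothesis on \<open>E\<close> is insensitive to
  twisting apart from the names of the weights, and for \<open>B(p)\<close> with \<open>p\<close> in \<open>kplus\<close> it holds because lowering a
  coordinate down to \<open>p\<^sub>i\<close> never meets the coefficient \<open>0\<close>.
\<close>

section \<open>Linear operators on finitely supported functions\<close>

text \<open>With infinitely many indices a weight space is cut out by infinitely many equations, so
  no single element of \<open>A\<close> is expected to project onto it. But two distinct weights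
  already differ in one coordinate, so finitely many weights are separated by a product of factors
  \<open>t_i - m_i\<close>, and an element of a weight module involves only finitely many weights.
  Components are therefore always extracted by a \<open>projector\<close> chosen after the element.
  The maps chosen by \<open>SOME\<close> say nothing until they are known to exist.
  \<open>theta\<close> and the action on \<open>B(p)\<close> come from the universal property, whose
  well-definedness is the independence of the normal-ordered monomials; \<open>diamond\<close> is
  obtained differently, as the adjoint for a bilinear form on polynomials. The twisted simple module
  is never identified with some \<open>L(q)\<close>. Only an equality of annihilators is used, that
  of its generator and that of a basis vector of \<open>E\<close>, and such an equality survives a
  twist. With the trivial twist, the annihilator of \<open>x^p\<close> in \<open>B(p)\<close> also
  yields the maximal submodule of \<open>P(p)\<close>.\<close>

lemma lookup_pm_scale [simp]: "Poly_Mapping.lookup (pm_scale c f) m = c * Poly_Mapping.lookup f m"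
  by (simp add: pm_scale_def Poly_Mapping.map.rep_eq when_def)

lemma pm_scale_simps [simp]:
  "pm_scale c (f + g) = pm_scale c f + pm_scale c g"
  "pm_scale (c + d) f = pm_scale c f + pm_scale d f"
  "pm_scale c (pm_scale d f) = pm_scale (c * d) f"
  "pm_scale 1 f = f" "pm_scale 0 f = 0" "pm_scale c 0 = 0"
  "pm_scale c (Poly_Mapping.single m d) = Poly_Mapping.single m (c * d)"
  by (auto intro!: poly_mapping_eqI simp: lookup_add lookup_single when_def algebra_simps)

lemma pm_scale_minus:
  "pm_scale c (- f) = - pm_scale c (f :: 'e \<Rightarrow>\<^sub>0 'k::field)" "pm_scale (- c) f = - pm_scale c f"
  by (auto intro!: poly_mapping_eqI)

lemma pm_scale_sum: "pm_scale c (sum g K) = (\<Sum>k\<in>K. pm_scale c (g k))"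
  by (induction K rule: infinite_finite_induct) auto

text \<open>Adds one term to a linear combination indexed by a set. If \<open>j\<close> already lies
  in \<open>K\<close> the two coefficients merge, so normal forms can be kept as a finite set with a
  coefficient function.\<close>

lemma sum_insert_coeff:
  fixes g :: "'a \<Rightarrow> ('e \<Rightarrow>\<^sub>0 'k::field)"
  assumes "finite K"
  shows "(\<Sum>k\<in>insert j K. pm_scale ((if k \<in> K then c k else 0) + (if k = j then d else 0)) (g k))
    = pm_scale d (g j) + (\<Sum>k\<in>K. pm_scale (c k) (g k))" (is "?L = _")
proof -
  have "?L = (\<Sum>k\<in>insert j K. if k \<in> K then pm_scale (c k) (g k) else 0)
      + (\<Sum>k\<in>insert j K. if k = j then pm_scale d (g k) else 0)"
    unfolding sum.distrib[symmetric] by (rule sum.cong) auto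
  also have "(\<Sum>k\<in>insert j K. if k = j then pm_scale d (g k) else 0) = pm_scale d (g j)"
    using assms by (simp add: sum.delta)
  also have "(\<Sum>k\<in>insert j K. if k \<in> K then pm_scale (c k) (g k) else 0) = (\<Sum>k\<in>K. pm_scale (c k) (g k))"
    by (rule sum.mono_neutral_cong_right) (use assms in auto)
  finally show ?thesis by (simp add: add.commute)
qed

definition linear_op :: "(('e \<Rightarrow>\<^sub>0 'k::field) \<Rightarrow> ('d \<Rightarrow>\<^sub>0 'k)) \<Rightarrow> bool" where
  "linear_op T \<longleftrightarrow> (\<forall>f g. T (f + g) = T f + T g) \<and> (\<forall>c f. T (pm_scale c f) = pm_scale c (T f))"

lemma linear_op_add: "linear_op T \<Longrightarrow> T (f + g) = T f + T g"
  and linear_op_scale: "linear_op T \<Longrightarrow> T (pm_scale c f) = pm_scale c (T f)"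
  by (auto simp: linear_op_def)

lemma linear_op_0: "linear_op T \<Longrightarrow> T 0 = 0"
  by (metis linear_op_scale pm_scale_simps(5))

lemma linear_op_minus: "linear_op T \<Longrightarrow> T (- f) = - T f"
  by (metis linear_op_scale pm_scale_minus(2) pm_scale_simps(4))

lemma linear_op_sum: "linear_op T \<Longrightarrow> T (sum g K) = (\<Sum>k\<in>K. T (g k))"
  by (induction K rule: infinite_finite_induct) (auto simp: linear_op_0 linear_op_add)

lemma linear_op_pm_scale: "linear_op (pm_scale c)"
  by (simp add: linear_op_def mult.commute)

lemma linear_op_comp: "linear_op S \<Longrightarrow> linear_op T \<Longrightarrow> linear_op (\<lambda>f. S (T f))"
  by (simp add: linear_op_def)

lemma linear_op_plus: "linear_op S \<Longrightarrow> linear_op T \<Longrightarrow> linear_op (\<lambda>f. S f + T f)"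
  by (simp add: linear_op_def)

lemma linear_op_uminus: "linear_op T \<Longrightarrow> linear_op (\<lambda>f. - T f)"
  by (simp add: linear_op_def pm_scale_minus)

lemma poly_mapping_sum_singles:
  "f = (\<Sum>m\<in>Poly_Mapping.keys f. pm_scale (Poly_Mapping.lookup f m) (Poly_Mapping.single m 1))"
  by (rule poly_mapping_eqI)
    (auto simp: lookup_sum lookup_single when_def sum.delta in_keys_iff)

lemma linear_op_apply:
  "linear_op T \<Longrightarrow>
    T f = (\<Sum>m\<in>Poly_Mapping.keys f. pm_scale (Poly_Mapping.lookup f m) (T (Poly_Mapping.single m 1)))"
  by (subst (1) poly_mapping_sum_singles[of f]) (simp only: linear_op_sum linear_op_scale)

lemma linear_op_eqI:
  assumes "linear_op S" "linear_op T"
    and "\<And>m. S (Poly_Mapping.single m 1) = T (Poly_Mapping.single m 1)"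
  shows "S f = T f"
  unfolding linear_op_apply[OF assms(1), of f] linear_op_apply[OF assms(2), of f] assms(3) ..

definition linear_ext :: "('e \<Rightarrow> ('d \<Rightarrow>\<^sub>0 'k::field)) \<Rightarrow> ('e \<Rightarrow>\<^sub>0 'k) \<Rightarrow> ('d \<Rightarrow>\<^sub>0 'k)" where
  "linear_ext h f = (\<Sum>m\<in>Poly_Mapping.keys f. pm_scale (Poly_Mapping.lookup f m) (h m))"

lemma linear_ext_superset:
  assumes "finite K" "Poly_Mapping.keys f \<subseteq> K"
  shows "linear_ext h f = (\<Sum>m\<in>K. pm_scale (Poly_Mapping.lookup f m) (h m))"
  unfolding linear_ext_def using assms
  by (intro sum.mono_neutral_left) (auto simp: in_keys_iff)

lemma linear_op_linear_ext: "linear_op (linear_ext h)"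
  unfolding linear_op_def
proof safe
  fix f g :: "'a \<Rightarrow>\<^sub>0 'b"
  let ?K = "Poly_Mapping.keys f \<union> Poly_Mapping.keys g"
  have "linear_ext h (f + g) = (\<Sum>m\<in>?K. pm_scale (Poly_Mapping.lookup (f + g) m) (h m))"
    by (rule linear_ext_superset) (use Poly_Mapping.keys_add[of f g] in auto)
  then show "linear_ext h (f + g) = linear_ext h f + linear_ext h g"
    by (simp add: linear_ext_superset[of ?K] lookup_add sum.distrib)
next
  fix c and f :: "'a \<Rightarrow>\<^sub>0 'b"
  have "linear_ext h (pm_scale c f)
      = (\<Sum>m\<in>Poly_Mapping.keys f. pm_scale (Poly_Mapping.lookup (pm_scale c f) m) (h m))"
    by (rule linear_ext_superset) (auto simp: in_keys_iff)
  then show "linear_ext h (pm_scale c f) = pm_scale c (linear_ext h f)"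
    by (simp add: linear_ext_def pm_scale_sum)
qed

lemma linear_ext_single [simp]: "linear_ext h (Poly_Mapping.single m c) = pm_scale c (h m)"
  by (subst linear_ext_superset[of "{m}"]) auto

section \<open>The generators on polynomials and on formal monomials\<close>

lemma X_op_linear: "linear_op (X_op i :: ('i,'k::field) mpol_op)"
proof -
  have "Poly_Mapping.single m 1 * pm_scale c f = pm_scale c (Poly_Mapping.single m 1 * f)"
    for m and c and f :: "('i,'k) mpol"
  proof -
    \<comment> \<open>Scaling is multiplication by a constant polynomial, which commutes with
      multiplication by a monomial.\<close>
    have "pm_scale c g = Poly_Mapping.single 0 c * g" for g :: "('i,'k) mpol"
      by (rule poly_mapping_eqI) (simp add: lookup_mult lookup_single when_mult Sum_any_when_equal')
    then show ?thesis by (simp add: mult.left_commute)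
  qed
  then show ?thesis by (simp add: linear_op_def X_op_def algebra_simps)
qed

lemma X_op_single [simp]:
  "X_op i (Poly_Mapping.single m c) = Poly_Mapping.single (m + Poly_Mapping.single i 1) c"
  by (simp add: X_op_def mult_single add.commute)

lemma Y_op_linear_ext:
  "Y_op i = linear_ext (\<lambda>m. Poly_Mapping.single (m - Poly_Mapping.single i 1) (of_nat (Poly_Mapping.lookup m i)))"
  by (rule ext) (simp add: Y_op_def linear_ext_def mult.commute)

lemma B_X_linear_ext: "B_X i = linear_ext (\<lambda>m. Poly_Mapping.single (m(i := m i + 1)) 1)"
  by (rule ext) (simp add: B_X_def linear_ext_def)

lemma B_Y_linear_ext: "B_Y i = linear_ext (\<lambda>m. Poly_Mapping.single (m(i := m i - 1)) (m i))"
  by (rule ext) (simp add: B_Y_def linear_ext_def mult.commute)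

lemma Y_op_single [simp]:
  "Y_op i (Poly_Mapping.single m c)
    = Poly_Mapping.single (m - Poly_Mapping.single i 1) (of_nat (Poly_Mapping.lookup m i) * c)"
  by (simp add: Y_op_linear_ext mult.commute)

lemma B_X_single [simp]: "B_X i (Poly_Mapping.single m c) = Poly_Mapping.single (m(i := m i + 1)) c"
  by (simp add: B_X_linear_ext)

lemma B_Y_single [simp]:
  "B_Y i (Poly_Mapping.single m c) = Poly_Mapping.single (m(i := m i - 1)) (m i * c)"
  by (simp add: B_Y_linear_ext mult.commute)

lemma Y_op_linear: "linear_op (Y_op i)"
  and B_X_linear: "linear_op (B_X i)"
  and B_Y_linear: "linear_op (B_Y i)"
  by (simp_all only: Y_op_linear_ext B_X_linear_ext B_Y_linear_ext linear_op_linear_ext)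

section \<open>Representations of the Weyl relations\<close>

text \<open>The Weyl relations without the algebra. The polynomial operators themselves, the
  operators on \<open>B(p)\<close> and the generators rearranged by \<open>theta\<close> are models,
  so the universal property is proved once for all of them.\<close>

locale weyl_rep =
  fixes x y :: "'i \<Rightarrow> ('e \<Rightarrow>\<^sub>0 'k::field) \<Rightarrow> ('e \<Rightarrow>\<^sub>0 'k)"
  assumes x_linear: "linear_op (x i)" and y_linear: "linear_op (y i)"
    and x_comm: "x i (x j f) = x j (x i f)" and y_comm: "y i (y j f) = y j (y i f)"
    and y_x: "y i (x j f) = x j (y i f) + (if i = j then f else 0)"

text \<open>Normal order: the \<open>y\<close> act first, then the \<open>x\<close>. Exponents are
  multisets, over which a fold is meaningful because operators of one kind commute.\<close>

definition mon :: "('i \<Rightarrow> 'w \<Rightarrow> 'w) \<Rightarrow> ('i \<Rightarrow> 'w \<Rightarrow> 'w) \<Rightarrow> 'i multiset \<Rightarrow> 'i multiset \<Rightarrow> 'w \<Rightarrow> 'w" where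
  "mon x y \<alpha> \<beta> f = fold_mset x (fold_mset y f \<beta>) \<alpha>"

text \<open>The graph of the homomorphism from the Weyl algebra to the given representation.\<close>

inductive nf_pair ::
  "('i \<Rightarrow> ('e \<Rightarrow>\<^sub>0 'k::field) \<Rightarrow> ('e \<Rightarrow>\<^sub>0 'k)) \<Rightarrow> ('i \<Rightarrow> ('e \<Rightarrow>\<^sub>0 'k) \<Rightarrow> ('e \<Rightarrow>\<^sub>0 'k)) \<Rightarrow>
    ('i, 'k) mpol_op \<Rightarrow> (('e \<Rightarrow>\<^sub>0 'k) \<Rightarrow> ('e \<Rightarrow>\<^sub>0 'k)) \<Rightarrow> bool" for x y where
  nf_0: "nf_pair x y (\<lambda>_. 0) (\<lambda>_. 0)"
| nf_step: "nf_pair x y a b \<Longrightarrow>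
    nf_pair x y (\<lambda>f. pm_scale c (mon X_op Y_op \<alpha> \<beta> f) + a f) (\<lambda>f. pm_scale c (mon x y \<alpha> \<beta> f) + b f)"

context weyl_rep begin

lemma comp_fun_commute_x: "comp_fun_commute x"
  by unfold_locales (auto simp: x_comm)

lemma comp_fun_commute_y: "comp_fun_commute y"
  by unfold_locales (auto simp: y_comm)

lemmas fold_x = comp_fun_commute.fold_mset_add_mset[OF comp_fun_commute_x]
lemmas fold_y = comp_fun_commute.fold_mset_add_mset[OF comp_fun_commute_y]

lemma fold_linear: "linear_op (\<lambda>f. fold_mset x f \<alpha>)" "linear_op (\<lambda>f. fold_mset y f \<alpha>)"
proof -
  show "linear_op (\<lambda>f. fold_mset x f \<alpha>)"
    by (induction \<alpha>) (simp_all add: fold_x linear_op_comp[OF x_linear], simp add: linear_op_def)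
  show "linear_op (\<lambda>f. fold_mset y f \<alpha>)"
    by (induction \<alpha>) (simp_all add: fold_y linear_op_comp[OF y_linear], simp add: linear_op_def)
qed

lemma mon_linear: "linear_op (mon x y \<alpha> \<beta>)"
  using linear_op_comp[OF fold_linear] by (simp add: mon_def[abs_def])

lemma mon_empty [simp]: "mon x y {#} {#} f = f"
  by (simp add: mon_def)

lemma x_mon: "x i (mon x y \<alpha> \<beta> f) = mon x y (add_mset i \<alpha>) \<beta> f"
  by (simp add: mon_def fold_x)

text \<open>The Leibniz rule: the commutator of \<open>y i\<close> with \<open>x^\<alpha>\<close> is
  the formal derivative of \<open>x^\<alpha>\<close>. If \<open>i\<close> does not occur, the
  coefficient is 0 and the truncated difference of multisets is harmless.\<close>

lemma y_fold_x:
  "y i (fold_mset x f \<alpha>) = fold_mset x (y i f) \<alpha> + pm_scale (of_nat (count \<alpha> i)) (fold_mset x f (\<alpha> - {#i#}))"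
proof (induction \<alpha>)
  case empty
  then show ?case by simp
next
  case (add j \<alpha>)
  let ?c = "of_nat (count \<alpha> i) :: 'k"
  have "y i (fold_mset x f (add_mset j \<alpha>))
      = fold_mset x (y i f) (add_mset j \<alpha>) + pm_scale ?c (x j (fold_mset x f (\<alpha> - {#i#})))
        + (if i = j then fold_mset x f \<alpha> else 0)"
    by (simp add: fold_x y_x add linear_op_add[OF x_linear] linear_op_scale[OF x_linear])
  also have "pm_scale ?c (x j (fold_mset x f (\<alpha> - {#i#}))) = pm_scale ?c (fold_mset x f (add_mset j \<alpha> - {#i#}))"
  proof (cases "i \<in># \<alpha>")
    case True
    then have "add_mset j \<alpha> - {#i#} = add_mset j (\<alpha> - {#i#})"
      by (simp add: diff_add_mset_swap)
    then show ?thesis by (simp add: fold_x)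
  next
    case False
    then show ?thesis by (simp add: not_in_iff)
  qed
  finally show ?case by (simp add: add_ac)
qed

text \<open>Restores normal order after a left multiplication by \<open>y i\<close>, at the price of
  one further monomial.\<close>

lemma y_mon:
  "y i (mon x y \<alpha> \<beta> f)
    = mon x y \<alpha> (add_mset i \<beta>) f + pm_scale (of_nat (count \<alpha> i)) (mon x y (\<alpha> - {#i#}) \<beta> f)"
  by (simp add: mon_def y_fold_x fold_y)

end

interpretation poly: weyl_rep "X_op :: 'i \<Rightarrow> ('i,'k::field_char_0) mpol_op" Y_op
proof
  fix i j and f :: "('i,'k) mpol"
  note lin = X_op_linear Y_op_linear B_X_linear B_Y_linear linear_op_comp linear_op_plus
  show "linear_op (X_op i :: ('i,'k) mpol_op)" "linear_op (Y_op i :: ('i,'k) mpol_op)"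
    by (rule lin)+
  show "X_op i (X_op j f) = X_op j (X_op i f)"
    by (simp add: X_op_def mult.left_commute)
  have *: "m - Poly_Mapping.single j 1 - Poly_Mapping.single i 1
      = m - Poly_Mapping.single i 1 - Poly_Mapping.single j (1::nat)" for m
    by (rule poly_mapping_eqI) (simp add: lookup_minus)
  show "Y_op i (Y_op j f) = Y_op j (Y_op i f)"
  proof (cases "i = j")
    case False
    then have "Y_op i (Y_op j (Poly_Mapping.single m (1::'k))) = Y_op j (Y_op i (Poly_Mapping.single m 1))" for m
      using *[of m] by (simp add: lookup_minus lookup_single mult.commute)
    then show ?thesis
      by (rule linear_op_eqI[OF linear_op_comp[OF lin(2,2)] linear_op_comp[OF lin(2,2)]])
  qed simp
  \<comment> \<open>Exponents are natural numbers, so the two shifts can be exchanged only where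
    \<open>x_i\<close> occurs; otherwise the derivative of the monomial is 0.\<close>
  have sub: "Poly_Mapping.lookup m i \<noteq> 0 \<Longrightarrow>
      m + Poly_Mapping.single j 1 - Poly_Mapping.single i 1 = m - Poly_Mapping.single i 1 + Poly_Mapping.single j (1::nat)" for m
    by (rule poly_mapping_eqI) (auto simp: lookup_minus lookup_add lookup_single when_def)
  have diag: "m + Poly_Mapping.single i 1 - Poly_Mapping.single i (1::nat) = m" for m
    by simp
  have lin_if: "linear_op (\<lambda>f::('i,'k) mpol. if i = j then f else 0)"
    by (auto simp: linear_op_def)
  show "Y_op i (X_op j f) = X_op j (Y_op i f) + (if i = j then f else 0)"
  proof (rule linear_op_eqI[OF linear_op_comp[OF lin(2,1)] linear_op_plus[OF linear_op_comp[OF lin(1,2)] lin_if]])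
    fix m
    show "Y_op i (X_op j (Poly_Mapping.single m (1::'k)))
        = X_op j (Y_op i (Poly_Mapping.single m 1)) + (if i = j then Poly_Mapping.single m 1 else 0)"
    proof (cases "Poly_Mapping.lookup m i = 0")
      case True
      then show ?thesis
        by (auto simp: lookup_add lookup_single linear_op_0[OF X_op_linear])
    next
      case False
      show ?thesis
      proof (cases "i = j")
        case True
        have "m - Poly_Mapping.single i 1 + Poly_Mapping.single i 1 = m"
          by (rule poly_mapping_eqI) (use False in \<open>auto simp: lookup_minus lookup_add lookup_single when_def\<close>)
        then show ?thesis
          using True by (simp add: lookup_add add.commute[of 1] flip: single_add)
      next
        case ij: False
        then show ?thesis
          using sub[OF False] by (simp add: lookup_add lookup_single)
      qed
    qed
  qed
qed

lemma B_weyl_rep: "weyl_rep (B_X :: 'i \<Rightarrow> (('i \<Rightarrow> 'k::field) \<Rightarrow>\<^sub>0 'k) \<Rightarrow> _) B_Y"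
proof
  fix i j and f :: "('i \<Rightarrow> 'k) \<Rightarrow>\<^sub>0 'k"
  note lin = Y_op_linear B_X_linear B_Y_linear linear_op_comp linear_op_plus
  show "linear_op (B_X i :: (('i \<Rightarrow> 'k) \<Rightarrow>\<^sub>0 'k) \<Rightarrow> _)" "linear_op (B_Y i :: (('i \<Rightarrow> 'k) \<Rightarrow>\<^sub>0 'k) \<Rightarrow> _)"
    by (rule lin)+
  show "B_X i (B_X j f) = B_X j (B_X i f)"
    by (rule linear_op_eqI[OF linear_op_comp[OF lin(2,2)] linear_op_comp[OF lin(2,2)]])
      (cases "i = j"; simp add: fun_upd_twist)
  show "B_Y i (B_Y j f) = B_Y j (B_Y i f)"
    by (rule linear_op_eqI[OF linear_op_comp[OF lin(3,3)] linear_op_comp[OF lin(3,3)]])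
      (cases "i = j"; simp add: fun_upd_twist mult.commute)
  have lin_if: "linear_op (\<lambda>f::('i \<Rightarrow> 'k) \<Rightarrow>\<^sub>0 'k. if i = j then f else 0)"
    by (auto simp: linear_op_def)
  show "B_Y i (B_X j f) = B_X j (B_Y i f) + (if i = j then f else 0)"
    by (rule linear_op_eqI[OF linear_op_comp[OF lin(3,2)] linear_op_plus[OF linear_op_comp[OF lin(2,3)] lin_if]])
      (cases "i = j"; simp add: fun_upd_twist distrib_right flip: single_add)
qed

section \<open>Normal forms\<close>

lemma nf_pair_linear:
  fixes x :: "'i \<Rightarrow> ('e \<Rightarrow>\<^sub>0 'k::field_char_0) \<Rightarrow> ('e \<Rightarrow>\<^sub>0 'k)"
  assumes "weyl_rep x y" "nf_pair x y a b"
  shows "linear_op a" "linear_op b"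
proof -
  interpret weyl_rep x y by fact
  show "linear_op a"
    using assms(2)
    by induction (simp_all add: linear_op_plus[OF linear_op_comp[OF linear_op_pm_scale poly.mon_linear]],
      simp add: linear_op_def)
  show "linear_op b"
    using assms(2)
    by induction (simp_all add: linear_op_plus[OF linear_op_comp[OF linear_op_pm_scale mon_linear]],
      simp add: linear_op_def)
qed

lemma nf_pair_add:
  assumes "nf_pair x y a b" "nf_pair x y a' b'"
  shows "nf_pair x y (\<lambda>f. a f + a' f) (\<lambda>f. b f + b' f)"
  using assms(1)
proof induction
  case nf_0
  then show ?case using assms(2) by simp
next
  case (nf_step a b c \<alpha> \<beta>)
  show ?case
    using nf_pair.nf_step[OF nf_step.IH, of c \<alpha> \<beta>] by (simp add: add.assoc)
qed

lemma nf_pair_scale: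
  "nf_pair x y a b \<Longrightarrow> nf_pair x y (\<lambda>f. pm_scale d (a f)) (\<lambda>f. pm_scale d (b f))"
proof (induction rule: nf_pair.induct)
  case nf_0
  then show ?case using nf_pair.nf_0 by simp
next
  case (nf_step a b c \<alpha> \<beta>)
  show ?case
    using nf_pair.nf_step[OF nf_step.IH, of "d * c" \<alpha> \<beta>] by simp
qed

lemma nf_pair_X:
  fixes x :: "'i \<Rightarrow> ('e \<Rightarrow>\<^sub>0 'k::field_char_0) \<Rightarrow> ('e \<Rightarrow>\<^sub>0 'k)"
  assumes "weyl_rep x y" "nf_pair x y a b"
  shows "nf_pair x y (\<lambda>f. X_op i (a f)) (\<lambda>f. x i (b f))"
proof -
  interpret weyl_rep x y by fact
  show ?thesis
    using assms(2)
  proof (induction rule: nf_pair.induct)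
    case nf_0
    then show ?case
      using nf_pair.nf_0[of x y] by (simp add: linear_op_0[OF X_op_linear] linear_op_0[OF x_linear])
  next
    case (nf_step a b c \<alpha> \<beta>)
    show ?case
      using nf_pair.nf_step[OF nf_step.IH, of c "add_mset i \<alpha>" \<beta>]
      by (simp add: linear_op_add[OF X_op_linear] linear_op_scale[OF X_op_linear]
          linear_op_add[OF x_linear] linear_op_scale[OF x_linear] x_mon poly.x_mon)
  qed
qed

lemma nf_pair_Y:
  fixes x :: "'i \<Rightarrow> ('e \<Rightarrow>\<^sub>0 'k::field_char_0) \<Rightarrow> ('e \<Rightarrow>\<^sub>0 'k)"
  assumes "weyl_rep x y" "nf_pair x y a b"
  shows "nf_pair x y (\<lambda>f. Y_op i (a f)) (\<lambda>f. y i (b f))"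
proof -
  interpret weyl_rep x y by fact
  show ?thesis
    using assms(2)
  proof (induction rule: nf_pair.induct)
    case nf_0
    then show ?case
      using nf_pair.nf_0[of x y] by (simp add: linear_op_0[OF Y_op_linear] linear_op_0[OF y_linear])
  next
    case (nf_step a b c \<alpha> \<beta>)
    show ?case
      \<comment> \<open>Two summands are added, as \<open>y_mon\<close> yields two
        monomials.\<close>
      using nf_pair.nf_step[OF nf_pair.nf_step[OF nf_step.IH, of "c * of_nat (count \<alpha> i)" "\<alpha> - {#i#}" \<beta>],
          of c \<alpha> "add_mset i \<beta>"]
      by (simp add: linear_op_add[OF Y_op_linear] linear_op_scale[OF Y_op_linear]
          linear_op_add[OF y_linear] linear_op_scale[OF y_linear] y_mon poly.y_mon add.assoc)
  qed
qed

lemma nf_pair_id: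
  fixes x :: "'i \<Rightarrow> ('e \<Rightarrow>\<^sub>0 'k::field_char_0) \<Rightarrow> ('e \<Rightarrow>\<^sub>0 'k)"
  assumes "weyl_rep x y"
  shows "nf_pair x y (\<lambda>f. f) (\<lambda>f. f)"
proof -
  interpret weyl_rep x y by fact
  show ?thesis
    using nf_pair.nf_step[OF nf_pair.nf_0, of x y 1 "{#}" "{#}"] by simp
qed

text \<open>One set of exponents and one coefficient function serve both components, so that
  independence on the polynomial side controls the other side as well.\<close>

lemma nf_pair_coeffs:
  fixes x :: "'i \<Rightarrow> ('e \<Rightarrow>\<^sub>0 'k::field) \<Rightarrow> ('e \<Rightarrow>\<^sub>0 'k)"
  assumes "nf_pair x y a b"
  obtains K c where "finite K"
    "\<And>f. a f = (\<Sum>k\<in>K. pm_scale (c k) (mon X_op Y_op (fst k) (snd k) f))"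
    "\<And>f. b f = (\<Sum>k\<in>K. pm_scale (c k) (mon x y (fst k) (snd k) f))"
proof -
  have "\<exists>K c. finite K \<and> (\<forall>f. a f = (\<Sum>k\<in>K. pm_scale (c k) (mon X_op Y_op (fst k) (snd k) f))) \<and>
    (\<forall>f. b f = (\<Sum>k\<in>K. pm_scale (c k) (mon x y (fst k) (snd k) f)))"
    using assms
  proof induction
    case nf_0
    then show ?case by (intro exI[of _ "{}"]) simp
  next
    case (nf_step a b d \<alpha> \<beta>)
    then obtain K c where K: "finite K"
      "\<And>f. a f = (\<Sum>k\<in>K. pm_scale (c k) (mon X_op Y_op (fst k) (snd k) f))"
      "\<And>f. b f = (\<Sum>k\<in>K. pm_scale (c k) (mon x y (fst k) (snd k) f))"
      by blast
    let ?k = "(\<alpha>, \<beta>)"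
    define c' where "c' k = (if k \<in> K then c k else 0) + (if k = ?k then d else 0)" for k
    have *: "(\<Sum>k\<in>insert ?k K. pm_scale (c' k) (m k)) = pm_scale d (m ?k) + (\<Sum>k\<in>K. pm_scale (c k) (m k))"
      for m :: "_ \<Rightarrow> ('z \<Rightarrow>\<^sub>0 'k)"
      unfolding c'_def by (rule sum_insert_coeff[OF K(1)])
    have "finite (insert ?k K)" using K(1) by simp
    then show ?case
      using *[of "\<lambda>k. mon X_op Y_op (fst k) (snd k) _"] *[of "\<lambda>k. mon x y (fst k) (snd k) _"] K(2,3)
      by (intro exI[of _ "insert ?k K"] exI[of _ c']) simp
  qed
  then show ?thesis using that by blast
qed

section \<open>Linear independence of the normal-ordered monomials\<close>

abbreviation (input) xmon :: "'i multiset \<Rightarrow> ('i, 'k::field_char_0) mpol" where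
  "xmon \<alpha> \<equiv> fold_mset X_op 1 \<alpha>"

lemma xmon_single: "\<exists>e. xmon \<alpha> = Poly_Mapping.single e 1 \<and> (\<forall>i. Poly_Mapping.lookup e i = count \<alpha> i)"
proof (induction \<alpha>)
  case empty
  then show ?case by (intro exI[of _ 0]) simp
next
  case (add i \<alpha>)
  then obtain e where "xmon \<alpha> = (Poly_Mapping.single e 1 :: ('a, 'b) mpol)" "\<And>i. Poly_Mapping.lookup e i = count \<alpha> i"
    by blast
  then show ?case
    by (intro exI[of _ "e + Poly_Mapping.single i 1"]) (simp add: poly.fold_x lookup_add lookup_single when_def)
qed

lemma Y_op_one: "Y_op i 1 = (0 :: ('i, 'k::field_char_0) mpol)"
  using Y_op_single[of i 0 1] by simp

text \<open>Iterated differentiation of a monomial. The scalar is a product of falling factorials;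
  in characteristic 0 it vanishes only when some exponent of \<open>\<gamma>\<close> exceeds that of
  \<open>\<beta>\<close>.\<close>

lemma fold_Y_xmon:
  "\<exists>c. fold_mset Y_op (xmon \<beta>) \<gamma> = pm_scale c (xmon (\<beta> - \<gamma>)) \<and> (c \<noteq> (0 :: 'k::field_char_0) \<longleftrightarrow> \<gamma> \<subseteq># \<beta>)"
proof (induction \<gamma>)
  case empty
  then show ?case by (intro exI[of _ 1]) simp
next
  case (add i \<gamma>)
  then obtain c where c: "fold_mset Y_op (xmon \<beta>) \<gamma> = pm_scale c (xmon (\<beta> - \<gamma>))" "c \<noteq> (0 :: 'k) \<longleftrightarrow> \<gamma> \<subseteq># \<beta>"
    by blast
  have z: "fold_mset X_op 0 \<gamma> = (0 :: ('a, 'k) mpol)" for \<gamma> :: "'a multiset"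
    using linear_op_0[OF poly.fold_linear(1)] .
  have "add_mset i \<gamma> \<subseteq># \<beta> \<longleftrightarrow> \<gamma> \<subseteq># \<beta> \<and> count (\<beta> - \<gamma>) i \<noteq> 0"
  proof (intro iffI conjI)
    assume *: "add_mset i \<gamma> \<subseteq># \<beta>"
    then show "\<gamma> \<subseteq># \<beta>"
      by (meson mset_subset_eq_insertD subset_mset.less_imp_le)
    show "count (\<beta> - \<gamma>) i \<noteq> 0"
      using mset_subset_eq_count[OF *, of i] by simp
  next
    assume *: "\<gamma> \<subseteq># \<beta> \<and> count (\<beta> - \<gamma>) i \<noteq> 0"
    show "add_mset i \<gamma> \<subseteq># \<beta>"
    proof (rule mset_subset_eqI)
      fix j
      show "count (add_mset i \<gamma>) j \<le> count \<beta> j"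
        using * mset_subset_eq_count[of \<gamma> \<beta> j] by (cases "i = j") auto
    qed
  qed
  then show ?case
    by (intro exI[of _ "c * of_nat (count (\<beta> - \<gamma>) i)"])
      (simp add: poly.fold_y c linear_op_scale[OF Y_op_linear] poly.y_fold_x Y_op_one z diff_diff_add)
qed

text \<open>Apply the relation to \<open>x^\<beta>0\<close>, where \<open>\<beta>0\<close> has least
  size among the right exponents with nonzero coefficient. Any other such \<open>\<beta>\<close> is
  not contained in \<open>\<beta>0\<close>, so \<open>Y^\<beta>\<close> kills
  \<open>x^\<beta>0\<close>; the terms with \<open>\<beta>0\<close> itself give distinct monomials
  \<open>x^\<alpha>\<close>, and the coefficient at \<open>\<alpha>0\<close> isolates
  \<open>c k0\<close>.\<close>

lemma mon_independent:
  fixes c :: "'i multiset \<times> 'i multiset \<Rightarrow> 'k::field_char_0"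
  assumes fin: "finite K"
    and zero: "\<And>f. (\<Sum>k\<in>K. pm_scale (c k) (mon X_op Y_op (fst k) (snd k) f)) = 0"
    and "k \<in> K"
  shows "c k = 0"
proof (rule ccontr)
  assume "c k \<noteq> 0"
  with \<open>k \<in> K\<close> have "k \<in> {k \<in> K. c k \<noteq> 0}" by simp
  then obtain k0 where k0: "k0 \<in> K" "c k0 \<noteq> 0" and
    min: "\<And>k. k \<in> K \<Longrightarrow> c k \<noteq> 0 \<Longrightarrow> size (snd k0) \<le> size (snd k)"
    using ex_has_least_nat[of "\<lambda>k. k \<in> {k \<in> K. c k \<noteq> 0}" k "\<lambda>k. size (snd k)"] by auto
  obtain \<alpha>0 \<beta>0 where k0_eq: "k0 = (\<alpha>0, \<beta>0)" by (cases k0)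
  obtain d where d: "fold_mset Y_op (xmon \<beta>0) \<beta>0 = pm_scale d (1 :: ('i, 'k) mpol)" "d \<noteq> 0"
    using fold_Y_xmon[of \<beta>0 \<beta>0] by auto
  obtain e where e: "xmon \<alpha>0 = (Poly_Mapping.single e 1 :: ('i, 'k) mpol)" "\<And>i. Poly_Mapping.lookup e i = count \<alpha>0 i"
    using xmon_single by blast
  have coeff: "Poly_Mapping.lookup (pm_scale (c k) (mon X_op Y_op (fst k) (snd k) (xmon \<beta>0))) e
      = (if k = k0 then c k0 * d else 0)" if "k \<in> K" for k
  proof (cases "c k = 0")
    case True
    then show ?thesis using k0 by auto
  next
    case False
    obtain \<alpha> \<beta> where k: "k = (\<alpha>, \<beta>)" by (cases k)
    have size: "size \<beta>0 \<le> size \<beta>" using min[OF that False] by (simp add: k k0_eq)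
    show ?thesis
    proof (cases "\<beta> = \<beta>0")
      case True
      obtain e' where e': "xmon \<alpha> = (Poly_Mapping.single e' 1 :: ('i, 'k) mpol)" "\<And>i. Poly_Mapping.lookup e' i = count \<alpha> i"
        using xmon_single by blast
      have "e' = e \<longleftrightarrow> \<alpha> = \<alpha>0"
        using e(2) e'(2) by (metis multiset_eqI poly_mapping_eqI)
      moreover have "mon X_op Y_op \<alpha> \<beta> (xmon \<beta>0) = pm_scale d (xmon \<alpha>)"
        unfolding mon_def True d(1) by (rule linear_op_scale[OF poly.fold_linear(1)])
      ultimately show ?thesis
        using True by (auto simp: k k0_eq e' lookup_single when_def)
    next
      case False
      then have "\<not> \<beta> \<subseteq># \<beta>0"
        using size by (meson mset_subset_size subset_mset.le_imp_less_or_eq leD)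
      then have "fold_mset Y_op (xmon \<beta>0) \<beta> = (0 :: ('i, 'k) mpol)"
        using fold_Y_xmon[of \<beta>0 \<beta>] by auto
      then show ?thesis
        using False by (simp add: k k0_eq mon_def linear_op_0[OF poly.fold_linear(1)])
    qed
  qed
  have "0 = Poly_Mapping.lookup (\<Sum>k\<in>K. pm_scale (c k) (mon X_op Y_op (fst k) (snd k) (xmon \<beta>0))) e"
    by (simp only: zero lookup_zero)
  also have "\<dots> = (\<Sum>k\<in>K. if k = k0 then c k0 * d else 0)"
    unfolding lookup_sum by (rule sum.cong) (use coeff in auto)
  also have "\<dots> = c k0 * d" using fin k0(1) by simp
  finally show False using k0(2) d(2) by simp
qed

text \<open>The homomorphism to the representation is well defined. By linearity only the zero
  operator matters, and its coefficients vanish by independence.\<close>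

lemma nf_pair_unique:
  fixes x :: "'i \<Rightarrow> ('e \<Rightarrow>\<^sub>0 'k::field_char_0) \<Rightarrow> ('e \<Rightarrow>\<^sub>0 'k)"
  assumes "nf_pair x y a b" "nf_pair x y a b'"
  shows "b = b'"
proof -
  have "nf_pair x y (\<lambda>f. a f + pm_scale (-1) (a f)) (\<lambda>f. b f + pm_scale (-1) (b' f))"
    by (intro nf_pair_add nf_pair_scale assms)
  from this obtain K c where K: "finite K"
    "\<And>f. a f + pm_scale (-1) (a f) = (\<Sum>k\<in>K. pm_scale (c k) (mon X_op Y_op (fst k) (snd k) f))"
    "\<And>f. b f + pm_scale (-1) (b' f) = (\<Sum>k\<in>K. pm_scale (c k) (mon x y (fst k) (snd k) f))"
    using nf_pair_coeffs by blast
  have cancel: "g + pm_scale (-1) h = g - h" for g h :: "'z \<Rightarrow>\<^sub>0 'k"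
    by (simp add: pm_scale_minus)
  have "(\<Sum>k\<in>K. pm_scale (c k) (mon X_op Y_op (fst k) (snd k) f)) = 0" for f
    using K(2)[of f] cancel[of "a f" "a f"] by simp
  then have "c k = 0" if "k \<in> K" for k
    using mon_independent[OF K(1) _ that] by blast
  then have "b f = b' f" for f
    using K(3)[of f] cancel[of "b f" "b' f"] by simp
  then show ?thesis by blast
qed

section \<open>The Weyl algebra\<close>

lemma End_ring_simps:
  "carrier End_ring = {T. linear_op T}" "S \<otimes>\<^bsub>End_ring\<^esub> T = (\<lambda>f. S (T f))" "\<one>\<^bsub>End_ring\<^esub> = (\<lambda>f. f)"
  "\<zero>\<^bsub>End_ring\<^esub> = (\<lambda>_. 0)" "S \<oplus>\<^bsub>End_ring\<^esub> T = (\<lambda>f. S f + T f)"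
  by (auto simp: End_ring_def linear_op_def id_def o_def)

lemma ring_End: "ring (End_ring :: ('i, 'k::field) mpol_op ring)"
proof (intro ringI abelian_groupI monoidI)
  fix T assume "T \<in> carrier (End_ring :: ('i, 'k) mpol_op ring)"
  then show "\<exists>S\<in>carrier End_ring. S \<oplus>\<^bsub>End_ring\<^esub> T = \<zero>\<^bsub>End_ring\<^esub>"
    by (intro bexI[of _ "\<lambda>f. - T f"]) (auto simp: End_ring_simps linear_op_uminus)
qed (auto simp: End_ring_simps linear_op_add linear_op_plus linear_op_comp add_ac, auto simp: linear_op_def)

lemma End_minus: "linear_op T \<Longrightarrow> \<ominus>\<^bsub>End_ring\<^esub> T = (\<lambda>f. - T f)"
  using ring.ring_simprules ring_End
  by (intro abelian_group.minus_equality[OF ring.is_abelian_group[OF ring_End]])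
    (auto simp: End_ring_simps linear_op_uminus)

abbreviation "weyl_gens \<equiv> {scal c |c. True} \<union> {X_op i |i. True} \<union> {Y_op i |i. True}"

lemma weyl_gens_linear: "weyl_gens \<subseteq> carrier End_ring"
  by (auto simp: End_ring_simps scal_def linear_op_pm_scale X_op_linear Y_op_linear B_X_linear B_Y_linear)

lemma weyl_simps [simp]:
  "S \<otimes>\<^bsub>weyl\<^esub> T = (\<lambda>f. S (T f))" "\<one>\<^bsub>weyl\<^esub> = (\<lambda>f. f)"
  "\<zero>\<^bsub>weyl\<^esub> = (\<lambda>_. 0)" "S \<oplus>\<^bsub>weyl\<^esub> T = (\<lambda>f. S f + T f)"
  by (auto simp: weyl_def End_ring_simps)

lemma ring_weyl: "ring weyl"
  unfolding weyl_def by (rule ring.generate_ring_is_ring[OF ring_End weyl_gens_linear])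

lemma weyl_linear: "a \<in> carrier weyl \<Longrightarrow> linear_op a"
  using ring.generate_ring_in_carrier[OF ring_End weyl_gens_linear] by (auto simp: weyl_def End_ring_simps)

lemma weyl_closed [simp, intro]:
  "scal c \<in> carrier weyl" "X_op i \<in> carrier weyl" "Y_op i \<in> carrier weyl"
  "(\<lambda>f. f) \<in> carrier weyl" "(\<lambda>f. 0) \<in> carrier weyl"
  "a \<in> carrier weyl \<Longrightarrow> b \<in> carrier weyl \<Longrightarrow> (\<lambda>f. a (b f)) \<in> carrier weyl"
  "a \<in> carrier weyl \<Longrightarrow> b \<in> carrier weyl \<Longrightarrow> (\<lambda>f. a f + b f) \<in> carrier weyl"
proof -
  show "scal c \<in> carrier weyl" "X_op i \<in> carrier weyl" "Y_op i \<in> carrier weyl"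
    by (auto simp: weyl_def intro!: generate_ring.incl)
  show "(\<lambda>f. f) \<in> carrier weyl" "(\<lambda>f. 0) \<in> carrier weyl"
    using ring.ring_simprules(2,6)[OF ring_weyl] by simp_all
  show "a \<in> carrier weyl \<Longrightarrow> b \<in> carrier weyl \<Longrightarrow> (\<lambda>f. a (b f)) \<in> carrier weyl"
    "a \<in> carrier weyl \<Longrightarrow> b \<in> carrier weyl \<Longrightarrow> (\<lambda>f. a f + b f) \<in> carrier weyl"
    using ring.ring_simprules(1,5)[OF ring_weyl, of a b] by simp_all
qed

lemma weyl_pm_scale: "a \<in> carrier weyl \<Longrightarrow> (\<lambda>f. pm_scale c (a f)) \<in> carrier weyl"
  using weyl_closed(6)[OF weyl_closed(1)] by (simp add: scal_def)

lemma weyl_uminus: "a \<in> carrier weyl \<Longrightarrow> (\<lambda>f. - a f) \<in> carrier weyl"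
  using weyl_pm_scale[of a "-1"] by (simp add: pm_scale_minus)

lemma weyl_minus: "a \<in> carrier weyl \<Longrightarrow> \<ominus>\<^bsub>weyl\<^esub> a = (\<lambda>f. - a f)"
  by (intro abelian_group.minus_equality[OF ring.is_abelian_group[OF ring_weyl]])
    (auto simp: weyl_uminus)

text \<open>The identity and the negatives in the generated ring are covered by the scalars 1 and
  -1.\<close>

lemma weyl_induct [consumes 1, case_names scal X Y add mult]:
  assumes "a \<in> carrier weyl"
    and "\<And>c. P (scal c)" "\<And>i. P (X_op i)" "\<And>i. P (Y_op i)"
    and add: "\<And>a b. a \<in> carrier weyl \<Longrightarrow> b \<in> carrier weyl \<Longrightarrow> P a \<Longrightarrow> P b \<Longrightarrow> P (\<lambda>f. a f + b f)"
    and mult: "\<And>a b. a \<in> carrier weyl \<Longrightarrow> b \<in> carrier weyl \<Longrightarrow> P a \<Longrightarrow> P b \<Longrightarrow> P (\<lambda>f. a (b f))"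
  shows "P a"
proof -
  have "a \<in> generate_ring End_ring weyl_gens" using assms(1) by (simp add: weyl_def)
  then have "a \<in> carrier weyl \<and> P a"
  proof induction
    case one
    have "scal 1 = (\<lambda>f::('a, 'b) mpol. f)" by (simp add: scal_def fun_eq_iff)
    then show ?case using assms(2)[of 1] by (simp add: End_ring_simps)
  next
    case (incl h)
    then show ?case using assms(2-4) by auto
  next
    case (a_inv h)
    then show ?case
      using mult[OF weyl_closed(1)[of "-1"], of h] assms(2)[of "-1"]
      by (auto simp: End_minus weyl_linear weyl_uminus scal_def pm_scale_minus)
  next
    case (eng_add h1 h2)
    then show ?case using add by (auto simp: End_ring_simps)
  next
    case (eng_mult h1 h2)
    then show ?case using mult by (auto simp: End_ring_simps)
  qed
  then show ?thesis ..
qed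


section \<open>The universal property of the Weyl algebra\<close>

text \<open>Quantifying over all pairs lets the operators of two factors be composed; knowing only
  the operator paired with \<open>a\<close> would not settle the product of \<open>a\<close> with a
  further element.\<close>

lemma nf_pair_left_ex:
  fixes x :: "'i \<Rightarrow> ('e \<Rightarrow>\<^sub>0 'k::field_char_0) \<Rightarrow> ('e \<Rightarrow>\<^sub>0 'k)"
  assumes "weyl_rep x y" "a \<in> carrier weyl"
  shows "\<exists>b. \<forall>a' b'. nf_pair x y a' b' \<longrightarrow> nf_pair x y (\<lambda>f. a (a' f)) (\<lambda>f. b (b' f))"
  using assms(2)
proof (induction rule: weyl_induct)
  case (scal c)
  then show ?case using nf_pair_scale unfolding scal_def by blast
next
  case (X i)
  then show ?case using nf_pair_X[OF assms(1)] by blast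
next
  case (Y i)
  then show ?case using nf_pair_Y[OF assms(1)] by blast
next
  case (add a1 a2)
  then obtain b1 b2 where
    "\<And>a' b'. nf_pair x y a' b' \<Longrightarrow> nf_pair x y (\<lambda>f. a1 (a' f)) (\<lambda>f. b1 (b' f))"
    "\<And>a' b'. nf_pair x y a' b' \<Longrightarrow> nf_pair x y (\<lambda>f. a2 (a' f)) (\<lambda>f. b2 (b' f))"
    by blast
  then show ?case
    by (intro exI[of _ "\<lambda>f. b1 f + b2 f"]) (simp add: nf_pair_add)
next
  case (mult a1 a2)
  then obtain b1 b2 where
    *: "\<And>a' b'. nf_pair x y a' b' \<Longrightarrow> nf_pair x y (\<lambda>f. a1 (a' f)) (\<lambda>f. b1 (b' f))"
    "\<And>a' b'. nf_pair x y a' b' \<Longrightarrow> nf_pair x y (\<lambda>f. a2 (a' f)) (\<lambda>f. b2 (b' f))"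
    by blast
  show ?case
    by (intro exI[of _ "\<lambda>f. b1 (b2 f)"]) (simp add: *(1)[OF *(2)])
qed

definition weyl_lift ::
  "('i \<Rightarrow> ('e \<Rightarrow>\<^sub>0 'k::field) \<Rightarrow> ('e \<Rightarrow>\<^sub>0 'k)) \<Rightarrow> ('i \<Rightarrow> ('e \<Rightarrow>\<^sub>0 'k) \<Rightarrow> ('e \<Rightarrow>\<^sub>0 'k)) \<Rightarrow>
    ('i, 'k) mpol_op \<Rightarrow> ('e \<Rightarrow>\<^sub>0 'k) \<Rightarrow> ('e \<Rightarrow>\<^sub>0 'k)" where
  "weyl_lift x y a = (THE b. nf_pair x y a b)"

context
  fixes x y :: "'i \<Rightarrow> ('e \<Rightarrow>\<^sub>0 'k::field_char_0) \<Rightarrow> ('e \<Rightarrow>\<^sub>0 'k)"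
  assumes rep: "weyl_rep x y"
begin

lemma weyl_lift_eqI: "nf_pair x y a b \<Longrightarrow> weyl_lift x y a = b"
  unfolding weyl_lift_def by (rule the_equality) (auto intro: nf_pair_unique)

lemma weyl_lift_left:
  assumes "a \<in> carrier weyl" "nf_pair x y a' b'"
  shows "nf_pair x y (\<lambda>f. a (a' f)) (\<lambda>f. weyl_lift x y a (b' f))"
proof -
  from nf_pair_left_ex[OF rep assms(1)] obtain b where
    b: "\<And>a' b'. nf_pair x y a' b' \<Longrightarrow> nf_pair x y (\<lambda>f. a (a' f)) (\<lambda>f. b (b' f))"
    by blast
  \<comment> \<open>Evaluation on the identity pair shows that the operator \<open>b\<close>, which
    works for all pairs, is the lift.\<close>
  have "weyl_lift x y a = b"
    using weyl_lift_eqI[OF b[OF nf_pair_id[OF rep]]] by simp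
  with b[OF assms(2)] show ?thesis by simp
qed

lemma nf_pair_weyl_lift: "a \<in> carrier weyl \<Longrightarrow> nf_pair x y a (weyl_lift x y a)"
  using weyl_lift_left[OF _ nf_pair_id[OF rep]] by simp

lemma weyl_lift_mult:
  "a \<in> carrier weyl \<Longrightarrow> b \<in> carrier weyl \<Longrightarrow>
    weyl_lift x y (\<lambda>f. a (b f)) = (\<lambda>f. weyl_lift x y a (weyl_lift x y b f))"
  by (intro weyl_lift_eqI weyl_lift_left nf_pair_weyl_lift)

lemma weyl_lift_add:
  "a \<in> carrier weyl \<Longrightarrow> b \<in> carrier weyl \<Longrightarrow>
    weyl_lift x y (\<lambda>f. a f + b f) = (\<lambda>f. weyl_lift x y a f + weyl_lift x y b f)"
  by (intro weyl_lift_eqI nf_pair_add nf_pair_weyl_lift)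

lemma weyl_lift_gens [simp]:
  "weyl_lift x y (scal c) = pm_scale c" "weyl_lift x y (X_op i) = x i" "weyl_lift x y (Y_op i) = y i"
  "weyl_lift x y (\<lambda>f. f) = (\<lambda>f. f)"
  using nf_pair_scale[OF nf_pair_id[OF rep]] nf_pair_X[OF rep nf_pair_id[OF rep]] nf_pair_Y[OF rep nf_pair_id[OF rep]]
  by (auto intro!: weyl_lift_eqI nf_pair_id[OF rep] simp: scal_def)

lemma weyl_lift_linear: "a \<in> carrier weyl \<Longrightarrow> linear_op (weyl_lift x y a)"
  by (rule nf_pair_linear(2)[OF rep nf_pair_weyl_lift])

end

section \<open>The automorphisms and the anti-automorphism\<close>

text \<open>The minus sign preserves the relation: the commutator of \<open>- X_op j\<close> with
  \<open>Y_op j\<close> is 1.\<close>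

lemma theta_weyl_rep:
  "weyl_rep (\<lambda>i. if i \<in> J then Y_op i else X_op i)
    (\<lambda>i. if i \<in> J then (\<lambda>f. - X_op i f) else (Y_op i :: ('i, 'k::field_char_0) mpol_op))"
  by unfold_locales
    (auto simp: X_op_linear Y_op_linear B_X_linear B_Y_linear linear_op_uminus poly.x_comm poly.y_comm poly.y_x
      linear_op_minus[OF X_op_linear] linear_op_minus[OF Y_op_linear])

lemma theta_ex:
  "\<exists>\<phi>. \<phi> \<in> ring_iso weyl weyl \<and> (\<forall>c. \<phi> (scal c) = scal c) \<and>
    (\<forall>j\<in>J. \<phi> (X_op j) = Y_op j \<and> \<phi> (Y_op j) = \<ominus>\<^bsub>weyl\<^esub> X_op j) \<and>
    (\<forall>i. i \<notin> J \<longrightarrow> \<phi> (X_op i) = X_op i \<and> \<phi> (Y_op i) = (Y_op i :: ('i, 'k::field_char_0) mpol_op))"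
proof -
  let ?x = "\<lambda>i. if i \<in> J then Y_op i else (X_op i :: ('i, 'k) mpol_op)"
  let ?y = "\<lambda>i. if i \<in> J then (\<lambda>f. - X_op i f) else (Y_op i :: ('i, 'k) mpol_op)"
  define T where "T = weyl_lift ?x ?y"
  note rep = theta_weyl_rep[of J, where 'k='k]
  note T_simps = weyl_lift_gens[OF rep, folded T_def]
  note T_add = weyl_lift_add[OF rep, folded T_def]
  note T_mult = weyl_lift_mult[OF rep, folded T_def]
  have closed: "T a \<in> carrier weyl" if "a \<in> carrier weyl" for a
    using that by (induction rule: weyl_induct)
      (auto simp: T_simps T_add T_mult weyl_uminus simp flip: scal_def)
  have minus: "(\<lambda>f. - a f) = (\<lambda>f. scal (-1) (a f))" for a :: "('i, 'k) mpol_op"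
    by (simp add: scal_def pm_scale_minus)
  have T_minus: "T (\<lambda>f. - a f) = (\<lambda>f. - T a f)" if "a \<in> carrier weyl" for a
    using T_mult[OF weyl_closed(1)[of "-1"] that] unfolding minus T_simps(1) by (simp add: scal_def)
  \<comment> \<open>The square of \<open>T\<close> changes the sign of \<open>X_op j\<close> and
    \<open>Y_op j\<close> for \<open>j\<close> in \<open>J\<close> and fixes the other generators.
    Hence the cube of \<open>T\<close> is its inverse.\<close>
  have order4: "T (T (T (T a))) = a" if "a \<in> carrier weyl" for a
    using that by (induction rule: weyl_induct)
      (auto simp: T_simps T_add T_mult T_minus closed simp flip: scal_def)
  have "bij_betw T (carrier weyl) (carrier weyl)"
    by (rule bij_betw_byWitness[of _ "\<lambda>a. T (T (T a))"]) (auto simp: closed order4)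
  then have "T \<in> ring_iso weyl weyl"
    by (intro ring_iso_memI) (auto simp: closed T_add T_mult T_simps bij_betw_def)
  then show ?thesis
    by (intro exI[of _ T]) (auto simp: T_simps weyl_minus simp flip: scal_def)
qed

lemma theta_spec:
  fixes J :: "'i set"
  defines "\<phi> \<equiv> (theta J :: ('i, 'k::field_char_0) mpol_op \<Rightarrow> _)"
  shows "\<phi> \<in> ring_iso weyl weyl" "\<phi> (scal c) = scal c"
    "j \<in> J \<Longrightarrow> \<phi> (X_op j) = Y_op j" "j \<in> J \<Longrightarrow> \<phi> (Y_op j) = (\<lambda>f. - X_op j f)"
    "i \<notin> J \<Longrightarrow> \<phi> (X_op i) = X_op i" "i \<notin> J \<Longrightarrow> \<phi> (Y_op i) = Y_op i"
  using someI_ex[OF theta_ex[of J, where 'k='k]] unfolding \<phi>_def theta_def[symmetric]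
  by (auto simp: weyl_minus)

section \<open>The factorial form on polynomials and adjoint operators\<close>

definition exp_fact :: "('i \<Rightarrow>\<^sub>0 nat) \<Rightarrow> 'k::field_char_0" where
  "exp_fact m = (\<Prod>i\<in>Poly_Mapping.keys m. fact (Poly_Mapping.lookup m i))"

lemma exp_fact_nonzero: "exp_fact m \<noteq> 0"
  by (simp add: exp_fact_def)

text \<open>The factor by which the multi-index factorial grows is the coefficient produced by
  differentiation; this is why factorials make \<open>X_op i\<close> and \<open>Y_op i\<close>
  adjoint.\<close>

lemma exp_fact_single:
  "exp_fact (m + Poly_Mapping.single i 1)
    = (of_nat (Poly_Mapping.lookup m i) + 1) * (exp_fact m :: 'k::field_char_0)"
proof -
  let ?K = "insert i (Poly_Mapping.keys m)" and ?n = "m + Poly_Mapping.single i 1"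
  have keys: "Poly_Mapping.keys ?n = ?K"
    by (auto simp: in_keys_iff lookup_add lookup_single when_def split: if_splits)
  have "exp_fact m = (\<Prod>j\<in>?K. fact (Poly_Mapping.lookup m j) :: 'k)"
    unfolding exp_fact_def by (rule prod.mono_neutral_left) (auto simp: in_keys_iff)
  moreover have "(\<Prod>j\<in>?K. fact (Poly_Mapping.lookup ?n j) :: 'k)
      = (of_nat (Poly_Mapping.lookup m i) + 1) * (\<Prod>j\<in>?K. fact (Poly_Mapping.lookup m j))"
  proof -
    have "(\<Prod>j\<in>Poly_Mapping.keys m - {i}. fact (Poly_Mapping.lookup ?n j) :: 'k)
        = (\<Prod>j\<in>Poly_Mapping.keys m - {i}. fact (Poly_Mapping.lookup m j))"
      by (rule prod.cong) (auto simp: lookup_add lookup_single)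
    then show ?thesis
      by (simp add: prod.insert_remove) (simp add: lookup_add algebra_simps)
  qed
  ultimately show ?thesis unfolding exp_fact_def keys by (simp only:)
qed

text \<open>For this form \<open>X\<^sub>i\<close> and \<open>Y\<^sub>i\<close> are adjoint, so \<open>\<diamond>\<close> is taking adjoints.\<close>

definition mform :: "('i, 'k::field_char_0) mpol \<Rightarrow> ('i, 'k) mpol \<Rightarrow> 'k" where
  "mform f g = (\<Sum>m\<in>Poly_Mapping.keys f. Poly_Mapping.lookup f m * (exp_fact m * Poly_Mapping.lookup g m))"

lemma mform_superset:
  "finite K \<Longrightarrow> Poly_Mapping.keys f \<subseteq> K \<Longrightarrow>
    mform f g = (\<Sum>m\<in>K. Poly_Mapping.lookup f m * (exp_fact m * Poly_Mapping.lookup g m))"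
  unfolding mform_def by (rule sum.mono_neutral_left) (auto simp: in_keys_iff)

lemma mform_sym: "mform f g = mform g f"
  by (simp add: mform_superset[of "Poly_Mapping.keys f \<union> Poly_Mapping.keys g"] mult_ac)

lemma mform_add_right: "mform f (g + h) = mform f g + mform f h"
  by (simp add: mform_def lookup_add algebra_simps sum.distrib)

lemma mform_add_left: "mform (g + h) f = mform g f + mform h f"
  by (metis mform_add_right mform_sym)

lemma mform_scale_right: "mform f (pm_scale c g) = c * mform f g"
  by (simp add: mform_def sum_distrib_left mult_ac)

lemma mform_scale_left: "mform (pm_scale c g) f = c * mform g f"
  by (metis mform_scale_right mform_sym)

lemma mform_single: "mform (Poly_Mapping.single m 1) g = exp_fact m * Poly_Mapping.lookup g m"
  by (subst mform_superset[of "{m}"]) auto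

lemma mform_sum_left: "mform (sum h K) g = (\<Sum>k\<in>K. mform (h k) g)"
  by (induction K rule: infinite_finite_induct) (auto simp: mform_add_left mform_def[of 0])

text \<open>Nondegeneracy: testing against \<open>x^m\<close> returns \<open>m!\<close> times the
  coefficient at \<open>m\<close>, and \<open>m!\<close> is nonzero in characteristic 0.\<close>

lemma mform_eqI: "(\<And>f. mform f g = mform f h) \<Longrightarrow> g = h"
  by (rule poly_mapping_eqI) (metis exp_fact_nonzero mform_single mult_left_cancel)

lemma lookup_Y_op:
  "Poly_Mapping.lookup (Y_op i g) m
    = (of_nat (Poly_Mapping.lookup m i) + 1) * Poly_Mapping.lookup g (m + Poly_Mapping.single i 1)"
proof -
  let ?n = "m + Poly_Mapping.single i 1"
  \<comment> \<open>Truncated subtraction is injective only on exponents in which \<open>i\<close>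
    occurs; the remaining terms have coefficient 0.\<close>
  have *: "n = ?n \<longleftrightarrow> n - Poly_Mapping.single i 1 = m" if "Poly_Mapping.lookup n i \<noteq> 0" for n
    using that by (auto intro!: poly_mapping_eqI simp: lookup_add lookup_minus lookup_single when_def)
  have "Poly_Mapping.lookup (Y_op i g) m = (\<Sum>n\<in>Poly_Mapping.keys g.
      if n = ?n then of_nat (Poly_Mapping.lookup n i) * Poly_Mapping.lookup g n else 0)"
    unfolding Y_op_def lookup_sum
  proof (rule sum.cong[OF refl])
    fix n
    show "Poly_Mapping.lookup (Poly_Mapping.single (n - Poly_Mapping.single i 1)
        (of_nat (Poly_Mapping.lookup n i) * Poly_Mapping.lookup g n)) m
      = (if n = ?n then of_nat (Poly_Mapping.lookup n i) * Poly_Mapping.lookup g n else 0)"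
      using *[of n] by (cases "Poly_Mapping.lookup n i = 0") (auto simp: lookup_single when_def)
  qed
  also have "\<dots> = of_nat (Poly_Mapping.lookup ?n i) * Poly_Mapping.lookup g ?n"
    by (simp add: sum.delta in_keys_iff)
  finally show ?thesis by (simp add: lookup_add add.commute)
qed

lemma mform_X_Y: "mform (X_op i f) g = mform f (Y_op i g)"
proof -
  have "mform (X_op i f) g
      = (\<Sum>m\<in>Poly_Mapping.keys f. Poly_Mapping.lookup f m * mform (X_op i (Poly_Mapping.single m 1)) g)"
    by (subst linear_op_apply[OF X_op_linear]) (simp only: mform_sum_left mform_scale_left)
  also have "\<dots> = mform f (Y_op i g)"
    unfolding mform_def[of f]
    by (rule sum.cong) (simp_all only: X_op_single mform_single exp_fact_single lookup_Y_op mult_ac)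
  finally show ?thesis .
qed

text \<open>Adjoints reverse products, are unique by nondegeneracy and mutual by symmetry of the
  form. So taking adjoints is an involutive anti-automorphism once each element of \<open>A\<close>
  has an adjoint in \<open>A\<close>, which follows from the generators.\<close>

lemma diamond_ex:
  "\<exists>\<phi>. \<phi> \<in> ring_iso weyl (weyl\<lparr>mult := (\<lambda>a b. b \<otimes>\<^bsub>weyl\<^esub> a)\<rparr>) \<and>
    (\<forall>a\<in>carrier weyl. \<phi> (\<phi> a) = a) \<and> (\<forall>c. \<phi> (scal c) = scal c) \<and>
    (\<forall>i. \<phi> (X_op i) = Y_op i \<and> \<phi> (Y_op i) = (X_op i :: ('i, 'k::field_char_0) mpol_op))"
proof -
  define adj where "adj a b \<longleftrightarrow> (\<forall>f g. mform (a f) g = mform f (b g))" for a b :: "('i, 'k) mpol_op"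
  define D where "D a = (THE b. adj a b)" for a :: "('i, 'k) mpol_op"
  have D_eqI: "D a = b" if "adj a b" for a b
    unfolding D_def
  proof (rule the_equality)
    fix b' assume "adj a b'"
    then show "b' = b" using that unfolding adj_def by (metis mform_eqI ext)
  qed fact
  have gens: "adj (scal c) (scal c)" "adj (X_op i) (Y_op i)" "adj (Y_op i) (X_op i)" for c i
    by (simp_all add: adj_def scal_def mform_scale_left mform_scale_right mform_X_Y)
      (metis mform_X_Y mform_sym)
  have adj_add: "adj (\<lambda>f. a f + a' f) (\<lambda>f. b f + b' f)" and adj_mult: "adj (\<lambda>f. a (a' f)) (\<lambda>f. b' (b f))"
    if "adj a b" "adj a' b'" for a a' b b'
    using that by (simp_all add: adj_def mform_add_left mform_add_right)
  have adj_sym: "adj b a" if "adj a b" for a b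
    using that unfolding adj_def by (metis mform_sym)
  have "\<exists>b\<in>carrier weyl. adj a b" if "a \<in> carrier weyl" for a
    using that
  proof (induction rule: weyl_induct)
    case (add a b)
    then show ?case using adj_add by blast
  next
    case (mult a b)
    then show ?case using adj_mult by (metis weyl_closed(6))
  qed (use gens in blast)+
  then have adj_D: "adj a (D a)" and D_closed: "D a \<in> carrier weyl" if "a \<in> carrier weyl" for a
    using that D_eqI by metis+
  have invol: "D (D a) = a" if "a \<in> carrier weyl" for a
    by (rule D_eqI[OF adj_sym[OF adj_D[OF that]]])
  have "bij_betw D (carrier weyl) (carrier weyl)"
    by (rule bij_betw_byWitness[of _ D]) (auto simp: D_closed invol)
  moreover have "adj (\<lambda>f. f) (\<lambda>f. f)" by (simp add: adj_def)
  ultimately have "D \<in> ring_iso weyl (weyl\<lparr>mult := (\<lambda>a b. b \<otimes>\<^bsub>weyl\<^esub> a)\<rparr>)"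
    by (intro ring_iso_memI) (auto simp: D_closed adj_D adj_add adj_mult intro!: D_eqI)
  then show ?thesis
    using gens invol D_eqI by (intro exI[of _ D]) blast
qed

lemma diamond_spec:
  fixes a b :: "('i, 'k::field_char_0) mpol_op"
  shows "a \<in> carrier weyl \<Longrightarrow> diamond a \<in> carrier weyl"
    "a \<in> carrier weyl \<Longrightarrow> diamond (diamond a) = a"
    "a \<in> carrier weyl \<Longrightarrow> b \<in> carrier weyl \<Longrightarrow> diamond (\<lambda>f. a (b f)) = (\<lambda>f. diamond b (diamond a f))"
    "a \<in> carrier weyl \<Longrightarrow> b \<in> carrier weyl \<Longrightarrow> diamond (\<lambda>f. a f + b f) = (\<lambda>f. diamond a f + diamond b f)"
    "diamond (\<lambda>f. f) = (\<lambda>f :: ('i, 'k) mpol. f)"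
    "diamond (scal c) = (scal c :: ('i, 'k) mpol_op)" "diamond (X_op i) = (Y_op i :: ('i, 'k) mpol_op)"
    "diamond (Y_op i) = (X_op i :: ('i, 'k) mpol_op)"
proof -
  note spec = someI_ex[OF diamond_ex[where 'i='i and 'k='k], folded diamond_def]
  note iso = ring_iso_memE[OF conjunct1[OF spec]]
  show "a \<in> carrier weyl \<Longrightarrow> diamond a \<in> carrier weyl"
    using iso(1)[of a] by simp
  show "a \<in> carrier weyl \<Longrightarrow> b \<in> carrier weyl \<Longrightarrow> diamond (\<lambda>f. a (b f)) = (\<lambda>f. diamond b (diamond a f))"
    using iso(2)[of a b] by simp
  show "a \<in> carrier weyl \<Longrightarrow> b \<in> carrier weyl \<Longrightarrow> diamond (\<lambda>f. a f + b f) = (\<lambda>f. diamond a f + diamond b f)"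
    using iso(3)[of a b] by simp
  show "diamond (\<lambda>f. f) = (\<lambda>f :: ('i, 'k) mpol. f)"
    using iso(4) by simp
qed (use someI_ex[OF diamond_ex[where 'i='i and 'k='k], folded diamond_def] in auto)

section \<open>The module \<open>B(p)\<close>\<close>

lemma Zf_add: "v \<in> Zf \<Longrightarrow> w \<in> Zf \<Longrightarrow> (\<lambda>i. v i + w i) \<in> Zf"
  by (auto simp: Zf_def intro: finite_subset[of _ "{i. v i \<noteq> 0} \<union> {i. w i \<noteq> 0}"])

lemma Zf_minus: "v \<in> Zf \<Longrightarrow> (\<lambda>i. - v i) \<in> Zf"
  by (auto simp: Zf_def)

lemma Zf_0: "(\<lambda>i. 0) \<in> Zf"
  by (simp add: Zf_def)

lemma Zf_unit: "c \<in> \<int> \<Longrightarrow> (\<lambda>j. if j = i then c else 0) \<in> Zf"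
  by (auto simp: Zf_def)

definition pcoset :: "('i \<Rightarrow> 'k::field) \<Rightarrow> ('i \<Rightarrow> 'k) set" where
  "pcoset p = {\<lambda>i. p i + v i |v. v \<in> Zf}"

lemma pcoset_iff: "m \<in> pcoset p \<longleftrightarrow> (\<lambda>i. m i - p i) \<in> Zf"
proof
  assume "(\<lambda>i. m i - p i) \<in> Zf"
  then show "m \<in> pcoset p"
    by (auto simp: pcoset_def intro!: exI[of _ "\<lambda>i. m i - p i"])
qed (auto simp: pcoset_def)

lemma pcoset_upd: "m \<in> pcoset p \<Longrightarrow> c \<in> \<int> \<Longrightarrow> m(i := m i + c) \<in> pcoset p"
proof -
  assume "m \<in> pcoset p" "c \<in> \<int>"
  then have "(\<lambda>j. (m j - p j) + (if j = i then c else 0)) \<in> Zf"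
    by (intro Zf_add Zf_unit) (simp_all add: pcoset_iff)
  also have "(\<lambda>j. (m j - p j) + (if j = i then c else 0)) = (\<lambda>j. (m(i := m i + c)) j - p j)"
    by auto
  finally show ?thesis by (simp add: pcoset_iff)
qed

lemma B_carrier_iff: "f \<in> B_carrier p \<longleftrightarrow> Poly_Mapping.keys f \<subseteq> pcoset p"
  by (simp add: B_carrier_def pcoset_def)

lemma B_carrier_add: "f \<in> B_carrier p \<Longrightarrow> g \<in> B_carrier p \<Longrightarrow> f + g \<in> B_carrier p"
  using Poly_Mapping.keys_add[of f g] by (auto simp: B_carrier_iff)

lemma B_carrier_scale: "f \<in> B_carrier p \<Longrightarrow> pm_scale c f \<in> B_carrier p"
  by (auto simp: B_carrier_iff in_keys_iff subset_iff)

lemma B_carrier_0: "0 \<in> B_carrier p"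
  by (simp add: B_carrier_iff)

lemma B_carrier_single: "Poly_Mapping.single m c \<in> B_carrier p \<longleftrightarrow> m \<in> pcoset p \<or> c = 0"
  by (simp add: B_carrier_iff)

lemma B_carrier_sum: "(\<And>k. k \<in> K \<Longrightarrow> f k \<in> B_carrier p) \<Longrightarrow> sum f K \<in> B_carrier p"
  by (induction K rule: infinite_finite_induct) (auto simp: B_carrier_0 B_carrier_add)

lemma B_carrier_XY:
  assumes "f \<in> B_carrier p"
  shows "B_X i f \<in> B_carrier p" "B_Y i f \<in> B_carrier p"
proof -
  have "Poly_Mapping.keys f \<subseteq> pcoset p" using assms by (simp add: B_carrier_iff)
  then show "B_X i f \<in> B_carrier p" "B_Y i f \<in> B_carrier p"
    using pcoset_upd[of _ p 1 i] pcoset_upd[of _ p "-1" i] unfolding B_X_def B_Y_def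
    by (auto intro!: B_carrier_sum simp: B_carrier_single subset_iff)
qed

lemma B_abelian_group: "abelian_group (B_with p act)"
proof (rule abelian_groupI)
  fix f assume "f \<in> carrier (B_with p act)"
  then show "\<exists>g\<in>carrier (B_with p act). g \<oplus>\<^bsub>B_with p act\<^esub> f = \<zero>\<^bsub>B_with p act\<^esub>"
    by (intro bexI[of _ "pm_scale (-1) f"]) (use B_carrier_scale[of f p "-1"] in \<open>simp_all add: B_with_def pm_scale_minus\<close>)
qed (auto simp: B_with_def B_carrier_add B_carrier_0 add_ac)

text \<open>The relations hold on formal monomials with arbitrary exponents in the field, so the
  lift acts on the whole space of these; \<open>B(p)\<close> is a subspace stable under the
  generators and hence under \<open>A\<close>.\<close>

lemma B_act_ex:
  fixes p :: "'i \<Rightarrow> 'k::field_char_0"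
  shows "\<exists>act. left_module weyl (B_with p act) \<and>
    (\<forall>f\<in>B_carrier p. (\<forall>c. act (scal c) f = pm_scale c f) \<and>
      (\<forall>i. act (X_op i) f = B_X i f \<and> act (Y_op i) f = B_Y i f))"
proof -
  note rep = B_weyl_rep[where 'i='i and 'k='k]
  let ?L = "weyl_lift (B_X :: 'i \<Rightarrow> (('i \<Rightarrow> 'k) \<Rightarrow>\<^sub>0 'k) \<Rightarrow> _) B_Y"
  note lift = weyl_lift_gens[OF rep] weyl_lift_add[OF rep] weyl_lift_mult[OF rep]
  have "\<forall>f\<in>B_carrier p. ?L a f \<in> B_carrier p" if "a \<in> carrier weyl" for a
    using that by (induction rule: weyl_induct) (auto simp: lift B_carrier_XY B_carrier_scale B_carrier_add)
  then have "left_module weyl (B_with p ?L)"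
    by (intro left_module.intro ring_weyl B_abelian_group left_module_axioms.intro)
      (auto simp: B_with_def lift linear_op_add[OF weyl_lift_linear[OF rep]])
  then show ?thesis
    by (intro exI[of _ ?L]) (simp add: lift)
qed

lemma B_mod_simps [simp]:
  "carrier (B_mod p) = B_carrier p" "\<zero>\<^bsub>B_mod p\<^esub> = 0" "f \<oplus>\<^bsub>B_mod p\<^esub> g = f + g"
  by (simp_all add: B_mod_def B_with_def)

lemma B_mod_spec:
  fixes p :: "'i \<Rightarrow> 'k::field_char_0"
  shows "left_module weyl (B_mod p)"
    and "f \<in> B_carrier p \<Longrightarrow> scal c \<odot>\<^bsub>B_mod p\<^esub> f = pm_scale c f"
    and "f \<in> B_carrier p \<Longrightarrow> X_op i \<odot>\<^bsub>B_mod p\<^esub> f = B_X i f"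
    and "f \<in> B_carrier p \<Longrightarrow> Y_op i \<odot>\<^bsub>B_mod p\<^esub> f = B_Y i f"
  using someI_ex[OF B_act_ex[of p]] unfolding B_mod_def[symmetric]
  by (auto simp: B_mod_def B_with_def)

section \<open>The left ideals \<open>A m\<^sub>r\<close>\<close>

lemma t_op_apply: "t_op i = (\<lambda>f. X_op i (Y_op i f))"
  by (simp add: t_op_def)

lemma t_op_closed [simp]: "t_op i \<in> carrier weyl"
  by (simp add: t_op_apply)

lemma t_op_linear: "linear_op (t_op i :: ('i, 'k::field_char_0) mpol_op)"
  by (simp add: weyl_linear)

lemma weyl_diff: "a \<in> carrier weyl \<Longrightarrow> b \<in> carrier weyl \<Longrightarrow> (\<lambda>f. a f - b f) \<in> carrier weyl"
  using weyl_closed(7)[OF _ weyl_uminus] by fastforce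

lemma pm_scale_closed [simp]: "pm_scale c \<in> carrier weyl"
  using weyl_closed(1)[of c] by (simp add: scal_def)

lemma pm_scale_diff [simp]:
  "pm_scale c (f - g) = pm_scale c f - pm_scale c (g :: 'e \<Rightarrow>\<^sub>0 'k::field)"
  "pm_scale (c - d) f = pm_scale c f - pm_scale d f"
  by (rule poly_mapping_eqI, simp add: lookup_minus left_diff_distrib right_diff_distrib)+

lemma linear_op_diff: "linear_op T \<Longrightarrow> T (f - g) = T f - T g"
  using linear_op_add[of T f "- g"] by (simp add: linear_op_minus)

text \<open>\<open>A m_r\<close> in a form made for induction;
  \<open>submodule_span_max_ideal\<close> shows that it is the left ideal by which
  \<open>P(r)\<close> is defined.\<close>

inductive_set wideal :: "('i \<Rightarrow> 'k::field) \<Rightarrow> ('i, 'k) mpol_op set" for r where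
  zero: "(\<lambda>_. 0) \<in> wideal r"
| step: "s \<in> wideal r \<Longrightarrow> b \<in> carrier weyl \<Longrightarrow>
    (\<lambda>f. b (t_op i f - pm_scale (r i) f) + s f) \<in> wideal r"

lemma wideal_closed: "s \<in> wideal r \<Longrightarrow> s \<in> carrier weyl"
proof (induction rule: wideal.induct)
  case (step s b i)
  then show ?case
    by (intro weyl_closed(7) weyl_closed(6)[OF step.hyps(2) weyl_diff]) auto
qed simp

lemma wideal_gen: "b \<in> carrier weyl \<Longrightarrow> (\<lambda>f. b (t_op i f - pm_scale (r i) f)) \<in> wideal r"
  using wideal.step[OF wideal.zero] by fastforce

lemma wideal_add: "s \<in> wideal r \<Longrightarrow> s' \<in> wideal r \<Longrightarrow> (\<lambda>f. s f + s' f) \<in> wideal r"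
proof (induction rule: wideal.induct)
  case (step s b i)
  then show ?case using wideal.step[of "\<lambda>f. s f + s' f" r b i] by (simp add: add.assoc)
qed simp

lemma wideal_lmult:
  assumes "a \<in> carrier weyl" "s \<in> wideal r"
  shows "(\<lambda>f. a (s f)) \<in> wideal r"
  using assms(2)
proof (induction rule: wideal.induct)
  case zero
  then show ?case using wideal.zero by (simp add: linear_op_0[OF weyl_linear[OF assms(1)]])
next
  case (step s b i)
  then show ?case
    using wideal.step[OF step.IH weyl_closed(6)[OF assms(1) step.hyps(2)], of i]
    by (simp add: linear_op_add[OF weyl_linear[OF assms(1)]])
qed

lemma wideal_scale: "s \<in> wideal r \<Longrightarrow> (\<lambda>f. pm_scale c (s f)) \<in> wideal r"
  by (rule wideal_lmult) simp

lemma wideal_uminus: "s \<in> wideal r \<Longrightarrow> (\<lambda>f. - s f) \<in> wideal r"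
  using wideal_scale[of s r "-1"] by (simp add: pm_scale_minus)

text \<open>Equality in \<open>P(r)\<close>. It is stable under left multiplication; multiplying by
  a monomial on the right changes the weight, see \<open>wideal_mon\<close>.\<close>

definition weq :: "('i \<Rightarrow> 'k::field) \<Rightarrow> ('i, 'k) mpol_op \<Rightarrow> ('i, 'k) mpol_op \<Rightarrow> bool" where
  "weq r a b \<longleftrightarrow> (\<lambda>f. a f - b f) \<in> wideal r"

lemma weq_refl: "weq r a a"
  by (simp add: weq_def wideal.zero)

lemma weq_trans [trans]: "weq r a b \<Longrightarrow> weq r b c \<Longrightarrow> weq r a c"
  using wideal_add[of "\<lambda>f. a f - b f" r "\<lambda>f. b f - c f"] by (simp add: weq_def)

lemma weq_add: "weq r a b \<Longrightarrow> weq r a' b' \<Longrightarrow> weq r (\<lambda>f. a f + a' f) (\<lambda>f. b f + b' f)"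
  using wideal_add[of "\<lambda>f. a f - b f" r "\<lambda>f. a' f - b' f"] by (simp add: weq_def algebra_simps)

lemma weq_lmult: "c \<in> carrier weyl \<Longrightarrow> weq r a b \<Longrightarrow> weq r (\<lambda>f. c (a f)) (\<lambda>f. c (b f))"
  using wideal_lmult[of c "\<lambda>f. a f - b f" r] by (simp add: weq_def linear_op_diff weyl_linear)

lemma weq_scale: "weq r a b \<Longrightarrow> weq r (\<lambda>f. pm_scale c (a f)) (\<lambda>f. pm_scale c (b f))"
  by (rule weq_lmult) simp

lemma weq_t: "b \<in> carrier weyl \<Longrightarrow> weq r (\<lambda>f. b (t_op i f)) (\<lambda>f. pm_scale (r i) (b f))"
  using wideal_gen[of b i r] by (simp add: weq_def linear_op_diff linear_op_scale weyl_linear)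

lemma weq_0: "weq r a (\<lambda>_. 0) \<longleftrightarrow> a \<in> wideal r"
  by (simp add: weq_def)

section \<open>Monomials and weights\<close>

abbreviation wmon :: "'i multiset \<Rightarrow> 'i multiset \<Rightarrow> ('i, 'k::field) mpol_op" where
  "wmon \<equiv> mon X_op Y_op"

text \<open>The shift by which \<open>X^\<alpha> Y^\<beta>\<close> moves weights.\<close>

definition wt :: "'i multiset \<Rightarrow> 'i multiset \<Rightarrow> 'i \<Rightarrow> 'k::field" where
  "wt \<alpha> \<beta> i = of_nat (count \<alpha> i) - of_nat (count \<beta> i)"

lemma wmon_closed [simp]: "wmon \<alpha> \<beta> \<in> carrier (weyl :: ('i, 'k::field_char_0) mpol_op ring)"
proof -
  have Y: "(\<lambda>f. fold_mset Y_op f \<beta>) \<in> carrier (weyl :: ('i, 'k) mpol_op ring)"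
    by (induction \<beta>) (auto simp: poly.fold_y)
  have "(\<lambda>f. fold_mset X_op (fold_mset Y_op f \<beta>) \<alpha>) \<in> carrier (weyl :: ('i, 'k) mpol_op ring)"
    by (induction \<alpha>) (auto simp: poly.fold_x Y)
  then show ?thesis by (simp add: mon_def[abs_def])
qed

text \<open>The normal form of an element, read off from its pair for the polynomial representation
  itself.\<close>

lemma weyl_mon_induct [consumes 1, case_names zero step]:
  fixes a :: "('i, 'k::field_char_0) mpol_op"
  assumes "a \<in> carrier weyl"
    and zero: "P (\<lambda>_. 0)"
    and step: "\<And>c \<alpha> \<beta> b. b \<in> carrier weyl \<Longrightarrow> P b \<Longrightarrow> P (\<lambda>f. pm_scale c (wmon \<alpha> \<beta> f) + b f)"
  shows "P a"
proof -
  have "nf_pair X_op Y_op a (weyl_lift X_op Y_op a)"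
    by (rule nf_pair_weyl_lift[OF poly.weyl_rep_axioms assms(1)])
  then have "a \<in> carrier weyl \<and> P a"
    by induction (auto intro: zero step weyl_pm_scale)
  then show ?thesis ..
qed

lemma t_X:
  "t_op j (X_op i f) = X_op i (t_op j f) + (if i = j then X_op i f else (0 :: ('i, 'k::field_char_0) mpol))"
  by (simp add: t_op_apply poly.y_x linear_op_add[OF X_op_linear] poly.x_comm[of j i] linear_op_0[OF X_op_linear])

lemma t_Y:
  "t_op j (Y_op i f) = Y_op i (t_op j f) - (if i = j then Y_op i f else (0 :: ('i, 'k::field_char_0) mpol))"
  by (simp add: t_op_apply poly.y_x poly.y_comm[of j i] linear_op_add[OF Y_op_linear]
      linear_op_0[OF X_op_linear])

text \<open>The commutator with \<open>t_op j\<close> is a derivation, and each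
  \<open>X_op i\<close> and \<open>Y_op i\<close> is an eigenvector for it.\<close>

lemma t_mon:
  "t_op j (wmon \<alpha> \<beta> f)
    = wmon \<alpha> \<beta> (t_op j f) + pm_scale (wt \<alpha> \<beta> j) (wmon \<alpha> \<beta> (f :: ('i, 'k::field_char_0) mpol))"
proof -
  have Y: "t_op j (fold_mset Y_op f \<beta>)
      = fold_mset Y_op (t_op j f) \<beta> - pm_scale (of_nat (count \<beta> j)) (fold_mset Y_op f \<beta>)"
    by (induction \<beta>)
      (simp_all add: poly.fold_y t_Y linear_op_diff[OF Y_op_linear] linear_op_scale[OF Y_op_linear])
  have X: "t_op j (fold_mset X_op g \<alpha>)
      = fold_mset X_op (t_op j g) \<alpha> + pm_scale (of_nat (count \<alpha> j)) (fold_mset X_op g \<alpha>)" for g :: "('i, 'k) mpol"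
    by (induction \<alpha>)
      (simp_all add: poly.fold_x t_X linear_op_add[OF X_op_linear] linear_op_scale[OF X_op_linear] add_ac)
  show ?thesis
    by (simp add: mon_def X Y wt_def linear_op_diff[OF poly.fold_linear(1)] linear_op_scale[OF poly.fold_linear(1)])
qed

text \<open>By \<open>t_mon\<close>, \<open>(t_i - r_i - wt_i) u = u (t_i - r_i)\<close> for the
  monomial \<open>u\<close>. This substitutes for stability under right multiplication.\<close>

lemma wideal_mon:
  assumes "s \<in> wideal (\<lambda>i. r i + wt \<alpha> \<beta> i)"
  shows "(\<lambda>f. s (wmon \<alpha> \<beta> f)) \<in> wideal (r :: 'i \<Rightarrow> 'k::field_char_0)"
  using assms
proof (induction rule: wideal.induct)
  case zero
  then show ?case by (simp add: wideal.zero)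
next
  case (step s b i)
  have "t_op i (wmon \<alpha> \<beta> f) - pm_scale (r i + wt \<alpha> \<beta> i) (wmon \<alpha> \<beta> f)
      = wmon \<alpha> \<beta> (t_op i f - pm_scale (r i) f)" for f
    by (simp add: t_mon linear_op_diff[OF poly.mon_linear] linear_op_scale[OF poly.mon_linear])
  then show ?case
    using wideal.step[OF step.IH weyl_closed(6)[OF step.hyps(2) wmon_closed[of \<alpha> \<beta>]], of i]
    by simp
qed

text \<open>Extract \<open>t_i = X_i Y_i\<close> from the middle:
  \<open>t_i Y^\<beta> = Y^\<beta> (t_i - \<beta>_i)\<close>, and at the far right
  \<open>t_i\<close> becomes \<open>r_i\<close>.\<close>

lemma mon_weq_step:
  "weq r (wmon (add_mset i \<alpha>) (add_mset i \<beta>))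
    (\<lambda>f. pm_scale (r i - of_nat (count \<beta> i)) (wmon \<alpha> \<beta> (f :: ('i, 'k::field_char_0) mpol)))"
proof -
  let ?c = "of_nat (count \<beta> i) :: 'k"
  have "wmon (add_mset i \<alpha>) (add_mset i \<beta>) f = fold_mset X_op (t_op i (wmon {#} \<beta> f)) \<alpha>" for f :: "('i, 'k) mpol"
    using comp_fun_commute.fold_mset_fun_left_comm[OF poly.comp_fun_commute_x, of i "Y_op i (fold_mset Y_op f \<beta>)" \<alpha>]
    by (simp add: mon_def t_op_apply poly.fold_x poly.fold_y)
  then have *: "wmon (add_mset i \<alpha>) (add_mset i \<beta>) = (\<lambda>f. wmon \<alpha> \<beta> (t_op i f) + pm_scale (- ?c) (wmon \<alpha> \<beta> (f :: ('i, 'k) mpol)))"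
    unfolding t_mon
    by (simp add: mon_def wt_def linear_op_add[OF poly.fold_linear(1)] linear_op_scale[OF poly.fold_linear(1)] fun_eq_iff)
  have "weq r (\<lambda>f. wmon \<alpha> \<beta> (t_op i f) + pm_scale (- ?c) (wmon \<alpha> \<beta> f))
     (\<lambda>f. pm_scale (r i) (wmon \<alpha> \<beta> f) + pm_scale (- ?c) (wmon \<alpha> \<beta> f))"
    by (intro weq_add weq_t weq_refl wmon_closed)
  then show ?thesis
    unfolding * by (simp add: pm_scale_minus)
qed

text \<open>Cancels the common part of the exponents one index at a time. The scalar may well be
  0.\<close>

lemma mon_weq_reduced:
  "\<exists>c. weq r (wmon \<alpha> \<beta>) (\<lambda>f. pm_scale c (wmon (\<alpha> - \<beta>) (\<beta> - \<alpha>) (f :: ('i, 'k::field_char_0) mpol)))"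
proof (induction \<alpha> arbitrary: \<beta>)
  case empty
  show ?case by (intro exI[of _ 1]) (simp add: weq_refl)
next
  case (add i \<alpha>)
  show ?case
  proof (cases "i \<in># \<beta>")
    case True
    then obtain \<beta>' where \<beta>: "\<beta> = add_mset i \<beta>'" by (metis insert_DiffM)
    obtain c where "weq r (wmon \<alpha> \<beta>') (\<lambda>f. pm_scale c (wmon (\<alpha> - \<beta>') (\<beta>' - \<alpha>) (f :: ('i, 'k) mpol)))"
      using add by blast
    from weq_trans[OF mon_weq_step weq_scale[OF this]] show ?thesis
      unfolding \<beta> by auto
  next
    case False
    obtain c where c: "weq r (wmon \<alpha> \<beta>) (\<lambda>f. pm_scale c (wmon (\<alpha> - \<beta>) (\<beta> - \<alpha>) (f :: ('i, 'k) mpol)))"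
      using add by blast
    have "add_mset i \<alpha> - \<beta> = add_mset i (\<alpha> - \<beta>)" "\<beta> - add_mset i \<alpha> = \<beta> - \<alpha>"
      using False by (auto simp: multiset_eq_iff not_in_iff)
    then show ?thesis
      using weq_lmult[OF weyl_closed(2)[of i] c]
      by (auto simp: linear_op_scale[OF X_op_linear] poly.x_mon simp flip: poly.x_mon)
  qed
qed

text \<open>For \<open>\<delta>\<close> in \<^const>\<open>Zf\<close> there is exactly one such pair; elsewhere the value is immaterial.\<close>

definition wunit :: "('i \<Rightarrow> 'k::field) \<Rightarrow> ('i, 'k) mpol_op" where
  "wunit \<delta> = (case SOME (\<alpha>, \<beta>). wt \<alpha> \<beta> = \<delta> \<and> \<alpha> \<inter># \<beta> = {#} of (\<alpha>, \<beta>) \<Rightarrow> wmon \<alpha> \<beta>)"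

text \<open>Disjointness leaves only the positive and the negative part of the weight, and in
  characteristic 0 the integers embed into the field.\<close>

lemma wt_disjoint_inj:
  assumes "wt \<alpha> \<beta> = (wt \<alpha>' \<beta>' :: 'i \<Rightarrow> 'k::field_char_0)" "\<alpha> \<inter># \<beta> = {#}" "\<alpha>' \<inter># \<beta>' = {#}"
  shows "\<alpha> = \<alpha>' \<and> \<beta> = \<beta>'"
proof -
  have "count \<alpha> i = count \<alpha>' i \<and> count \<beta> i = count \<beta>' i" for i
  proof -
    have "of_nat (count \<alpha> i + count \<beta>' i) = (of_nat (count \<alpha>' i + count \<beta> i) :: 'k)"
      using fun_cong[OF assms(1), of i] by (simp add: wt_def algebra_simps)
    then have "count \<alpha> i + count \<beta>' i = count \<alpha>' i + count \<beta> i"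
      by (simp only: of_nat_eq_iff)
    moreover have "min (count \<alpha> i) (count \<beta> i) = 0" "min (count \<alpha>' i) (count \<beta>' i) = 0"
      using assms(2,3) by (metis count_empty count_inter_mset)+
    ultimately show ?thesis by (auto simp: min_def split: if_splits)
  qed
  then show ?thesis by (simp add: multiset_eq_iff)
qed

lemma wunit_eq:
  "wunit (wt \<alpha> \<beta> :: 'i \<Rightarrow> 'k::field_char_0) = wmon (\<alpha> - \<beta>) (\<beta> - \<alpha>)"
proof -
  let ?P = "\<lambda>(\<alpha>', \<beta>'). wt \<alpha>' \<beta>' = (wt \<alpha> \<beta> :: 'i \<Rightarrow> 'k) \<and> \<alpha>' \<inter># \<beta>' = {#}"
  have *: "wt (\<alpha> - \<beta>) (\<beta> - \<alpha>) = (wt \<alpha> \<beta> :: 'i \<Rightarrow> 'k)"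
  proof
    fix i
    show "wt (\<alpha> - \<beta>) (\<beta> - \<alpha>) i = (wt \<alpha> \<beta> i :: 'k)"
      by (cases "count \<alpha> i \<le> count \<beta> i") (auto simp: wt_def of_nat_diff)
  qed
  have dis: "(\<alpha> - \<beta>) \<inter># (\<beta> - \<alpha>) = {#}"
    by (auto simp: multiset_eq_iff)
  have "(SOME k. ?P k) = (\<alpha> - \<beta>, \<beta> - \<alpha>)"
  proof (rule some_equality)
    fix k assume "?P k"
    then show "k = (\<alpha> - \<beta>, \<beta> - \<alpha>)"
      using wt_disjoint_inj[of "fst k" "snd k" "\<alpha> - \<beta>" "\<beta> - \<alpha>", where 'k='k] dis * by (cases k) auto
  qed (use * dis in auto)
  then show ?thesis by (simp add: wunit_def)
qed

lemma mon_weq: "\<exists>c. weq r (wmon \<alpha> \<beta>) (\<lambda>f. pm_scale c (wunit (wt \<alpha> \<beta>) (f :: ('i, 'k::field_char_0) mpol)))"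
  using mon_weq_reduced[of r \<alpha> \<beta>] by (simp add: wunit_eq)

lemma wt_empty [simp]: "wt {#} {#} = (\<lambda>i. 0)"
  by (auto simp: wt_def)

lemma wunit_0: "wunit (\<lambda>i. 0 :: 'k::field_char_0) = (\<lambda>f. f)"
  using wunit_eq[of "{#}" "{#}", where 'k='k] by (simp add: fun_eq_iff)

lemma Zf_wt: "wt \<alpha> \<beta> \<in> (Zf :: ('i \<Rightarrow> 'k::field_char_0) set)"
proof -
  have "{i. wt \<alpha> \<beta> i \<noteq> (0 :: 'k)} \<subseteq> set_mset \<alpha> \<union> set_mset \<beta>"
    by (auto simp: wt_def not_in_iff)
  then show ?thesis
    by (auto simp: Zf_def wt_def intro: finite_subset)
qed

lemma Zf_wtE:
  assumes "\<delta> \<in> (Zf :: ('i \<Rightarrow> 'k::field_char_0) set)"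
  obtains \<alpha> \<beta> where "\<delta> = wt \<alpha> \<beta>"
proof -
  define z where "z i = (THE n. \<delta> i = of_int n)" for i
  have z: "\<delta> i = of_int (z i)" for i
  proof -
    obtain n where "\<delta> i = of_int n" using assms by (auto simp: Zf_def Ints_def)
    then show ?thesis unfolding z_def by (metis (mono_tags, lifting) of_int_eq_iff the_equality)
  qed
  have fin: "finite {i. z i \<noteq> 0}" using assms z by (simp add: Zf_def)
  then have fin': "finite {i. 0 < nat (z i)}" "finite {i. 0 < nat (- z i)}"
    by (auto intro!: finite_subset[OF _ fin])
  have "\<delta> = wt (Abs_multiset (\<lambda>i. nat (z i))) (Abs_multiset (\<lambda>i. nat (- z i)))"
  proof
    fix i
    have "of_int (z i) = (of_nat (nat (z i)) - of_nat (nat (- z i)) :: 'k)"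
      by (cases "z i \<ge> 0") (auto simp: of_nat_nat)
    then show "\<delta> i = wt (Abs_multiset (\<lambda>i. nat (z i))) (Abs_multiset (\<lambda>i. nat (- z i))) i"
      using fin' by (simp add: wt_def z count_Abs_multiset)
  qed
  then show ?thesis by (rule that)
qed

lemma wunit_closed: "\<delta> \<in> Zf \<Longrightarrow> wunit \<delta> \<in> carrier (weyl :: ('i, 'k::field_char_0) mpol_op ring)"
  by (erule Zf_wtE) (simp add: wunit_eq)

lemma weyl_sum: "(\<And>k. k \<in> K \<Longrightarrow> g k \<in> carrier weyl) \<Longrightarrow> (\<lambda>f. \<Sum>k\<in>K. g k f) \<in> carrier weyl"
  by (induction K rule: infinite_finite_induct) auto

text \<open>So the \<open>wunit \<delta>\<close> span \<open>P(r)\<close>, with at most one line in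
  each weight \<open>r + \<delta>\<close>.\<close>

lemma weq_homogeneous:
  fixes a :: "('i, 'k::field_char_0) mpol_op"
  assumes "a \<in> carrier weyl"
  obtains D c where "finite D" "D \<subseteq> Zf" "weq r a (\<lambda>f. \<Sum>\<delta>\<in>D. pm_scale (c \<delta>) (wunit \<delta> f))"
proof -
  have "\<exists>D c. finite D \<and> D \<subseteq> Zf \<and> weq r a (\<lambda>f. \<Sum>\<delta>\<in>D. pm_scale (c \<delta>) (wunit \<delta> f))"
    using assms
  proof (induction rule: weyl_mon_induct)
    case zero
    then show ?case by (intro exI[of _ "{}"]) (simp add: weq_refl)
  next
    case (step d \<alpha> \<beta> b)
    then obtain D c where D: "finite D" "D \<subseteq> Zf" "weq r b (\<lambda>f. \<Sum>\<delta>\<in>D. pm_scale (c \<delta>) (wunit \<delta> f))"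
      by blast
    obtain e where e: "weq r (wmon \<alpha> \<beta>) (\<lambda>f. pm_scale e (wunit (wt \<alpha> \<beta>) f))"
      using mon_weq by blast
    let ?k = "wt \<alpha> \<beta>"
    define c' where "c' \<delta> = (if \<delta> \<in> D then c \<delta> else 0) + (if \<delta> = ?k then d * e else 0)" for \<delta>
    have "(\<Sum>\<delta>\<in>insert ?k D. pm_scale (c' \<delta>) (wunit \<delta> f))
        = pm_scale (d * e) (wunit ?k f) + (\<Sum>\<delta>\<in>D. pm_scale (c \<delta>) (wunit \<delta> f))" for f
      unfolding c'_def by (rule sum_insert_coeff[OF D(1)])
    moreover have "weq r (\<lambda>f. pm_scale d (wmon \<alpha> \<beta> f) + b f)
        (\<lambda>f. pm_scale d (pm_scale e (wunit ?k f)) + (\<Sum>\<delta>\<in>D. pm_scale (c \<delta>) (wunit \<delta> f)))"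
      by (intro weq_add weq_scale e D)
    ultimately show ?case
      using D(1,2) Zf_wt by (intro exI[of _ "insert ?k D"] exI[of _ c']) auto
  qed
  then show ?thesis using that by blast
qed

section \<open>Projections onto weight spaces\<close>

text \<open>An element that acts on every vector of weight \<open>r\<close> as the scalar
  \<open>\<chi> r\<close>. The values of \<open>\<chi>\<close> will be prescribed at finitely many
  weights only.\<close>

definition projector :: "('i, 'k::field) mpol_op \<Rightarrow> (('i \<Rightarrow> 'k) \<Rightarrow> 'k) \<Rightarrow> bool" where
  "projector \<pi> \<chi> \<longleftrightarrow> \<pi> \<in> carrier weyl \<and> (\<forall>r. weq r \<pi> (pm_scale (\<chi> r)))"

text \<open>Lagrange interpolation: for each \<open>m\<close> in \<open>M\<close> pick a coordinate
  with \<open>q i \<noteq> m i\<close> and multiply by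
  \<open>(t_i - m_i) / (q_i - m_i)\<close>.\<close>

lemma projector_ex:
  fixes q :: "'i \<Rightarrow> 'k::field_char_0"
  assumes "finite M" "q \<notin> M"
  obtains \<pi> \<chi> where "projector \<pi> \<chi>" "\<chi> q = 1" "\<And>m. m \<in> M \<Longrightarrow> \<chi> m = 0"
proof -
  have "\<exists>\<pi> \<chi>. projector \<pi> \<chi> \<and> \<chi> q = 1 \<and> (\<forall>m\<in>M. \<chi> m = 0)"
    using assms
  proof (induction M)
    case empty
    have "pm_scale 1 = (\<lambda>f :: ('i, 'k) mpol. f)" by auto
    then have "projector (\<lambda>f :: ('i, 'k) mpol. f) (\<lambda>_. 1)"
      by (simp add: projector_def weq_refl)
    then show ?case by auto
  next
    case (insert m M)
    then obtain \<pi> \<chi> where \<pi>: "projector \<pi> \<chi>" "\<chi> q = 1" "\<forall>m\<in>M. \<chi> m = 0" by auto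
    from insert.prems obtain i where i: "q i \<noteq> m i" by auto
    define c where "c = 1 / (q i - m i)"
    define \<pi>' where "\<pi>' f = pm_scale c (t_op i (\<pi> f) + pm_scale (- m i) (\<pi> f))" for f
    define \<chi>' where "\<chi>' r = c * (r i - m i) * \<chi> r" for r
    have closed: "\<pi>' \<in> carrier weyl"
    proof -
      have "\<pi> \<in> carrier weyl" using \<pi>(1) by (simp add: projector_def)
      then show ?thesis
        unfolding \<pi>'_def[abs_def]
        by (intro weyl_pm_scale[OF weyl_closed(7)[OF weyl_closed(6)[OF t_op_closed] weyl_pm_scale]])
    qed
    have "weq r \<pi>' (pm_scale (\<chi>' r))" for r
    proof -
      have 1: "weq r \<pi> (pm_scale (\<chi> r))" using \<pi>(1) by (simp add: projector_def)
      have 2: "weq r (\<lambda>f. t_op i (\<pi> f)) (\<lambda>f. pm_scale (r i) (pm_scale (\<chi> r) f))"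
      proof (rule weq_trans[OF weq_lmult[OF t_op_closed 1]])
        show "weq r (\<lambda>f. t_op i (pm_scale (\<chi> r) f)) (\<lambda>f. pm_scale (r i) (pm_scale (\<chi> r) f))"
          using weq_t[of "pm_scale (\<chi> r)" r i] by (simp add: linear_op_scale[OF t_op_linear])
      qed
      have "weq r \<pi>' (\<lambda>f. pm_scale c (pm_scale (r i) (pm_scale (\<chi> r) f) + pm_scale (- m i) (pm_scale (\<chi> r) f)))"
        unfolding \<pi>'_def[abs_def] by (intro weq_scale weq_add 1 2)
      also have "(\<lambda>f. pm_scale c (pm_scale (r i) (pm_scale (\<chi> r) f) + pm_scale (- m i) (pm_scale (\<chi> r) f)))
          = pm_scale (\<chi>' r)"
        by (rule ext, rule poly_mapping_eqI)
          (simp only: lookup_add lookup_pm_scale \<chi>'_def, simp add: algebra_simps)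
      finally show ?thesis .
    qed
    with closed have "projector \<pi>' \<chi>'" by (simp add: projector_def)
    moreover have "\<chi>' q = 1" using i \<pi>(2) by (simp add: \<chi>'_def c_def)
    moreover have "\<forall>m'\<in>insert m M. \<chi>' m' = 0" using \<pi>(3) by (auto simp: \<chi>'_def)
    ultimately show ?case by blast
  qed
  then show ?thesis using that by blast
qed

text \<open>Extracts the component of weight \<open>r\<close> of \<open>a\<close> in
  \<open>P(r)\<close>, a multiple of the generator: monomials of weight 0 are scalars modulo
  \<open>A m_r\<close>, and the others are killed by a projector vanishing at their weights.\<close>

lemma scalar_part:
  fixes a :: "('i, 'k::field_char_0) mpol_op"
  assumes "a \<in> carrier weyl"
  obtains \<pi> \<chi> c where "projector \<pi> \<chi>" "\<chi> r = 1" "weq r (\<lambda>f. \<pi> (a f)) (pm_scale c)"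
proof -
  \<comment> \<open>\<open>M\<close> collects the weights \<open>r + wt \<alpha> \<beta>\<close> to
    be killed. Quantifying over all projectors vanishing there postpones the choice of one until all
    monomials are known.\<close>
  have "\<exists>M c. finite M \<and> r \<notin> M \<and> (\<forall>\<pi> \<chi>. projector \<pi> \<chi> \<longrightarrow> \<chi> r = 1 \<longrightarrow> (\<forall>m\<in>M. \<chi> m = 0) \<longrightarrow>
      weq r (\<lambda>f. \<pi> (a f)) (pm_scale c))"
    using assms
  proof (induction rule: weyl_mon_induct)
    case zero
    have "weq r (\<lambda>f. \<pi> 0) (pm_scale 0)" if "projector \<pi> \<chi>" for \<pi> :: "('i, 'k) mpol_op" and \<chi>
      using that linear_op_0[OF weyl_linear[of \<pi>]] by (simp add: projector_def weq_def wideal.zero)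
    then show ?case by (intro exI[of _ "{}"] exI[of _ 0]) blast
  next
    case (step d \<alpha> \<beta> b)
    then obtain M c where M: "finite M" "r \<notin> M"
      "\<And>\<pi> \<chi>. projector \<pi> \<chi> \<Longrightarrow> \<chi> r = 1 \<Longrightarrow> (\<And>m. m \<in> M \<Longrightarrow> \<chi> m = 0) \<Longrightarrow> weq r (\<lambda>f. \<pi> (b f)) (pm_scale c)"
      by metis
    have comb: "weq r (\<lambda>f. \<pi> (pm_scale d (wmon \<alpha> \<beta> f) + b f)) (pm_scale (d * e + c))"
      if "projector \<pi> \<chi>" "\<chi> r = 1" "\<And>m. m \<in> M \<Longrightarrow> \<chi> m = 0" "weq r (\<lambda>f. \<pi> (wmon \<alpha> \<beta> f)) (pm_scale e)"
      for \<pi> \<chi> e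
    proof -
      have lin: "linear_op \<pi>" using that(1) by (simp add: projector_def weyl_linear)
      have "weq r (\<lambda>f. pm_scale d (\<pi> (wmon \<alpha> \<beta> f)) + \<pi> (b f)) (\<lambda>f. pm_scale d (pm_scale e f) + pm_scale c f)"
        by (intro weq_add weq_scale that M(3)[of \<pi> \<chi>])
      then show ?thesis
        by (simp add: linear_op_add[OF lin] linear_op_scale[OF lin] weq_def)
    qed
    show ?case
    proof (cases "wt \<alpha> \<beta> = (\<lambda>i. 0 :: 'k)")
      case True
      obtain e where e: "weq r (wmon \<alpha> \<beta>) (\<lambda>f. pm_scale e (f :: ('i, 'k) mpol))"
        using mon_weq[of r \<alpha> \<beta>] by (auto simp: True wunit_0)
      have "weq r (\<lambda>f. \<pi> (wmon \<alpha> \<beta> f)) (pm_scale e)" if "projector \<pi> \<chi>" "\<chi> r = 1" for \<pi> \<chi>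
      proof -
        have \<pi>: "\<pi> \<in> carrier weyl" "weq r \<pi> (pm_scale 1)"
          using that unfolding projector_def by metis+
        have "weq r (\<lambda>f. \<pi> (wmon \<alpha> \<beta> f)) (\<lambda>f. \<pi> (pm_scale e f))"
          by (rule weq_lmult[OF \<pi>(1) e])
        also have "(\<lambda>f. \<pi> (pm_scale e f)) = (\<lambda>f. pm_scale e (\<pi> f))"
          by (simp add: linear_op_scale[OF weyl_linear[OF \<pi>(1)]])
        also have "weq r \<dots> (\<lambda>f. pm_scale e (pm_scale 1 f))"
          by (rule weq_scale[OF \<pi>(2)])
        finally show ?thesis by simp
      qed
      then show ?thesis
        using M(1,2) comb by (intro exI[of _ M] exI[of _ "d * e + c"]) blast
    next
      case False
      let ?m = "\<lambda>i. r i + wt \<alpha> \<beta> i"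
      have "weq r (\<lambda>f. \<pi> (wmon \<alpha> \<beta> f)) (pm_scale 0)" if "projector \<pi> \<chi>" "\<chi> ?m = 0" for \<pi> \<chi>
      proof -
        \<comment> \<open>A projector vanishing at the weight \<open>?m\<close> lies in the left
          ideal of \<open>?m\<close>, and the monomial carries that ideal into the one of
          \<open>r\<close>.\<close>
        have "(\<lambda>f. \<pi> f - pm_scale 0 f) \<in> wideal ?m"
          using that by (metis projector_def weq_def)
        from wideal_mon[OF this] show ?thesis by (simp add: weq_def)
      qed
      moreover have "?m \<noteq> r"
        using False by (auto simp: fun_eq_iff)
      ultimately show ?thesis
        using M(1,2) comb[of _ _ 0]
        by (intro exI[of _ "insert ?m M"] exI[of _ "d * 0 + c"] conjI allI impI) auto
    qed
  qed
  then obtain M c where "finite M" "r \<notin> M" "\<And>\<pi> \<chi>. projector \<pi> \<chi> \<Longrightarrow> \<chi> r = 1 \<Longrightarrow> (\<forall>m\<in>M. \<chi> m = 0) \<Longrightarrow>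
      weq r (\<lambda>f. \<pi> (a f)) (pm_scale c)"
    by blast
  then show ?thesis
    using projector_ex[of M r] that by metis
qed


section \<open>The regular module and the left ideal spanned by \<open>max_ideal\<close>\<close>

lemma regular_weyl_simps [simp]:
  "carrier (regular_module weyl) = carrier weyl"
  "a \<odot>\<^bsub>regular_module weyl\<^esub> b = (\<lambda>f. a (b f))"
  "a \<oplus>\<^bsub>regular_module weyl\<^esub> b = (\<lambda>f. a f + b f)"
  "\<zero>\<^bsub>regular_module weyl\<^esub> = (\<lambda>f. 0)"
  using weyl_simps by (simp_all add: regular_module_def)

lemma regular_left_module: "left_module weyl (regular_module weyl :: (('i, 'k::field_char_0) mpol_op, _) module)"
proof (intro left_module.intro ring_weyl left_module_axioms.intro abelian_groupI)
  fix a assume "a \<in> carrier (regular_module weyl :: (('i, 'k) mpol_op, _) module)"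
  then show "\<exists>b\<in>carrier (regular_module weyl). b \<oplus>\<^bsub>regular_module weyl\<^esub> a = \<zero>\<^bsub>regular_module weyl\<^esub>"
    by (intro bexI[of _ "\<lambda>f. - a f"]) (auto simp: weyl_uminus)
qed (auto simp: add_ac linear_op_add weyl_linear)

lemma left_module_submoduleI:
  assumes "left_module R M" "H \<subseteq> carrier M" "\<zero>\<^bsub>M\<^esub> \<in> H"
    and add: "\<And>x y. x \<in> H \<Longrightarrow> y \<in> H \<Longrightarrow> x \<oplus>\<^bsub>M\<^esub> y \<in> H"
    and minus: "\<And>x. x \<in> H \<Longrightarrow> \<ominus>\<^bsub>M\<^esub> x \<in> H"
    and smult: "\<And>a x. a \<in> carrier R \<Longrightarrow> x \<in> H \<Longrightarrow> a \<odot>\<^bsub>M\<^esub> x \<in> H"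
  shows "submodule H R M"
proof -
  interpret left_module R M by fact
  have "subgroup H (add_monoid M)"
    using assms by (intro group.subgroupI[OF M.a_group]) (auto simp flip: a_inv_def)
  then show ?thesis
    by (intro submodule.intro submodule_axioms.intro smult)
qed

lemma left_module_submoduleE:
  assumes "left_module R M" "submodule H R M"
  shows "H \<subseteq> carrier M" "\<zero>\<^bsub>M\<^esub> \<in> H"
    "\<And>x y. x \<in> H \<Longrightarrow> y \<in> H \<Longrightarrow> x \<oplus>\<^bsub>M\<^esub> y \<in> H"
    "\<And>x. x \<in> H \<Longrightarrow> \<ominus>\<^bsub>M\<^esub> x \<in> H"
    "\<And>a x. a \<in> carrier R \<Longrightarrow> x \<in> H \<Longrightarrow> a \<odot>\<^bsub>M\<^esub> x \<in> H"
proof -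
  interpret left_module R M by fact
  have H: "subgroup H (add_monoid M)" using assms(2) by (simp add: submodule_def)
  show "H \<subseteq> carrier M" "\<zero>\<^bsub>M\<^esub> \<in> H" "\<And>x y. x \<in> H \<Longrightarrow> y \<in> H \<Longrightarrow> x \<oplus>\<^bsub>M\<^esub> y \<in> H"
    using subgroup.subset[OF H] subgroup.one_closed[OF H] subgroup.m_closed[OF H] by auto
  show "\<And>x. x \<in> H \<Longrightarrow> \<ominus>\<^bsub>M\<^esub> x \<in> H"
    using subgroup.m_inv_closed[OF H] by (simp add: a_inv_def)
  show "\<And>a x. a \<in> carrier R \<Longrightarrow> x \<in> H \<Longrightarrow> a \<odot>\<^bsub>M\<^esub> x \<in> H"
    using submodule.smult_closed[OF assms(2)] .
qed

lemma regular_minus: "a \<in> carrier weyl \<Longrightarrow> \<ominus>\<^bsub>regular_module weyl\<^esub> a = (\<lambda>f. - a f)"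
  for a :: "('i, 'k::field_char_0) mpol_op"
proof -
  interpret left_module weyl "regular_module weyl :: (('i, 'k) mpol_op, _) module"
    by (rule regular_left_module)
  show "a \<in> carrier weyl \<Longrightarrow> ?thesis"
    by (intro M.minus_equality) (auto simp: weyl_uminus)
qed

lemma wideal_submodule: "submodule (wideal r) weyl (regular_module weyl)"
  for r :: "'i \<Rightarrow> 'k::field_char_0"
  by (rule left_module_submoduleI[OF regular_left_module])
    (auto simp: wideal_closed wideal.zero wideal_add wideal_lmult wideal_uminus regular_minus)

lemma weyl0_gens_linear: "{scal c |c. True} \<union> {t_op i |i. True} \<subseteq> carrier End_ring"
  by (auto simp: End_ring_simps scal_def linear_op_pm_scale t_op_apply linear_op_comp[OF X_op_linear Y_op_linear])

lemma weyl0_simps: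
  "S \<otimes>\<^bsub>weyl0\<^esub> T = (\<lambda>f. S (T f))" "S \<oplus>\<^bsub>weyl0\<^esub> T = (\<lambda>f. S f + T f)" "\<zero>\<^bsub>weyl0\<^esub> = (\<lambda>_. 0)"
  by (auto simp: weyl0_def End_ring_simps)

lemma ring_weyl0: "ring weyl0"
  unfolding weyl0_def by (rule ring.generate_ring_is_ring[OF ring_End weyl0_gens_linear])

text \<open>Modulo \<open>A m_r\<close> the generators of \<open>A_0\<close> are scalars, and
  scalars commute with everything, so sums and products are scalars too.\<close>

lemma weyl0_closed: "a \<in> carrier weyl0 \<Longrightarrow> a \<in> carrier weyl \<and> (\<exists>c. weq r a (pm_scale c))"
  for r :: "'i \<Rightarrow> 'k::field_char_0"
proof -
  assume "a \<in> carrier weyl0"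
  then have "a \<in> generate_ring End_ring ({scal c |c. True} \<union> {t_op i |i. True})"
    by (simp add: weyl0_def)
  then show ?thesis
  proof induction
    case one
    have "weq r (\<lambda>f. f) (pm_scale 1)" using weq_refl[of r "\<lambda>f. f"] by (simp add: weq_def)
    then show ?case by (auto simp: End_ring_simps)
  next
    case (incl h)
    have "weq r (t_op i) (\<lambda>f. pm_scale (r i) f)" for i
      using weq_t[of "\<lambda>f. f" r i] by simp
    with incl show ?case by (auto simp: scal_def intro: weq_refl)
  next
    case (a_inv h)
    then obtain c where c: "weq r h (pm_scale c)" by blast
    have "weq r (\<lambda>f. - h f) (pm_scale (- c))"
      using weq_scale[OF c, of "-1"] by (simp add: pm_scale_minus weq_def)
    with a_inv show ?case by (auto simp: End_minus weyl_linear weyl_uminus)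
  next
    case (eng_add h h')
    then obtain c c' where "weq r h (pm_scale c)" "weq r h' (pm_scale c')" by blast
    from weq_add[OF this] have "weq r (\<lambda>f. h f + h' f) (pm_scale (c + c'))"
      by (simp add: weq_def)
    with eng_add show ?case by (auto simp: End_ring_simps)
  next
    case (eng_mult h h')
    then obtain c c' where c: "weq r h (pm_scale c)" "weq r h' (pm_scale c')" by blast
    have "weq r (\<lambda>f. h (h' f)) (\<lambda>f. h (pm_scale c' f))"
      using eng_mult by (intro weq_lmult[OF _ c(2)]) auto
    also have "(\<lambda>f. h (pm_scale c' f)) = (\<lambda>f. pm_scale c' (h f))"
      using eng_mult by (simp add: linear_op_scale weyl_linear)
    also have "weq r \<dots> (\<lambda>f. pm_scale c' (pm_scale c f))"
      by (rule weq_scale[OF c(1)])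
    finally have "weq r (\<lambda>f. h (h' f)) (pm_scale (c' * c))" by (simp add: weq_def)
    with eng_mult show ?case by (auto simp: End_ring_simps)
  qed
qed

lemma weyl0_minus: "a \<in> carrier weyl0 \<Longrightarrow> \<ominus>\<^bsub>weyl0\<^esub> a = (\<lambda>f. - a f)"
  for a :: "('i, 'k::field_char_0) mpol_op"
proof -
  assume a: "a \<in> carrier weyl0"
  interpret ring "weyl0 :: ('i, 'k) mpol_op ring" by (rule ring_weyl0)
  have "\<ominus>\<^bsub>weyl0\<^esub> a \<oplus>\<^bsub>weyl0\<^esub> a = \<zero>\<^bsub>weyl0\<^esub>"
    by (rule l_neg[OF a])
  then show ?thesis by (auto simp: weyl0_simps fun_eq_iff eq_neg_iff_add_eq_0)
qed

lemma max_ideal_gens: "{t_op i \<ominus>\<^bsub>weyl0\<^esub> scal (r i) |i. True} = {\<lambda>f. t_op i f - pm_scale (r i) f |i. True}"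
  "{t_op i \<ominus>\<^bsub>weyl0\<^esub> scal (r i) |i. True} \<subseteq> carrier weyl0" for r :: "'i \<Rightarrow> 'k::field_char_0"
proof -
  have mem: "t_op i \<in> carrier (weyl0 :: ('i, 'k) mpol_op ring)"
    "scal c \<in> carrier (weyl0 :: ('i, 'k) mpol_op ring)" for i c
    by (auto simp: weyl0_def intro!: generate_ring.incl)
  have "t_op i \<ominus>\<^bsub>weyl0\<^esub> scal (r i) = (\<lambda>f. t_op i f - pm_scale (r i) f)" for i
    unfolding a_minus_def weyl0_simps weyl0_minus[OF mem(2)] by (simp add: scal_def)
  then show "{t_op i \<ominus>\<^bsub>weyl0\<^esub> scal (r i) |i. True} = {\<lambda>f. t_op i f - pm_scale (r i) f |i. True}"
    by simp
  show "{t_op i \<ominus>\<^bsub>weyl0\<^esub> scal (r i) |i. True} \<subseteq> carrier weyl0"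
    using abelian_group.minus_closed[OF ring.is_abelian_group[OF ring_weyl0] mem] by blast
qed

text \<open>\<open>max_ideal\<close> is a two-sided ideal of \<open>A_0\<close>, so right
  multiplication is the point: if \<open>x\<close> in \<open>A_0\<close> is congruent to the scalar
  \<open>c\<close>, then \<open>a x\<close> is congruent to \<open>c a\<close>, which lies in
  \<open>A m_r\<close> whenever \<open>a\<close> does.\<close>

lemma max_ideal_subset: "max_ideal r \<subseteq> wideal r" for r :: "'i \<Rightarrow> 'k::field_char_0"
proof -
  let ?I = "carrier weyl0 \<inter> wideal r"
  interpret W: ring "weyl0 :: ('i, 'k) mpol_op ring" by (rule ring_weyl0)
  have "ideal ?I weyl0"
  proof (rule idealI[OF ring_weyl0])
    show "subgroup ?I (add_monoid weyl0)"
    proof (rule group.subgroupI[OF W.a_group])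
      show "?I \<noteq> {}" using W.zero_closed wideal.zero[of r] by (auto simp: weyl0_simps)
      fix a assume "a \<in> ?I"
      then show "inv\<^bsub>add_monoid weyl0\<^esub> a \<in> ?I"
        using W.a_inv_closed[of a] weyl0_minus[of a] wideal_uminus[of a r] by (auto simp: a_inv_def)
    next
      fix a b assume "a \<in> ?I" "b \<in> ?I"
      then show "a \<otimes>\<^bsub>add_monoid weyl0\<^esub> b \<in> ?I"
        using W.a_closed[of a b] wideal_add[of a r b] by (auto simp: weyl0_simps)
    qed auto
  next
    fix a x :: "('i, 'k) mpol_op" assume a: "a \<in> ?I" and x: "x \<in> carrier weyl0"
    then show "x \<otimes>\<^bsub>weyl0\<^esub> a \<in> ?I"
      using W.m_closed[of x a] wideal_lmult[of x a r] weyl0_closed[OF x] by (auto simp: weyl0_simps)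
    obtain c where c: "weq r x (pm_scale c)" using weyl0_closed[OF x] by blast
    have "weq r (\<lambda>f. a (x f)) (\<lambda>f. a (pm_scale c f))"
      using a wideal_closed by (intro weq_lmult[OF _ c]) blast
    also have "(\<lambda>f. a (pm_scale c f)) = (\<lambda>f. pm_scale c (a f))"
      using a by (auto simp: linear_op_scale weyl_linear wideal_closed)
    also have "weq r \<dots> (\<lambda>_. 0)"
      using a by (simp add: weq_0 wideal_scale)
    finally show "a \<otimes>\<^bsub>weyl0\<^esub> x \<in> ?I"
      using W.m_closed[of a x] a x by (simp add: weyl0_simps weq_0)
  qed
  moreover have "{t_op i \<ominus>\<^bsub>weyl0\<^esub> scal (r i) |i. True} \<subseteq> ?I"
    using max_ideal_gens[of r] wideal_gen[of "\<lambda>f. f" _ r] by auto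
  ultimately have "max_ideal r \<subseteq> ?I"
    unfolding max_ideal_def by (rule W.genideal_minimal)
  then show ?thesis by blast
qed

lemma submodule_span_max_ideal:
  "submodule_span weyl (regular_module weyl) (max_ideal r) = wideal r" for r :: "'i \<Rightarrow> 'k::field_char_0"
proof
  show "submodule_span weyl (regular_module weyl) (max_ideal r) \<subseteq> wideal r"
    unfolding submodule_span_def using wideal_submodule[of r] max_ideal_subset[of r] by blast
  show "wideal r \<subseteq> submodule_span weyl (regular_module weyl) (max_ideal r)"
    unfolding submodule_span_def
  proof safe
    fix s N assume s: "s \<in> wideal r" and N: "submodule N weyl (regular_module weyl)" "max_ideal r \<subseteq> N"
    note E = left_module_submoduleE[OF regular_left_module N(1)]
    have gen: "(\<lambda>f. t_op i f - pm_scale (r i) f) \<in> N" for i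
      using N(2) ring.genideal_self[OF ring_weyl0 max_ideal_gens(2)[of r]] max_ideal_gens(1)[of r]
      unfolding max_ideal_def by blast
    from s show "s \<in> N"
    proof induction
      case zero
      then show ?case using E(2) by simp
    next
      case (step s b i)
      then show ?case
        using E(3)[OF E(5)[OF step.hyps(2) gen[of i]] step.IH] by simp
    qed
  qed
qed

section \<open>Modules over the Weyl algebra\<close>

declare weyl_closed(6) [simp del, rule del]

text \<open>The sum of the weight spaces, without a claim of directness. Directness comes from
  projectors in \<open>weight_moduleI\<close>.\<close>

inductive_set weight_sums :: "(('i, 'k::field) mpol_op, 'm) module \<Rightarrow> 'm set" for V where
  zero: "\<zero>\<^bsub>V\<^esub> \<in> weight_sums V"
| step: "y \<in> weight_space V r \<Longrightarrow> x \<in> weight_sums V \<Longrightarrow> y \<oplus>\<^bsub>V\<^esub> x \<in> weight_sums V"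

locale weyl_module =
  fixes V :: "(('i, 'k::field_char_0) mpol_op, 'm) module" (structure)
  assumes left_module_V: "left_module weyl V"

sublocale weyl_module \<subseteq> left_module weyl V
  by (rule left_module_V)

context weyl_module begin

lemma act_closed [simp]: "a \<in> carrier weyl \<Longrightarrow> x \<in> carrier V \<Longrightarrow> a \<odot> x \<in> carrier V"
  by (rule smult_closed)

lemma act_add: "a \<in> carrier weyl \<Longrightarrow> b \<in> carrier weyl \<Longrightarrow> x \<in> carrier V \<Longrightarrow>
    (\<lambda>f. a f + b f) \<odot> x = a \<odot> x \<oplus> b \<odot> x"
  using smult_l_distr[of a b x] by simp

lemma act_mult: "a \<in> carrier weyl \<Longrightarrow> b \<in> carrier weyl \<Longrightarrow> x \<in> carrier V \<Longrightarrow>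
    (\<lambda>f. a (b f)) \<odot> x = a \<odot> (b \<odot> x)"
  using smult_assoc[of a b x] by simp

lemma act_id [simp]: "x \<in> carrier V \<Longrightarrow> (\<lambda>f. f) \<odot> x = x"
  using smult_one[of x] by simp

lemma act_zero_left [simp]: "x \<in> carrier V \<Longrightarrow> (\<lambda>_. 0) \<odot> x = \<zero>"
  using act_add[of "\<lambda>_. 0" "\<lambda>_. 0" x] by simp

lemma act_zero_right [simp]: "a \<in> carrier weyl \<Longrightarrow> a \<odot> \<zero> = \<zero>"
  using smult_r_distr[of a \<zero> \<zero>] by simp

lemma act_minus_right: "a \<in> carrier weyl \<Longrightarrow> x \<in> carrier V \<Longrightarrow> a \<odot> (\<ominus> x) = \<ominus> (a \<odot> x)"
  using smult_r_distr[of a x "\<ominus> x"] by (intro M.minus_equality[symmetric]) (simp_all add: M.r_neg M.a_comm)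

lemma act_minus_left: "a \<in> carrier weyl \<Longrightarrow> x \<in> carrier V \<Longrightarrow> (\<lambda>f. - a f) \<odot> x = \<ominus> (a \<odot> x)"
  using act_add[of a "\<lambda>f. - a f" x]
  by (intro M.minus_equality[symmetric]) (simp_all add: weyl_uminus M.a_comm)

lemma act_scale: "a \<in> carrier weyl \<Longrightarrow> x \<in> carrier V \<Longrightarrow>
    (\<lambda>f. pm_scale c (a f)) \<odot> x = pm_scale c \<odot> (a \<odot> x)"
  by (rule act_mult) auto

lemma act_scale_comm:
  assumes "a \<in> carrier weyl" "x \<in> carrier V"
  shows "a \<odot> (pm_scale c \<odot> x) = pm_scale c \<odot> (a \<odot> x)"
proof -
  have "(\<lambda>f. a (pm_scale c f)) = (\<lambda>f. pm_scale c (a f))"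
    using linear_op_scale[OF weyl_linear[OF assms(1)]] by blast
  then show ?thesis
    using act_mult[OF assms(1) pm_scale_closed[of c] assms(2)] act_scale[OF assms, of c] by metis
qed

lemma scale_simps [simp]:
  assumes "x \<in> carrier V"
  shows "pm_scale 0 \<odot> x = \<zero>" "pm_scale 1 \<odot> x = x"
    "pm_scale c \<odot> (pm_scale d \<odot> x) = pm_scale (c * d) \<odot> x"
proof -
  have "pm_scale 0 = (\<lambda>f :: ('i, 'k) mpol. 0)" "pm_scale 1 = (\<lambda>f :: ('i, 'k) mpol. f)"
    "pm_scale (c * d) = (\<lambda>f :: ('i, 'k) mpol. pm_scale c (pm_scale d f))"
    by (simp_all add: fun_eq_iff)
  then show "pm_scale 0 \<odot> x = \<zero>" "pm_scale 1 \<odot> x = x"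
    "pm_scale c \<odot> (pm_scale d \<odot> x) = pm_scale (c * d) \<odot> x"
    using assms act_mult[of "pm_scale c" "pm_scale d" x] by simp_all
qed

lemma weight_space_iff:
  "x \<in> weight_space V r \<longleftrightarrow> x \<in> carrier V \<and> (\<forall>i. t_op i \<odot> x = pm_scale (r i) \<odot> x)"
  by (simp add: weight_space_def scal_def)

lemma weight_space_closed: "x \<in> weight_space V r \<Longrightarrow> x \<in> carrier V"
  by (simp add: weight_space_def)

lemma weight_space_zero: "\<zero> \<in> weight_space V r"
  by (simp add: weight_space_iff)

lemma weight_space_add: "x \<in> weight_space V r \<Longrightarrow> y \<in> weight_space V r \<Longrightarrow> x \<oplus> y \<in> weight_space V r"
  by (simp add: weight_space_iff smult_r_distr)

lemma weight_space_scale: "x \<in> weight_space V r \<Longrightarrow> pm_scale c \<odot> x \<in> weight_space V r"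
  by (simp add: weight_space_iff act_scale_comm[OF t_op_closed] mult.commute)

lemma wideal_act:
  assumes "s \<in> wideal r" "x \<in> weight_space V r"
  shows "s \<odot> x = \<zero>"
  using assms(1)
proof induction
  case zero
  then show ?case using assms(2) by (simp add: weight_space_iff)
next
  case (step s b i)
  have x: "x \<in> carrier V" using assms(2) by (simp add: weight_space_iff)
  have "(\<lambda>f. t_op i f - pm_scale (r i) f) \<odot> x = t_op i \<odot> x \<ominus> pm_scale (r i) \<odot> x"
    using act_add[of "t_op i" "\<lambda>f. - pm_scale (r i) f" x] x
    by (simp add: act_minus_left weyl_uminus a_minus_def)
  also have "\<dots> = \<zero>"
    using assms(2) x by (simp add: weight_space_iff a_minus_def M.r_neg)
  finally have *: "(\<lambda>f. t_op i f - pm_scale (r i) f) \<odot> x = \<zero>" .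
  have c: "(\<lambda>f. t_op i f - pm_scale (r i) f) \<in> carrier (weyl :: ('i, 'k) mpol_op ring)"
    by (simp add: weyl_diff)
  show ?case
    using act_add[OF weyl_closed(6)[OF step.hyps(2) c] wideal_closed[OF step.hyps(1)] x]
      act_mult[OF step.hyps(2) c x] step * by simp
qed

lemma weq_act:
  assumes "weq r a b" "a \<in> carrier weyl" "b \<in> carrier weyl" "x \<in> weight_space V r"
  shows "a \<odot> x = b \<odot> x"
proof -
  have x: "x \<in> carrier V" using assms(4) by (simp add: weight_space_iff)
  have "(\<lambda>f. (a f - b f) + b f) \<odot> x = (\<lambda>f. a f - b f) \<odot> x \<oplus> b \<odot> x"
    using assms(2,3) x by (intro act_add weyl_diff)
  then show ?thesis
    using wideal_act[OF assms(1)[unfolded weq_def] assms(4)] x assms(3) by simp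
qed

lemma mon_weight_space:
  assumes "x \<in> weight_space V r"
  shows "wmon \<alpha> \<beta> \<odot> x \<in> weight_space V (\<lambda>i. r i + wt \<alpha> \<beta> i)"
proof -
  have x: "x \<in> carrier V" using assms by (simp add: weight_space_iff)
  have "t_op i \<odot> (wmon \<alpha> \<beta> \<odot> x) = pm_scale (r i + wt \<alpha> \<beta> i) \<odot> (wmon \<alpha> \<beta> \<odot> x)" for i
  proof -
    have "t_op i \<odot> (wmon \<alpha> \<beta> \<odot> x) = (\<lambda>f. t_op i (wmon \<alpha> \<beta> f)) \<odot> x"
      using act_mult[of "t_op i" "wmon \<alpha> \<beta>" x] x by simp
    also have "\<dots> = (\<lambda>f. pm_scale (r i + wt \<alpha> \<beta> i) (wmon \<alpha> \<beta> f)) \<odot> x"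
    proof (rule weq_act[OF _ _ _ assms])
      show "weq r (\<lambda>f. t_op i (wmon \<alpha> \<beta> f)) (\<lambda>f. pm_scale (r i + wt \<alpha> \<beta> i) (wmon \<alpha> \<beta> f))"
        using weq_add[OF weq_t[of "wmon \<alpha> \<beta>" r i] weq_refl[of r "\<lambda>f. pm_scale (wt \<alpha> \<beta> i) (wmon \<alpha> \<beta> f)"]]
        by (simp add: t_mon)
    qed (simp_all add: weyl_pm_scale weyl_closed(6)[OF t_op_closed wmon_closed])
    also have "\<dots> = pm_scale (r i + wt \<alpha> \<beta> i) \<odot> (wmon \<alpha> \<beta> \<odot> x)"
      by (rule act_scale) (simp_all add: x)
    finally show ?thesis .
  qed
  then show ?thesis using x by (simp add: weight_space_iff)
qed

lemma wunit_weight_space: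
  assumes "x \<in> weight_space V r" "\<delta> \<in> Zf"
  shows "wunit \<delta> \<odot> x \<in> weight_space V (\<lambda>i. r i + \<delta> i)"
proof -
  obtain \<alpha> \<beta> where \<delta>: "\<delta> = wt \<alpha> \<beta>" using Zf_wtE[OF assms(2)] .
  have "wt (\<alpha> - \<beta>) (\<beta> - \<alpha>) i = (wt \<alpha> \<beta> i :: 'k)" for i
    by (cases "count \<alpha> i \<le> count \<beta> i") (auto simp: wt_def of_nat_diff)
  then show ?thesis
    using mon_weight_space[OF assms(1), of "\<alpha> - \<beta>" "\<beta> - \<alpha>"] by (simp add: \<delta> wunit_eq)
qed

lemma projector_act:
  "projector \<pi> \<chi> \<Longrightarrow> x \<in> weight_space V r \<Longrightarrow> \<pi> \<odot> x = pm_scale (\<chi> r) \<odot> x"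
  by (rule weq_act) (auto simp: projector_def)

lemma projector_one: "projector \<pi> \<chi> \<Longrightarrow> x \<in> weight_space V r \<Longrightarrow> \<chi> r = 1 \<Longrightarrow> \<pi> \<odot> x = x"
  using projector_act[of \<pi> \<chi> x r] weight_space_closed[of x r] by simp

lemma projector_zero: "projector \<pi> \<chi> \<Longrightarrow> x \<in> weight_space V r \<Longrightarrow> \<chi> r = 0 \<Longrightarrow> \<pi> \<odot> x = \<zero>"
  using projector_act[of \<pi> \<chi> x r] weight_space_closed[of x r] by simp

lemma projector_closed: "projector \<pi> \<chi> \<Longrightarrow> \<pi> \<in> carrier weyl"
  by (simp add: projector_def)

lemma weight_sums_closed: "x \<in> weight_sums V \<Longrightarrow> x \<in> carrier V"
  by (induction rule: weight_sums.induct) (auto simp: weight_space_iff)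

lemma weight_sums_act:
  assumes "a \<in> carrier weyl" "y \<in> weight_space V r"
  shows "a \<odot> y \<in> weight_sums V"
  using assms(1)
proof (induction rule: weyl_mon_induct)
  case zero
  then show ?case using assms(2) by (simp add: weight_sums.zero weight_space_closed)
next
  case (step c \<alpha> \<beta> b)
  have y: "y \<in> carrier V" using assms(2) by (rule weight_space_closed)
  show ?case
    using weight_sums.step[OF weight_space_scale[OF mon_weight_space[OF assms(2)]] step.IH, of c \<alpha> \<beta>]
    unfolding act_add[OF weyl_pm_scale[OF wmon_closed] step.hyps(1) y] act_scale[OF wmon_closed y] .
qed

text \<open>The projector depends on \<open>x\<close>: it vanishes at the finitely many weights
  other than \<open>q\<close> that occur in \<open>x\<close>.\<close>

lemma weight_projection_ex:
  assumes "x \<in> weight_sums V"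
  obtains \<pi> \<chi> where "projector \<pi> \<chi>" "\<chi> q = 1" "\<pi> \<odot> x \<in> weight_space V q"
proof -
  have "\<exists>M. finite M \<and> q \<notin> M \<and> (\<forall>\<pi> \<chi>. projector \<pi> \<chi> \<longrightarrow> \<chi> q = 1 \<longrightarrow> (\<forall>m\<in>M. \<chi> m = 0) \<longrightarrow>
      \<pi> \<odot> x \<in> weight_space V q)"
    using assms
  proof induction
    case zero
    then show ?case
      by (intro exI[of _ "{}"]) (auto simp: weight_space_zero projector_closed)
  next
    case (step y r x)
    then obtain M where M: "finite M" "q \<notin> M"
      "\<And>\<pi> \<chi>. projector \<pi> \<chi> \<Longrightarrow> \<chi> q = 1 \<Longrightarrow> \<forall>m\<in>M. \<chi> m = 0 \<Longrightarrow> \<pi> \<odot> x \<in> weight_space V q"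
      by blast
    have y: "y \<in> carrier V" using step.hyps(1) by (rule weight_space_closed)
    have x: "x \<in> carrier V" using step.hyps(2) by (rule weight_sums_closed)
    have "\<pi> \<odot> (y \<oplus> x) \<in> weight_space V q"
      if "projector \<pi> \<chi>" "\<chi> q = 1" "\<forall>m\<in>M. \<chi> m = 0" "r \<noteq> q \<Longrightarrow> \<chi> r = 0" for \<pi> \<chi>
    proof -
      have "\<pi> \<odot> y \<in> weight_space V q"
        using that(2,4) projector_one[OF that(1) step.hyps(1)] projector_zero[OF that(1) step.hyps(1)]
          step.hyps(1) weight_space_zero by (cases "r = q") auto
      then show ?thesis
        using M(3)[OF that(1-3)] x y projector_closed[OF that(1)]
        by (simp add: smult_r_distr weight_space_add)
    qed
    then show ?case
      \<comment> \<open>\<open>q\<close> must stay out of the set, since \<open>\<chi>\<close> is 1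
        there.\<close>
      using M(1,2) by (intro exI[of _ "M \<union> ({r} - {q})"]) (auto split: if_splits)
  qed
  then obtain M where "finite M" "q \<notin> M" and
    M: "\<And>\<pi> \<chi>. projector \<pi> \<chi> \<Longrightarrow> \<chi> q = 1 \<Longrightarrow> \<forall>m\<in>M. \<chi> m = 0 \<Longrightarrow> \<pi> \<odot> x \<in> weight_space V q"
    by blast
  then show ?thesis using projector_ex[of M q] that by metis
qed

lemma projector_finsum:
  assumes "projector \<pi> \<chi>" "\<chi> q = 1" "finite S" "\<And>m. v m \<in> weight_space V m"
    and "\<And>m. m \<in> S \<Longrightarrow> m \<noteq> q \<Longrightarrow> \<chi> m = 0"
  shows "\<pi> \<odot> finsum V v S = (if q \<in> S then v q else \<zero>)"
  using assms(3,5)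
proof (induction S)
  case empty
  then show ?case using projector_closed[OF assms(1)] by simp
next
  case (insert m S)
  have v: "v m \<in> carrier V" for m using assms(4) by (rule weight_space_closed)
  then have fs: "finsum V v S \<in> carrier V" by (intro M.finsum_closed) auto
  have "\<pi> \<odot> finsum V v (insert m S) = \<pi> \<odot> v m \<oplus> \<pi> \<odot> finsum V v S"
    using insert v fs projector_closed[OF assms(1)] by (simp add: M.finsum_insert smult_r_distr)
  moreover have "\<pi> \<odot> v m = (if m = q then v q else \<zero>)"
    using projector_one[OF assms(1) assms(4)] projector_zero[OF assms(1) assms(4)] assms(2) insert.prems
    by auto
  ultimately show ?case using insert v by auto
qed

lemma finsum_weight_sums:
  assumes "finite S" "\<And>m. v m \<in> weight_space V m"
  shows "finsum V v S \<in> weight_sums V"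
  using assms(1)
proof (induction S)
  case empty
  then show ?case by (simp add: weight_sums.zero)
next
  case (insert m S)
  have "v m \<in> carrier V" for m using assms(2) by (rule weight_space_closed)
  then show ?case
    using insert weight_sums.step[OF assms(2) insert.IH] by (simp add: M.finsum_insert)
qed

lemma finsum_support:
  assumes "finite S" "{m. v m \<noteq> \<zero>} \<subseteq> S" "\<And>m. v m \<in> carrier V"
  shows "finsum V v {m. v m \<noteq> \<zero>} = finsum V v S"
  using assms by (intro M.add.finprod_mono_neutral_cong_left) auto

lemma weight_moduleI:
  assumes "\<And>x. x \<in> carrier V \<Longrightarrow> x \<in> weight_sums V"
  shows "weight_module V"
  unfolding weight_module_def
proof (intro conjI ballI left_module_V)
  fix x assume "x \<in> carrier V"
  let ?P = "\<lambda>x v. (\<forall>p. v p \<in> weight_space V p) \<and> finite {p. v p \<noteq> \<zero>} \<and> x = finsum V v {p. v p \<noteq> \<zero>}"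
  have "\<exists>v. ?P x v"
    using assms[OF \<open>x \<in> carrier V\<close>]
  proof induction
    case zero
    then show ?case by (intro exI[of _ "\<lambda>_. \<zero>"]) (simp add: weight_space_zero)
  next
    case (step y r x)
    then obtain v where v: "\<And>p. v p \<in> weight_space V p" "finite {p. v p \<noteq> \<zero>}" "x = finsum V v {p. v p \<noteq> \<zero>}"
      by blast
    have vc: "v p \<in> carrier V" for p using v(1) by (rule weight_space_closed)
    have yc: "y \<in> carrier V" using step.hyps(1) by (rule weight_space_closed)
    \<comment> \<open>The new summand is absorbed into the component of weight \<open>r\<close>.
      That weight is split off from the support because \<open>y \<oplus> v r\<close> may vanish
      where \<open>v r\<close> does not, and conversely.\<close>
    let ?v = "v(r := y \<oplus> v r)" and ?S = "{p. v p \<noteq> \<zero>} - {r}"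
    have fin: "finite (insert r ?S)" using v(2) by simp
    have sub: "{p. ?v p \<noteq> \<zero>} \<subseteq> insert r ?S" "{p. v p \<noteq> \<zero>} \<subseteq> insert r ?S" by auto
    have vc': "?v p \<in> carrier V" for p using vc yc by simp
    have "finsum V ?v {p. ?v p \<noteq> \<zero>} = finsum V ?v (insert r ?S)"
      by (rule finsum_support[OF fin sub(1) vc'])
    also have "\<dots> = (y \<oplus> v r) \<oplus> finsum V ?v ?S"
      using v(2) vc vc' yc by (subst M.finsum_insert) auto
    also have "finsum V ?v ?S = finsum V v ?S"
      using vc by (intro M.finsum_cong') auto
    also have "(y \<oplus> v r) \<oplus> finsum V v ?S = y \<oplus> (v r \<oplus> finsum V v ?S)"
      using yc vc by (intro M.a_assoc M.finsum_closed) auto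
    also have "v r \<oplus> finsum V v ?S = finsum V v (insert r ?S)"
      using v(2) vc by (subst M.finsum_insert) auto
    also have "\<dots> = x"
      unfolding v(3) by (rule finsum_support[OF fin sub(2) vc, symmetric])
    finally have "y \<oplus> x = finsum V ?v {p. ?v p \<noteq> \<zero>}" by (rule sym)
    moreover have "finite {p. ?v p \<noteq> \<zero>}" using finite_subset[OF sub(1) fin] .
    moreover have "?v p \<in> weight_space V p" for p
      using v(1) step.hyps(1) weight_space_add by simp
    ultimately show ?case by blast
  qed
  \<comment> \<open>A projector separating \<open>q\<close> from all other weights in both supports
    recovers the component at \<open>q\<close> from \<open>x\<close>.\<close>
  moreover have "v = v'" if v: "?P x v" and v': "?P x v'" for v v'
  proof
    fix q
    let ?S = "insert q ({p. v p \<noteq> \<zero>} \<union> {p. v' p \<noteq> \<zero>})"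
    have fin: "finite ?S" using v v' by simp
    obtain \<pi> \<chi> where \<pi>: "projector \<pi> \<chi>" "\<chi> q = 1" "\<And>m. m \<in> ?S - {q} \<Longrightarrow> \<chi> m = 0"
      using projector_ex[of "?S - {q}" q] fin by auto
    have S: "x = finsum V v ?S" "x = finsum V v' ?S"
      using v v' fin finsum_support[of ?S v] finsum_support[of ?S v'] weight_space_closed by auto
    have "\<pi> \<odot> x = v q"
      unfolding S(1) using projector_finsum[OF \<pi>(1,2) fin, of v] v \<pi>(3) by auto
    moreover have "\<pi> \<odot> x = v' q"
      unfolding S(2) using projector_finsum[OF \<pi>(1,2) fin, of v'] v' \<pi>(3) by auto
    ultimately show "v q = v' q" by simp
  qed
  ultimately show "\<exists>!v. ?P x v" by blast
qed

end

lemma weight_moduleD: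
  assumes "weight_module V"
  shows "weyl_module (V :: (('i, 'k::field_char_0) mpol_op, 'm) module)"
    and "x \<in> carrier V \<Longrightarrow> x \<in> weight_sums V"
proof -
  show "weyl_module V" using assms by (simp add: weight_module_def weyl_module_def)
  then interpret weyl_module V .
  assume "x \<in> carrier V"
  then obtain v where "\<forall>p. v p \<in> weight_space V p" "finite {p. v p \<noteq> \<zero>\<^bsub>V\<^esub>}" "x = finsum V v {p. v p \<noteq> \<zero>\<^bsub>V\<^esub>}"
    using assms unfolding weight_module_def by blast
  then show "x \<in> weight_sums V" using finsum_weight_sums by simp
qed

lemma left_module_hom_simps:
  assumes "h \<in> left_module_hom R M N" "x \<in> carrier M"
  shows "h x \<in> carrier N" "y \<in> carrier M \<Longrightarrow> h (x \<oplus>\<^bsub>M\<^esub> y) = h x \<oplus>\<^bsub>N\<^esub> h y"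
    "a \<in> carrier R \<Longrightarrow> h (a \<odot>\<^bsub>M\<^esub> x) = a \<odot>\<^bsub>N\<^esub> h x"
  using assms by (auto simp: left_module_hom_def)

lemma hom_weight_space:
  "h \<in> left_module_hom weyl M N \<Longrightarrow> x \<in> weight_space M r \<Longrightarrow> h x \<in> weight_space N r"
  for M :: "(('i, 'k::field_char_0) mpol_op, 'm) module"
  unfolding weight_space_def left_module_hom_def
  by (auto simp: Pi_iff) (metis t_op_closed weyl_closed(1))

lemma hom_zero:
  fixes M :: "(('i, 'k::field_char_0) mpol_op, 'm) module"
  assumes "weyl_module M" "weyl_module N" "h \<in> left_module_hom weyl M N"
  shows "h \<zero>\<^bsub>M\<^esub> = \<zero>\<^bsub>N\<^esub>"
proof -
  interpret M: weyl_module M by fact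
  interpret N: weyl_module N by fact
  have "h ((\<lambda>_. 0) \<odot>\<^bsub>M\<^esub> \<zero>\<^bsub>M\<^esub>) = (\<lambda>_. 0) \<odot>\<^bsub>N\<^esub> h \<zero>\<^bsub>M\<^esub>"
    by (rule left_module_hom_simps(3)[OF assms(3)]) auto
  moreover have "h \<zero>\<^bsub>M\<^esub> \<in> carrier N" using left_module_hom_simps(1)[OF assms(3)] by simp
  ultimately show ?thesis by simp
qed

section \<open>Cyclic modules\<close>

lemma (in weyl_module) act_diff: "a \<in> carrier weyl \<Longrightarrow> b \<in> carrier weyl \<Longrightarrow> x \<in> carrier V \<Longrightarrow>
    (\<lambda>f. a f - b f) \<odot> x = a \<odot> x \<ominus> b \<odot> x"
  using act_add[of a "\<lambda>f. - b f" x] act_minus_left[of b x] by (simp add: weyl_uminus a_minus_def)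

lemma (in weyl_module) eq_if_diff_zero:
  assumes "x \<in> carrier V" "y \<in> carrier V" "x \<ominus> y = \<zero>"
  shows "x = y"
proof -
  have "x = (x \<ominus> y) \<oplus> y"
    using assms(1,2) by (simp add: a_minus_def M.a_assoc M.l_neg)
  then show ?thesis using assms by simp
qed

definition cyclic_on :: "(('i, 'k::field) mpol_op, 'm) module \<Rightarrow> 'm \<Rightarrow> bool" where
  "cyclic_on M x \<longleftrightarrow> x \<in> carrier M \<and> (\<forall>y\<in>carrier M. \<exists>a\<in>carrier weyl. y = a \<odot>\<^bsub>M\<^esub> x)"

lemma cyclic_onD: "cyclic_on M x \<Longrightarrow> x \<in> carrier M"
  "cyclic_on M x \<Longrightarrow> y \<in> carrier M \<Longrightarrow> \<exists>a\<in>carrier weyl. y = a \<odot>\<^bsub>M\<^esub> x"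
  by (auto simp: cyclic_on_def)

text \<open>\<open>M\<close> is the quotient of \<open>A\<close> by the annihilator of
  \<open>x\<close>, so \<open>ann\<close> is just the well-definedness of sending \<open>a x\<close>
  to \<open>a y\<close>.\<close>

lemma cyclic_hom:
  fixes M :: "(('i, 'k::field_char_0) mpol_op, 'm) module" and N :: "(('i, 'k) mpol_op, 'n) module"
  assumes "weyl_module M" "weyl_module N" "cyclic_on M x" "y \<in> carrier N"
    and ann: "\<And>a. a \<in> carrier weyl \<Longrightarrow> a \<odot>\<^bsub>M\<^esub> x = \<zero>\<^bsub>M\<^esub> \<Longrightarrow> a \<odot>\<^bsub>N\<^esub> y = \<zero>\<^bsub>N\<^esub>"
  obtains h where "h \<in> left_module_hom weyl M N" "\<And>a. a \<in> carrier weyl \<Longrightarrow> h (a \<odot>\<^bsub>M\<^esub> x) = a \<odot>\<^bsub>N\<^esub> y"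
proof
  interpret M: weyl_module M by fact
  interpret N: weyl_module N by fact
  note x = cyclic_onD(1)[OF assms(3)]
  define h where "h z = (SOME a. a \<in> carrier weyl \<and> z = a \<odot>\<^bsub>M\<^esub> x) \<odot>\<^bsub>N\<^esub> y" for z
  show h: "h (a \<odot>\<^bsub>M\<^esub> x) = a \<odot>\<^bsub>N\<^esub> y" if a: "a \<in> carrier weyl" for a
  proof -
    define b where "b = (SOME b. b \<in> carrier weyl \<and> a \<odot>\<^bsub>M\<^esub> x = b \<odot>\<^bsub>M\<^esub> x)"
    have b: "b \<in> carrier weyl" "a \<odot>\<^bsub>M\<^esub> x = b \<odot>\<^bsub>M\<^esub> x"
      using someI_ex[of "\<lambda>b. b \<in> carrier weyl \<and> a \<odot>\<^bsub>M\<^esub> x = b \<odot>\<^bsub>M\<^esub> x"] a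
      unfolding b_def by blast+
    have "(\<lambda>f. a f - b f) \<odot>\<^bsub>M\<^esub> x = \<zero>\<^bsub>M\<^esub>"
      unfolding M.act_diff[OF a b(1) x] b(2)[symmetric]
      using M.act_closed[OF a x] by (simp add: a_minus_def M.M.r_neg)
    from ann[OF weyl_diff[OF a b(1)] this] have "a \<odot>\<^bsub>N\<^esub> y \<ominus>\<^bsub>N\<^esub> b \<odot>\<^bsub>N\<^esub> y = \<zero>\<^bsub>N\<^esub>"
      unfolding N.act_diff[OF a b(1) assms(4)] .
    then have "a \<odot>\<^bsub>N\<^esub> y = b \<odot>\<^bsub>N\<^esub> y"
      by (rule N.eq_if_diff_zero[OF N.act_closed[OF a assms(4)] N.act_closed[OF b(1) assms(4)]])
    then show ?thesis by (simp add: h_def b_def)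
  qed
  show "h \<in> left_module_hom weyl M N"
    unfolding left_module_hom_def
  proof safe
    fix z assume "z \<in> carrier M"
    then obtain a where "a \<in> carrier weyl" "z = a \<odot>\<^bsub>M\<^esub> x" using cyclic_onD(2)[OF assms(3)] by blast
    then show "h z \<in> carrier N" using h assms(4) by simp
  next
    fix z z' assume "z \<in> carrier M" "z' \<in> carrier M"
    then obtain a a' where a: "a \<in> carrier weyl" "z = a \<odot>\<^bsub>M\<^esub> x" "a' \<in> carrier weyl" "z' = a' \<odot>\<^bsub>M\<^esub> x"
      using cyclic_onD(2)[OF assms(3)] by meson
    then show "h (z \<oplus>\<^bsub>M\<^esub> z') = h z \<oplus>\<^bsub>N\<^esub> h z'"
      using h[OF weyl_closed(7)[OF a(1,3)]] M.act_add[OF a(1,3) x] N.act_add[OF a(1,3) assms(4)] h by simp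
  next
    fix b :: "('i, 'k) mpol_op" and z assume b: "b \<in> carrier weyl" and "z \<in> carrier M"
    then obtain a where a: "a \<in> carrier weyl" "z = a \<odot>\<^bsub>M\<^esub> x" using cyclic_onD(2)[OF assms(3)] by blast
    then show "h (b \<odot>\<^bsub>M\<^esub> z) = b \<odot>\<^bsub>N\<^esub> h z"
      using h[OF weyl_closed(6)[OF b a(1)]] M.act_mult[OF b a(1) x] N.act_mult[OF b a(1) assms(4)] h by simp
  qed
qed

lemma cyclic_weight_module:
  assumes "weyl_module M" "cyclic_on M x" "x \<in> weight_space M r"
  shows "weight_module M"
proof -
  interpret weyl_module M by fact
  show ?thesis
    using cyclic_onD(2)[OF assms(2)] weight_sums_act[OF _ assms(3)] by (intro weight_moduleI) blast
qed

lemma projective_coverI: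
  fixes Q :: "(('i, 'k::field_char_0) mpol_op, 'm) module" and L :: "(('i, 'k) mpol_op, 'n) module"
  assumes "weyl_module Q" "cyclic_on Q e" "e \<in> weight_space Q q"
    and ann: "\<And>a. a \<in> carrier weyl \<Longrightarrow> a \<odot>\<^bsub>Q\<^esub> e = \<zero>\<^bsub>Q\<^esub> \<Longrightarrow> a \<in> wideal q"
    and "weyl_module L" "cyclic_on L y" "y \<in> weight_space L q" "y \<noteq> \<zero>\<^bsub>L\<^esub>"
  shows "projective_cover_in_W TYPE('u) TYPE('v) Q L"
proof -
  interpret Q: weyl_module Q by fact
  interpret L: weyl_module L by fact
  have e: "e \<in> carrier Q" by (rule cyclic_onD(1)[OF assms(2)])
  have y: "y \<in> carrier L" by (rule cyclic_onD(1)[OF assms(6)])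
  have "projective_in_W TYPE('u) TYPE('v) Q"
    unfolding projective_in_W_def
  proof (intro conjI allI impI ballI)
    show "weight_module Q" by (rule cyclic_weight_module[OF assms(1-3)])
    fix U :: "(('i, 'k) mpol_op, 'u) module" and V :: "(('i, 'k) mpol_op, 'v) module" and f g
    assume UV: "weight_module U \<and> weight_module V"
      and f: "f \<in> left_module_hom weyl U V" and g: "g \<in> left_module_hom weyl Q V"
      and surj: "f ` carrier U = carrier V"
    interpret U: weyl_module U using weight_moduleD(1) UV by blast
    interpret V: weyl_module V using weight_moduleD(1) UV by blast
    have ge: "g e \<in> weight_space V q" by (rule hom_weight_space[OF g assms(3)])
    have "g e \<in> f ` carrier U" unfolding surj by (rule V.weight_space_closed[OF ge])
    then obtain u where u: "u \<in> carrier U" "g e = f u" by (rule imageE)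
    \<comment> \<open>The preimage \<open>u\<close> need not be a weight vector, but its component
      of weight \<open>q\<close> is still a preimage, because \<open>g e\<close> has weight
      \<open>q\<close>.\<close>
    obtain \<pi> \<chi> where \<pi>: "projector \<pi> \<chi>" "\<chi> q = 1" "\<pi> \<odot>\<^bsub>U\<^esub> u \<in> weight_space U q"
      using U.weight_projection_ex[OF weight_moduleD(2)[OF conjunct1[OF UV] u(1)]] by blast
    have fu: "f (\<pi> \<odot>\<^bsub>U\<^esub> u) = g e"
      using left_module_hom_simps(3)[OF f u(1) Q.projector_closed[OF \<pi>(1)]] V.projector_one[OF \<pi>(1) ge \<pi>(2)]
      by (simp add: u(2))
    have uc: "\<pi> \<odot>\<^bsub>U\<^esub> u \<in> carrier U" using \<pi>(3) by (rule U.weight_space_closed)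
    obtain h where h: "h \<in> left_module_hom weyl Q U"
      "\<And>a. a \<in> carrier weyl \<Longrightarrow> h (a \<odot>\<^bsub>Q\<^esub> e) = a \<odot>\<^bsub>U\<^esub> (\<pi> \<odot>\<^bsub>U\<^esub> u)"
      using cyclic_hom[OF assms(1) U.weyl_module_axioms assms(2) uc] U.wideal_act[OF _ \<pi>(3)] ann by blast
    show "\<exists>h\<in>left_module_hom weyl Q U. \<forall>x\<in>carrier Q. f (h x) = g x"
    proof (intro bexI[OF _ h(1)] ballI)
      fix x assume "x \<in> carrier Q"
      then obtain a where a: "a \<in> carrier weyl" "x = a \<odot>\<^bsub>Q\<^esub> e" using cyclic_onD(2)[OF assms(2)] by blast
      then show "f (h x) = g x"
        using h(2)[OF a(1)] left_module_hom_simps(3)[OF f uc a(1)] left_module_hom_simps(3)[OF g e a(1)] fu by simp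
    qed
  qed
  moreover have "\<exists>\<pi>\<in>left_module_hom weyl Q L. \<pi> ` carrier Q = carrier L \<and>
      (\<forall>N. submodule N weyl Q \<and> N <+>\<^bsub>Q\<^esub> {x \<in> carrier Q. \<pi> x = \<zero>\<^bsub>L\<^esub>} = carrier Q \<longrightarrow> N = carrier Q)"
  proof -
    obtain h where h: "h \<in> left_module_hom weyl Q L"
      "\<And>a. a \<in> carrier weyl \<Longrightarrow> h (a \<odot>\<^bsub>Q\<^esub> e) = a \<odot>\<^bsub>L\<^esub> y"
      using cyclic_hom[OF assms(1,5,2) y] L.wideal_act[OF _ assms(7)] ann by blast
    have he: "h e = y" using h(2)[of "\<lambda>f. f"] e y by simp
    have "h ` carrier Q = carrier L"
    proof
      show "h ` carrier Q \<subseteq> carrier L" using left_module_hom_simps(1)[OF h(1)] by blast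
      show "carrier L \<subseteq> h ` carrier Q"
      proof
        fix z assume "z \<in> carrier L"
        then obtain a where a: "a \<in> carrier weyl" "z = a \<odot>\<^bsub>L\<^esub> y" using cyclic_onD(2)[OF assms(6)] by blast
        then show "z \<in> h ` carrier Q" using h(2)[OF a(1)] e by (intro image_eqI[of _ _ "a \<odot>\<^bsub>Q\<^esub> e"]) auto
      qed
    qed
    moreover have "N = carrier Q" if N: "submodule N weyl Q"
      and sum: "N <+>\<^bsub>Q\<^esub> {x \<in> carrier Q. h x = \<zero>\<^bsub>L\<^esub>} = carrier Q" for N
    proof -
      note NE = left_module_submoduleE[OF Q.left_module_V N]
      have "e \<in> N <+>\<^bsub>Q\<^esub> {x \<in> carrier Q. h x = \<zero>\<^bsub>L\<^esub>}" using sum e by simp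
      then obtain n k where nk: "n \<in> N" "k \<in> carrier Q" "h k = \<zero>\<^bsub>L\<^esub>" "e = n \<oplus>\<^bsub>Q\<^esub> k"
        by (auto simp: set_add_def set_mult_def)
      have n: "n \<in> carrier Q" using nk(1) NE(1) by blast
      obtain a where a: "a \<in> carrier weyl" "n = a \<odot>\<^bsub>Q\<^esub> e" using cyclic_onD(2)[OF assms(2) n] by blast
      \<comment> \<open>The part of weight \<open>q\<close> of the summand \<open>n\<close> is
        \<open>c e\<close> and again lies in \<open>N\<close>.\<close>
      obtain \<pi> \<chi> c where \<pi>: "projector \<pi> \<chi>" "\<chi> q = 1" "weq q (\<lambda>f. \<pi> (a f)) (pm_scale c)"
        using scalar_part[OF a(1)] .
      note \<pi>c = Q.projector_closed[OF \<pi>(1)]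
      have "\<pi> \<odot>\<^bsub>Q\<^esub> n = pm_scale c \<odot>\<^bsub>Q\<^esub> e"
        using Q.weq_act[OF \<pi>(3) weyl_closed(6)[OF \<pi>c a(1)] pm_scale_closed assms(3)] Q.act_mult[OF \<pi>c a(1) e] a(2)
        by simp
      then have ce: "pm_scale c \<odot>\<^bsub>Q\<^esub> e \<in> N" using NE(5)[OF \<pi>c nk(1)] by simp
      \<comment> \<open>Otherwise \<open>e\<close> would be the projection of \<open>k\<close>, and
        its image \<open>y\<close> would be 0.\<close>
      have "c \<noteq> 0"
      proof
        assume "c = 0"
        then have "\<pi> \<odot>\<^bsub>Q\<^esub> n = \<zero>\<^bsub>Q\<^esub>" using \<open>\<pi> \<odot>\<^bsub>Q\<^esub> n = pm_scale c \<odot>\<^bsub>Q\<^esub> e\<close> e by simp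
        moreover have "\<pi> \<odot>\<^bsub>Q\<^esub> e = e" by (rule Q.projector_one[OF \<pi>(1) assms(3) \<pi>(2)])
        ultimately have "e = \<pi> \<odot>\<^bsub>Q\<^esub> k"
          using Q.smult_r_distr[OF \<pi>c n nk(2)] nk(2,4) \<pi>c by simp
        then have "h e = \<pi> \<odot>\<^bsub>L\<^esub> h k" using left_module_hom_simps(3)[OF h(1) nk(2) \<pi>c] by simp
        then show False using nk(3) \<pi>c he assms(8) by simp
      qed
      then have "e \<in> N" using NE(5)[OF pm_scale_closed[of "1 / c"] ce] e by simp
      then show ?thesis
        using NE(1,5) cyclic_onD(2)[OF assms(2)] by blast
    qed
    ultimately show ?thesis using h(1) by blast
  qed
  ultimately show ?thesis
    using cyclic_weight_module[OF assms(5-7)] by (simp add: projective_cover_in_W_def)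
qed

section \<open>Extension of functionals\<close>

text \<open>A linear functional on the weight space at \<open>q\<close>, extended by 0 to the other
  weights.\<close>

locale weight_functional = weyl_module V for V :: "(('i, 'k::field_char_0) mpol_op, 'm) module" (structure) +
  fixes q :: "'i \<Rightarrow> 'k" and \<mu> :: "'m \<Rightarrow> 'k"
  assumes sums: "x \<in> carrier V \<Longrightarrow> x \<in> weight_sums V"
    and add: "x \<in> carrier V \<Longrightarrow> y \<in> carrier V \<Longrightarrow> \<mu> (x \<oplus> y) = \<mu> x + \<mu> y"
    and scale: "x \<in> carrier V \<Longrightarrow> \<mu> (pm_scale c \<odot> x) = c * \<mu> x"
    and off: "x \<in> weight_space V r \<Longrightarrow> r \<noteq> q \<Longrightarrow> \<mu> x = 0"
begin

lemma functional_zero: "\<mu> \<zero> = 0"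
  using add[of \<zero> \<zero>] by simp

lemma functional_minus: "x \<in> carrier V \<Longrightarrow> \<mu> (\<ominus> x) = - \<mu> x"
  using add[of x "\<ominus> x"] by (simp add: M.r_neg functional_zero add_eq_0_iff)

lemma functional_projector:
  assumes "projector \<pi> \<chi>" "\<chi> q = 1" "x \<in> carrier V"
  shows "\<mu> (\<pi> \<odot> x) = \<mu> x"
  using sums[OF assms(3)]
proof induction
  case zero
  then show ?case using projector_closed[OF assms(1)] by simp
next
  case (step y r x)
  have c: "y \<in> carrier V" "x \<in> carrier V" "\<pi> \<in> carrier weyl"
    using step weight_space_closed weight_sums_closed projector_closed[OF assms(1)] by auto
  have "\<mu> (\<pi> \<odot> y) = \<mu> y"
    using projector_one[OF assms(1) step.hyps(1)] projector_act[OF assms(1) step.hyps(1)] assms(2)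
      off[OF step.hyps(1)] scale[OF c(1)] by (cases "r = q") auto
  then show ?case using c step.IH by (simp add: smult_r_distr add)
qed

end

text \<open>A linear functional vanishing here vanishes on \<open>K\<close> and off the weight
  \<open>q\<close>, which is how the functional in \<open>functional_extension\<close> gets its
  support.\<close>

inductive_set ext_kernel for V K q where
  zero: "\<zero>\<^bsub>V\<^esub> \<in> ext_kernel V K q"
| ker: "z \<in> K \<Longrightarrow> x \<in> ext_kernel V K q \<Longrightarrow> z \<oplus>\<^bsub>V\<^esub> x \<in> ext_kernel V K q"
| off: "w \<in> weight_space V r \<Longrightarrow> r \<noteq> q \<Longrightarrow> x \<in> ext_kernel V K q \<Longrightarrow> w \<oplus>\<^bsub>V\<^esub> x \<in> ext_kernel V K q"

definition (in weyl_module) subspace :: "'m set \<Rightarrow> bool" where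
  "subspace H \<longleftrightarrow> H \<subseteq> carrier V \<and> \<zero> \<in> H \<and> (\<forall>x\<in>H. \<forall>y\<in>H. x \<oplus> y \<in> H) \<and> (\<forall>c. \<forall>x\<in>H. pm_scale c \<odot> x \<in> H)"

text \<open>Zorn's lemma gives a subspace \<open>H\<close> above \<open>H0\<close> that is maximal
  among those avoiding \<open>v\<close>. It is a complement to the line of \<open>v\<close>, and
  \<open>\<nu>\<close> reads off the coefficient of \<open>v\<close>.\<close>

lemma (in weyl_module) subspace_separation:
  assumes "subspace H0" "v \<in> carrier V" "v \<notin> H0"
  obtains \<nu> where "\<And>x y. x \<in> carrier V \<Longrightarrow> y \<in> carrier V \<Longrightarrow> \<nu> (x \<oplus> y) = \<nu> x + \<nu> y"
    "\<And>c x. x \<in> carrier V \<Longrightarrow> \<nu> (pm_scale c \<odot> x) = c * \<nu> x"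
    "\<And>x. x \<in> H0 \<Longrightarrow> \<nu> x = (0 :: 'k)" "\<nu> v = 1"
proof -
  let ?F = "{H. subspace H \<and> H0 \<subseteq> H \<and> v \<notin> H}"
  have "\<exists>H\<in>?F. \<forall>X\<in>?F. H \<subseteq> X \<longrightarrow> X = H"
  proof (rule subset_Zorn_nonempty)
    show "?F \<noteq> {}" using assms by blast
    fix C assume C: "C \<noteq> {}" "subset.chain ?F C"
    then have sub: "subspace H" "H0 \<subseteq> H" "v \<notin> H" if "H \<in> C" for H
      using that by (auto simp: subset.chain_def)
    have "x \<oplus> y \<in> \<Union>C" if xy: "x \<in> \<Union>C" "y \<in> \<Union>C" for x y
    proof -
      obtain X Y where "X \<in> C" "x \<in> X" "Y \<in> C" "y \<in> Y" using xy by blast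
      then obtain Z where "Z \<in> C" "x \<in> Z" "y \<in> Z"
        using subset.chain_total[OF C(2), of X Y] by blast
      then show ?thesis using sub(1)[of Z] by (auto simp: subspace_def)
    qed
    then have "subspace (\<Union>C)"
      using sub(1) C(1) unfolding subspace_def by blast
    then show "\<Union>C \<in> ?F" using sub C(1) by blast
  qed
  then obtain H where HF: "H \<in> ?F" and maxF: "\<forall>X\<in>?F. H \<subseteq> X \<longrightarrow> X = H"
    by (rule bexE)
  have H: "subspace H" "H0 \<subseteq> H" "v \<notin> H" using HF by auto
  have max: "X = H" if "subspace X" "H \<subseteq> X" "v \<notin> X" for X
    using maxF that H(2) by blast
  have Hc: "x \<in> carrier V" if "x \<in> H" for x using H(1) that by (auto simp: subspace_def)
  have Hadd: "x \<oplus> y \<in> H" if "x \<in> H" "y \<in> H" for x y using H(1) that by (auto simp: subspace_def)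
  have Hscale: "pm_scale c \<odot> x \<in> H" if "x \<in> H" for x c using H(1) that by (auto simp: subspace_def)
  have H_zero: "\<zero> \<in> H" using H(1) by (auto simp: subspace_def)
  have neg: "\<ominus> x = pm_scale (-1) \<odot> x" if "x \<in> carrier V" for x
  proof -
    have "pm_scale (-1) = (\<lambda>f :: ('i, 'k) mpol. - f)" by (simp add: fun_eq_iff pm_scale_minus)
    then show ?thesis using act_minus_left[of "\<lambda>f. f" x] that by simp
  qed
  have scale_add: "pm_scale (c + d) \<odot> x = pm_scale c \<odot> x \<oplus> pm_scale d \<odot> x" if "x \<in> carrier V" for c d x
  proof -
    have "pm_scale (c + d) = (\<lambda>f :: ('i, 'k) mpol. pm_scale c f + pm_scale d f)" by (simp add: fun_eq_iff)
    then show ?thesis using act_add[of "pm_scale c" "pm_scale d" x] that by simp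
  qed
  have unique: "c = c'" if "h \<in> H" "h' \<in> H" "h \<oplus> pm_scale c \<odot> v = h' \<oplus> pm_scale c' \<odot> v" for h h' c c'
  proof (rule ccontr)
    assume "c \<noteq> c'"
    have hc: "h \<in> carrier V" "h' \<in> carrier V" using that Hc by auto
    have "pm_scale (c - c') \<odot> v = pm_scale c \<odot> v \<oplus> pm_scale (- c') \<odot> v"
      using scale_add[OF assms(2), of c "- c'"] by simp
    also have "pm_scale (- c') \<odot> v = \<ominus> (pm_scale c' \<odot> v)"
      using assms(2) by (simp add: neg)
    also have "pm_scale c \<odot> v = \<ominus> h \<oplus> (h' \<oplus> pm_scale c' \<odot> v)"
      using assms(2) hc by (simp add: that(3)[symmetric] M.r_neg1)
    also have "\<ominus> h \<oplus> (h' \<oplus> pm_scale c' \<odot> v) \<oplus> \<ominus> (pm_scale c' \<odot> v) = \<ominus> h \<oplus> h'"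
      using assms(2) hc by (simp add: M.a_assoc M.r_neg)
    finally have "pm_scale (c - c') \<odot> v = \<ominus> h \<oplus> h'" .
    also have "\<ominus> h \<oplus> h' \<in> H"
      unfolding neg[OF hc(1)] by (intro Hadd Hscale that(1,2))
    finally have "pm_scale (c - c') \<odot> v \<in> H" .
    from Hscale[OF this, of "1 / (c - c')"] have "v \<in> H"
      using \<open>c \<noteq> c'\<close> assms(2) by simp
    then show False using H(3) by simp
  qed
  have exist: "\<exists>c. \<exists>h\<in>H. x = h \<oplus> pm_scale c \<odot> v" if x: "x \<in> carrier V" for x
  proof (cases "x \<in> H")
    case True
    then show ?thesis using x assms(2) by (intro exI[of _ 0] bexI[of _ x]) auto
  next
    case False
    \<comment> \<open>By maximality \<open>H\<close> together with \<open>x\<close> spans a subspace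
      containing \<open>v\<close>, and the resulting equation is solved for
      \<open>x\<close>.\<close>
    define X where "X = {h \<oplus> pm_scale d \<odot> x |h d. h \<in> H}"
    have "subspace X"
      unfolding subspace_def
    proof (intro conjI ballI allI)
      show "X \<subseteq> carrier V" using Hc x by (auto simp: X_def)
      show "\<zero> \<in> X" unfolding X_def using H_zero x by (auto intro!: exI[of _ \<zero>] exI[of _ 0])
    next
      fix a b assume "a \<in> X" "b \<in> X"
      then obtain h d h' d' where hd: "h \<in> H" "h' \<in> H" "a = h \<oplus> pm_scale d \<odot> x" "b = h' \<oplus> pm_scale d' \<odot> x"
        unfolding X_def by blast
      have "a \<oplus> b = (h \<oplus> h') \<oplus> pm_scale (d + d') \<odot> x"
        using hd(1,2) Hc x unfolding hd(3,4) by (simp add: scale_add M.a_ac)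
      then show "a \<oplus> b \<in> X" using Hadd[OF hd(1,2)] unfolding X_def by blast
    next
      fix c a assume "a \<in> X"
      then obtain h d where hd: "h \<in> H" "a = h \<oplus> pm_scale d \<odot> x" unfolding X_def by blast
      have "pm_scale c \<odot> a = pm_scale c \<odot> h \<oplus> pm_scale (c * d) \<odot> x"
        using hd(1) Hc x unfolding hd(2) by (simp add: smult_r_distr)
      then show "pm_scale c \<odot> a \<in> X" using Hscale[OF hd(1)] unfolding X_def by blast
    qed
    moreover have "H \<subseteq> X"
    proof
      fix h assume h: "h \<in> H"
      then have "h = h \<oplus> pm_scale 0 \<odot> x" using Hc x by simp
      then show "h \<in> X" using h unfolding X_def by blast
    qed
    moreover have "x \<in> X"
      unfolding X_def using x H_zero by (auto intro!: exI[of _ \<zero>] exI[of _ 1])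
    ultimately have "v \<in> X" using max False by blast
    then obtain h d where hd: "h \<in> H" "v = h \<oplus> pm_scale d \<odot> x" unfolding X_def by blast
    have "d \<noteq> 0" using hd H(3) Hc x by auto
    let ?h = "pm_scale (- (1 / d)) \<odot> h"
    have hc: "h \<in> carrier V" using hd(1) Hc by simp
    have "pm_scale (1 / d) \<odot> v = pm_scale (1 / d) \<odot> h \<oplus> x"
      using hc x \<open>d \<noteq> 0\<close> unfolding hd(2) by (simp add: smult_r_distr)
    moreover have "?h = \<ominus> (pm_scale (1 / d) \<odot> h)" using hc by (simp add: neg)
    ultimately have "x = ?h \<oplus> pm_scale (1 / d) \<odot> v"
      using hc x by (simp add: M.r_neg1)
    then show ?thesis using Hscale[OF hd(1)] by blast
  qed
  define \<nu> where "\<nu> x = (THE c. \<exists>h\<in>H. x = h \<oplus> pm_scale c \<odot> v)" for x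
  have \<nu>_eq: "\<nu> (h \<oplus> pm_scale c \<odot> v) = c" if "h \<in> H" for h c
    unfolding \<nu>_def using that unique by (intro the_equality) blast+
  show ?thesis
  proof (rule that)
    fix x y assume "x \<in> carrier V" "y \<in> carrier V"
    then obtain c h d k where hk: "h \<in> H" "x = h \<oplus> pm_scale c \<odot> v" "k \<in> H" "y = k \<oplus> pm_scale d \<odot> v"
      using exist by meson
    have "x \<oplus> y = (h \<oplus> k) \<oplus> pm_scale (c + d) \<odot> v"
      using hk(1,3) Hc assms(2) unfolding hk(2,4) by (simp add: scale_add M.a_ac)
    then show "\<nu> (x \<oplus> y) = \<nu> x + \<nu> y"
      using \<nu>_eq[OF Hadd[OF hk(1,3)], of "c + d"] \<nu>_eq[OF hk(1), of c] \<nu>_eq[OF hk(3), of d] hk by simp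
  next
    fix c x assume "x \<in> carrier V"
    then obtain d h where hd: "h \<in> H" "x = h \<oplus> pm_scale d \<odot> v" using exist by blast
    have "pm_scale c \<odot> x = pm_scale c \<odot> h \<oplus> pm_scale (c * d) \<odot> v"
      using hd(1) Hc assms(2) unfolding hd(2) by (simp add: smult_r_distr)
    then show "\<nu> (pm_scale c \<odot> x) = c * \<nu> x"
      using \<nu>_eq[OF Hscale[OF hd(1)], of c "c * d"] \<nu>_eq[OF hd(1), of d] hd by simp
  next
    fix x assume "x \<in> H0"
    then have "x \<in> H" using H(2) by blast
    then show "\<nu> x = 0" using \<nu>_eq[of x 0] Hc[of x] assms(2) by simp
  next
    show "\<nu> v = 1" using \<nu>_eq[OF H_zero, of 1] assms(2) by simp
  qed
qed

text \<open>Passing to the weight space at \<open>q\<close> preserves injections, and functionals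
  extend along injections of vector spaces. Concretely, a vector \<open>f u0\<close> with
  \<open>\<mu> u0 = 1\<close> is separated from the image of the kernel of \<open>\<mu>\<close>
  together with all other weight spaces.\<close>

lemma functional_extension:
  fixes U :: "(('i, 'k::field_char_0) mpol_op, 'u) module" and V :: "(('i, 'k) mpol_op, 'v) module"
  assumes "weight_functional U q \<mu>" "weight_module V" "f \<in> left_module_hom weyl U V" "inj_on f (carrier U)"
  obtains \<nu> where "weight_functional V q \<nu>" "\<And>u. u \<in> carrier U \<Longrightarrow> \<nu> (f u) = \<mu> u"
proof -
  interpret U: weight_functional U q \<mu> by fact
  interpret V: weyl_module V by (rule weight_moduleD(1)[OF assms(2)])
  note fE = left_module_hom_simps[OF assms(3)]
  show ?thesis
  proof (cases "\<forall>u\<in>carrier U. \<mu> u = 0")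
    case True
    have "weight_functional V q (\<lambda>_. 0)"
      by unfold_locales (auto simp: weight_moduleD(2)[OF assms(2)])
    then show ?thesis using True that by simp
  next
    case False
    have "\<exists>y r. y \<in> weight_space U r \<and> \<mu> y \<noteq> 0"
    proof (rule ccontr)
      assume *: "\<not> ?thesis"
      have "\<mu> x = 0" if "x \<in> weight_sums U" for x
        using that
      proof induction
        case (step y r x)
        then show ?case
          using * U.add[of y x] U.weight_space_closed U.weight_sums_closed by auto
      qed (rule U.functional_zero)
      then show False using False U.sums by blast
    qed
    then obtain y r where yr: "y \<in> weight_space U r" "\<mu> y \<noteq> 0" by blast
    then have "r = q" using U.off by blast
    define u0 where "u0 = pm_scale (1 / \<mu> y) \<odot>\<^bsub>U\<^esub> y"
    have u0: "u0 \<in> weight_space U q" "u0 \<in> carrier U" "\<mu> u0 = 1"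
      using yr \<open>r = q\<close> U.weight_space_closed[OF yr(1)] U.weight_space_scale[OF yr(1)]
      by (auto simp: u0_def U.scale)
    let ?K = "f ` {u \<in> carrier U. \<mu> u = 0}"
    let ?H = "ext_kernel V ?K q"
    have H_closed: "x \<in> carrier V" if "x \<in> ?H" for x
      using that by induction (auto simp: fE V.weight_space_closed)
    have H_add: "x \<oplus>\<^bsub>V\<^esub> x' \<in> ?H" if "x \<in> ?H" "x' \<in> ?H" for x x'
      using that(1)
    proof induction
      case zero
      then show ?case using that(2) H_closed by simp
    next
      case (ker z x)
      then have "z \<in> carrier V" by (auto simp: fE)
      then show ?case
        using ext_kernel.ker[OF ker.hyps(1) ker.IH] H_closed[OF ker.hyps(2)] H_closed[OF that(2)] V.M.a_assoc by simp
    next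
      case (off w r x)
      then show ?case
        using ext_kernel.off[OF off.hyps(1,2) off.IH] V.weight_space_closed[OF off.hyps(1)]
          H_closed[OF off.hyps(3)] H_closed[OF that(2)] V.M.a_assoc by simp
    qed
    have H_scale: "pm_scale c \<odot>\<^bsub>V\<^esub> x \<in> ?H" if "x \<in> ?H" for c x
      using that
    proof induction
      case zero
      then show ?case using ext_kernel.zero[of V] by simp
    next
      case (ker z x)
      then obtain u where u: "u \<in> carrier U" "\<mu> u = 0" "z = f u" by blast
      have "pm_scale c \<odot>\<^bsub>V\<^esub> z = f (pm_scale c \<odot>\<^bsub>U\<^esub> u)" using u by (simp add: fE)
      then have "pm_scale c \<odot>\<^bsub>V\<^esub> z \<in> ?K" using u by (auto simp: U.scale)
      from ext_kernel.ker[OF this ker.IH] show ?case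
        using u H_closed[OF ker.hyps(2)] by (simp add: V.smult_r_distr fE)
    next
      case (off w r x)
      from ext_kernel.off[OF V.weight_space_scale[OF off.hyps(1)] off.hyps(2) off.IH] show ?case
        using H_closed[OF off.hyps(3)] V.weight_space_closed[OF off.hyps(1)] by (simp add: V.smult_r_distr)
    qed
    have sub: "V.subspace ?H"
      using H_closed H_add H_scale ext_kernel.zero[of V] by (auto simp: V.subspace_def)
    have notin: "f u0 \<notin> ?H"
    proof
      assume "f u0 \<in> ?H"
      \<comment> \<open>Suitable projectors carry each element of \<open>?H\<close> into
        \<open>?K\<close>. Applied to \<open>f u0\<close>, which has weight \<open>q\<close> and is
        fixed, this puts \<open>f u0\<close> into \<open>?K\<close>, contrary to injectivity of
        \<open>f\<close>.\<close>
      have "\<exists>M. finite M \<and> q \<notin> M \<and> (\<forall>\<pi> \<chi>. projector \<pi> \<chi> \<longrightarrow> \<chi> q = 1 \<longrightarrow> (\<forall>m\<in>M. \<chi> m = 0) \<longrightarrow> \<pi> \<odot>\<^bsub>V\<^esub> x \<in> ?K)"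
        if "x \<in> ?H" for x
        using that
      proof induction
        case zero
        have "f \<zero>\<^bsub>U\<^esub> = \<zero>\<^bsub>V\<^esub>"
          by (rule hom_zero[OF U.weyl_module_axioms V.weyl_module_axioms assms(3)])
        then have "\<zero>\<^bsub>V\<^esub> \<in> ?K" using U.functional_zero by (intro image_eqI[of _ _ "\<zero>\<^bsub>U\<^esub>"]) auto
        then show ?case
          by (intro exI[of _ "{}"]) (auto simp: V.projector_closed)
      next
        case (ker z x)
        then obtain M u where M: "finite M" "q \<notin> M" "u \<in> carrier U" "\<mu> u = 0" "z = f u"
          "\<And>\<pi> \<chi>. projector \<pi> \<chi> \<Longrightarrow> \<chi> q = 1 \<Longrightarrow> (\<forall>m\<in>M. \<chi> m = 0) \<Longrightarrow> \<pi> \<odot>\<^bsub>V\<^esub> x \<in> ?K"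
          by blast
        have "\<pi> \<odot>\<^bsub>V\<^esub> (z \<oplus>\<^bsub>V\<^esub> x) \<in> ?K" if \<pi>: "projector \<pi> \<chi>" "\<chi> q = 1" "\<forall>m\<in>M. \<chi> m = 0" for \<pi> \<chi>
        proof -
          note \<pi>c = V.projector_closed[OF \<pi>(1)]
          obtain u' where u': "u' \<in> carrier U" "\<mu> u' = 0" "\<pi> \<odot>\<^bsub>V\<^esub> x = f u'"
            using M(6)[OF \<pi>] by blast
          have "\<pi> \<odot>\<^bsub>V\<^esub> (z \<oplus>\<^bsub>V\<^esub> x) = f (\<pi> \<odot>\<^bsub>U\<^esub> u \<oplus>\<^bsub>U\<^esub> u')"
            using \<pi>c M(3) u' H_closed[OF ker.hyps(2)] by (simp add: M(5) V.smult_r_distr fE)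
          then show ?thesis
            using \<pi>c M(3,4) u' U.functional_projector[OF \<pi>(1,2) M(3)]
            by (intro image_eqI[of _ _ "\<pi> \<odot>\<^bsub>U\<^esub> u \<oplus>\<^bsub>U\<^esub> u'"]) (auto simp: U.add)
        qed
        then show ?case using M(1,2) by blast
      next
        case (off w r x)
        then obtain M where M: "finite M" "q \<notin> M"
          "\<And>\<pi> \<chi>. projector \<pi> \<chi> \<Longrightarrow> \<chi> q = 1 \<Longrightarrow> (\<forall>m\<in>M. \<chi> m = 0) \<Longrightarrow> \<pi> \<odot>\<^bsub>V\<^esub> x \<in> ?K"
          by blast
        have "\<pi> \<odot>\<^bsub>V\<^esub> (w \<oplus>\<^bsub>V\<^esub> x) \<in> ?K" if \<pi>: "projector \<pi> \<chi>" "\<chi> q = 1" "\<forall>m\<in>insert r M. \<chi> m = 0" for \<pi> \<chi>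
        proof -
          note \<pi>c = V.projector_closed[OF \<pi>(1)]
          have "\<pi> \<odot>\<^bsub>V\<^esub> w = \<zero>\<^bsub>V\<^esub>" by (rule V.projector_zero[OF \<pi>(1) off.hyps(1)]) (use \<pi>(3) in simp)
          moreover have "w \<in> carrier V" "x \<in> carrier V"
            using V.weight_space_closed[OF off.hyps(1)] H_closed[OF off.hyps(3)] by auto
          ultimately have "\<pi> \<odot>\<^bsub>V\<^esub> (w \<oplus>\<^bsub>V\<^esub> x) = \<pi> \<odot>\<^bsub>V\<^esub> x"
            using \<pi>c by (simp add: V.smult_r_distr)
          then show ?thesis using M(3)[OF \<pi>(1,2)] \<pi>(3) by simp
        qed
        then show ?case using M(1,2) off.hyps(2) by (intro exI[of _ "insert r M"]) auto
      qed
      from this[OF \<open>f u0 \<in> ?H\<close>] obtain M where fin: "finite M" "q \<notin> M" and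
        M: "\<And>\<pi> \<chi>. projector \<pi> \<chi> \<Longrightarrow> \<chi> q = 1 \<Longrightarrow> (\<forall>m\<in>M. \<chi> m = 0) \<Longrightarrow> \<pi> \<odot>\<^bsub>V\<^esub> f u0 \<in> ?K"
        by blast
      obtain \<pi> \<chi> where \<pi>: "projector \<pi> \<chi>" "\<chi> q = 1" "\<And>m. m \<in> M \<Longrightarrow> \<chi> m = 0"
        by (rule projector_ex[OF fin]) (rule that)
      have "\<pi> \<odot>\<^bsub>V\<^esub> f u0 \<in> ?K" by (rule M[OF \<pi>(1,2)]) (use \<pi>(3) in blast)
      moreover have "\<pi> \<odot>\<^bsub>V\<^esub> f u0 = f u0"
        by (rule V.projector_one[OF \<pi>(1) hom_weight_space[OF assms(3) u0(1)] \<pi>(2)])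
      ultimately have "f u0 \<in> ?K" by simp
      then obtain u where u: "u \<in> carrier U" "\<mu> u = 0" "f u0 = f u" by blast
      have "u0 = u" by (rule inj_onD[OF assms(4) u(3) u0(2) u(1)])
      then show False using u(2) u0(3) by simp
    qed
    obtain \<nu> where \<nu>: "\<And>x y. x \<in> carrier V \<Longrightarrow> y \<in> carrier V \<Longrightarrow> \<nu> (x \<oplus>\<^bsub>V\<^esub> y) = \<nu> x + \<nu> y"
      "\<And>c x. x \<in> carrier V \<Longrightarrow> \<nu> (pm_scale c \<odot>\<^bsub>V\<^esub> x) = c * \<nu> x"
      "\<And>x. x \<in> ?H \<Longrightarrow> \<nu> x = 0" "\<nu> (f u0) = 1"
      by (rule V.subspace_separation[OF sub fE(1)[OF u0(2)] notin]) (rule that)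
    have off: "\<nu> w = 0" if "w \<in> weight_space V r" "r \<noteq> q" for w r
      using \<nu>(3)[OF ext_kernel.off[OF that ext_kernel.zero]] V.weight_space_closed[OF that(1)] by simp
    have "weight_functional V q \<nu>"
      by unfold_locales (auto simp: weight_moduleD(2)[OF assms(2)] \<nu> off)
    moreover have "\<nu> (f u) = \<mu> u" if u: "u \<in> carrier U" for u
    proof -
      \<comment> \<open>Subtracting \<open>\<mu> u\<close> times \<open>u0\<close> puts
        \<open>u\<close> into the kernel of \<open>\<mu>\<close>, on whose image
        \<open>\<nu>\<close> vanishes; at \<open>u0\<close> both functionals have the value
        1.\<close>
      let ?d = "u \<oplus>\<^bsub>U\<^esub> pm_scale (- \<mu> u) \<odot>\<^bsub>U\<^esub> u0"
      have d: "?d \<in> carrier U" "\<mu> ?d = 0" using u u0(2,3) by (auto simp: U.add U.scale)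
      then have "f ?d \<in> ?K" by blast
      from ext_kernel.ker[OF this ext_kernel.zero[of V _ q]] have "f ?d \<in> ?H" using fE(1)[OF d(1)] by simp
      then have "\<nu> (f ?d) = 0" by (rule \<nu>(3))
      moreover have "f ?d = f u \<oplus>\<^bsub>V\<^esub> pm_scale (- \<mu> u) \<odot>\<^bsub>V\<^esub> f u0"
        using u u0(2) by (simp add: fE)
      ultimately show ?thesis using u u0(2) by (simp add: \<nu> fE)
    qed
    ultimately show ?thesis by (rule that)
  qed
qed

section \<open>Modules with one-dimensional weight spaces\<close>

text \<open>By \<open>reach\<close>, an element \<open>x\<close> is determined by the functional
  \<open>a \<mapsto> lam (a x)\<close> on \<open>A\<close>; homomorphisms into \<open>E\<close> are
  built by prescribing these functionals.\<close>

locale weyl_line = weight_functional E q lam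
  for E :: "(('i, 'k::field_char_0) mpol_op, 'm) module" (structure) and q lam +
  fixes b :: "('i \<Rightarrow> 'k) \<Rightarrow> 'm"
  assumes b_weight: "m \<in> pcoset q \<Longrightarrow> b m \<in> weight_space E m"
    and b_span: "x \<in> weight_space E m \<Longrightarrow> x \<noteq> \<zero> \<Longrightarrow> m \<in> pcoset q \<and> (\<exists>c. x = pm_scale c \<odot> b m)"
    and reach: "m \<in> pcoset q \<Longrightarrow> \<exists>a\<in>carrier weyl. lam (a \<odot> b m) \<noteq> 0"
begin

lemma b_closed: "m \<in> pcoset q \<Longrightarrow> b m \<in> carrier E"
  by (rule weight_space_closed[OF b_weight])

lemma q_in_pcoset: "q \<in> pcoset q"
  by (simp add: pcoset_iff Zf_0)

lemma lam_mon:
  assumes "x \<in> weight_space E m" "lam (wmon \<alpha> \<beta> \<odot> x) \<noteq> 0"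
  shows "wt \<alpha> \<beta> = (\<lambda>i. q i - m i)"
proof -
  have "(\<lambda>i. m i + wt \<alpha> \<beta> i) = q"
    using off[OF mon_weight_space[OF assms(1)]] assms(2) by blast
  then have "m i + wt \<alpha> \<beta> i = q i" for i by (rule fun_cong)
  then show ?thesis by (auto simp: eq_diff_eq add.commute)
qed

lemma reach_mon:
  assumes "m \<in> pcoset q"
  obtains \<alpha> \<beta> where "lam (wmon \<alpha> \<beta> \<odot> b m) \<noteq> 0" "wt \<alpha> \<beta> = (\<lambda>i. q i - m i)"
proof -
  have "\<exists>\<alpha> \<beta>. lam (wmon \<alpha> \<beta> \<odot> b m) \<noteq> 0"
  proof (rule ccontr)
    assume *: "\<not> ?thesis"
    have "lam (a \<odot> b m) = 0" if "a \<in> carrier weyl" for a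
      using that
    proof (induction rule: weyl_mon_induct)
      case zero
      then show ?case using b_closed[OF assms] by (simp add: functional_zero)
    next
      case (step c \<alpha> \<beta> a)
      have "(\<lambda>f. pm_scale c (wmon \<alpha> \<beta> f) + a f) \<odot> b m = pm_scale c \<odot> (wmon \<alpha> \<beta> \<odot> b m) \<oplus> a \<odot> b m"
        unfolding act_add[OF weyl_pm_scale[OF wmon_closed] step.hyps b_closed[OF assms]]
          act_scale[OF wmon_closed b_closed[OF assms]] ..
      then show ?case
        using step * b_closed[OF assms] by (simp add: add scale)
    qed
    then show False using reach[OF assms] by blast
  qed
  then show ?thesis using lam_mon[OF b_weight[OF assms]] that by blast
qed

text \<open>A nonzero component of \<open>x\<close> is isolated by a projector; it is a multiple of
  some \<open>b m\<close>, which \<open>reach\<close> moves to where \<open>lam\<close> is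
  nonzero.\<close>

lemma lam_eq_0I:
  assumes x: "x \<in> carrier E" and zero: "\<And>a. a \<in> carrier weyl \<Longrightarrow> lam (a \<odot> x) = 0"
  shows "x = \<zero>"
proof -
  have "weight_module E" by (rule weight_moduleI[OF sums])
  then obtain v where v: "\<And>m. v m \<in> weight_space E m" "finite {m. v m \<noteq> \<zero>}" "x = finsum E v {m. v m \<noteq> \<zero>}"
    using x unfolding weight_module_def by blast
  have "v m = \<zero>" for m
  proof (rule ccontr)
    assume nz: "v m \<noteq> \<zero>"
    let ?S = "{m. v m \<noteq> \<zero>}"
    obtain \<pi> \<chi> where \<pi>: "projector \<pi> \<chi>" "\<chi> m = 1" "\<And>r. r \<in> ?S - {m} \<Longrightarrow> \<chi> r = 0"
      by (rule projector_ex[of "?S - {m}" m]) (use v(2) in auto)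
    have \<pi>x: "\<pi> \<odot> x = v m"
      unfolding v(3) using projector_finsum[OF \<pi>(1,2) v(2,1) \<pi>(3)] nz by simp
    obtain c where c: "m \<in> pcoset q" "v m = pm_scale c \<odot> b m" using b_span[OF v(1) nz] by blast
    have "c \<noteq> 0" using c nz b_closed by auto
    obtain a where a: "a \<in> carrier weyl" "lam (a \<odot> b m) \<noteq> 0" using reach[OF c(1)] by blast
    note \<pi>c = projector_closed[OF \<pi>(1)]
    have "(\<lambda>f. a (\<pi> f)) \<odot> x = pm_scale c \<odot> (a \<odot> b m)"
      unfolding act_mult[OF a(1) \<pi>c x] \<pi>x c(2) by (rule act_scale_comm[OF a(1) b_closed[OF c(1)]])
    then have "c * lam (a \<odot> b m) = 0"
      using zero[OF weyl_closed(6)[OF a(1) \<pi>c]] scale a(1) b_closed[OF c(1)] by simp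
    then show False using \<open>c \<noteq> 0\<close> a(2) by simp
  qed
  then show ?thesis using v(3) by simp
qed

lemma lam_eqI:
  assumes "x \<in> carrier E" "y \<in> carrier E" "\<And>a. a \<in> carrier weyl \<Longrightarrow> lam (a \<odot> x) = lam (a \<odot> y)"
  shows "x = y"
proof (rule eq_if_diff_zero[OF assms(1,2) lam_eq_0I])
  show "x \<ominus> y \<in> carrier E" using assms by simp
  fix a :: "('i, 'k) mpol_op" assume a: "a \<in> carrier weyl"
  then have "a \<odot> (x \<ominus> y) = a \<odot> x \<oplus> \<ominus> (a \<odot> y)"
    using assms(1,2) by (simp add: a_minus_def smult_r_distr act_minus_right)
  then show "lam (a \<odot> (x \<ominus> y)) = 0"
    using a assms by (simp add: add functional_minus)
qed

text \<open>By additivity \<open>y\<close> may be taken of some weight \<open>m\<close>. Both sides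
  then see only monomials of weight \<open>q - m\<close>, and on vectors of weight \<open>m\<close>
  these act as multiples of the single element \<open>wunit (q - m)\<close>. So only one value has
  to be matched.\<close>

lemma represents:
  assumes V: "weight_functional V q \<nu>" and y: "y \<in> carrier V"
  shows "\<exists>x\<in>carrier E. \<forall>a\<in>carrier weyl. lam (a \<odot> x) = \<nu> (a \<odot>\<^bsub>V\<^esub> y)"
proof -
  interpret V: weight_functional V q \<nu> by fact
  have weight: "\<exists>x\<in>carrier E. \<forall>a\<in>carrier weyl. lam (a \<odot> x) = \<nu> (a \<odot>\<^bsub>V\<^esub> y)"
    if y: "y \<in> weight_space V m" for y m
  proof -
    have yc: "y \<in> carrier V" using y by (rule V.weight_space_closed)
    have red: "\<forall>a\<in>carrier weyl. lam (a \<odot> x) = \<nu> (a \<odot>\<^bsub>V\<^esub> y)"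
      if x: "x \<in> carrier E" and mon: "\<And>\<alpha> \<beta>. lam (wmon \<alpha> \<beta> \<odot> x) = \<nu> (wmon \<alpha> \<beta> \<odot>\<^bsub>V\<^esub> y)" for x
    proof
      fix a :: "('i, 'k) mpol_op" assume "a \<in> carrier weyl"
      then show "lam (a \<odot> x) = \<nu> (a \<odot>\<^bsub>V\<^esub> y)"
      proof (induction rule: weyl_mon_induct)
        case zero
        then show ?case using x yc by (simp add: functional_zero V.functional_zero)
      next
        case (step c \<alpha> \<beta> a)
        show ?case
          unfolding act_add[OF weyl_pm_scale[OF wmon_closed] step.hyps x] act_scale[OF wmon_closed x]
            V.act_add[OF weyl_pm_scale[OF wmon_closed] step.hyps yc] V.act_scale[OF wmon_closed yc]
          using x yc step mon[of \<alpha> \<beta>] by (simp add: add scale V.add V.scale)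
      qed
    qed
    have nu_mon: "\<nu> (wmon \<alpha> \<beta> \<odot>\<^bsub>V\<^esub> y) = 0" if "wt \<alpha> \<beta> \<noteq> (\<lambda>i. q i - m i)" for \<alpha> \<beta>
    proof (rule V.off[OF V.mon_weight_space[OF y]])
      show "(\<lambda>i. m i + wt \<alpha> \<beta> i) \<noteq> q"
      proof
        assume e: "(\<lambda>i. m i + wt \<alpha> \<beta> i) = q"
        have "wt \<alpha> \<beta> i = q i - m i" for i
          using fun_cong[OF e, of i] by (simp add: eq_diff_eq add.commute)
        then show False using that by blast
      qed
    qed
    show ?thesis
    proof (cases "m \<in> pcoset q")
      case True
      note bc = b_closed[OF True]
      let ?u = "wunit (\<lambda>i. q i - m i)"
      have "(\<lambda>i. q i - m i) \<in> Zf" using Zf_minus True by (fastforce simp: pcoset_iff)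
      note uc = wunit_closed[OF this]
      have red_u: "\<exists>c. wmon \<alpha> \<beta> \<odot> b m = pm_scale c \<odot> (?u \<odot> b m) \<and>
          wmon \<alpha> \<beta> \<odot>\<^bsub>V\<^esub> y = pm_scale c \<odot>\<^bsub>V\<^esub> (?u \<odot>\<^bsub>V\<^esub> y)"
        if wt: "wt \<alpha> \<beta> = (\<lambda>i. q i - m i)" for \<alpha> \<beta>
      proof -
        obtain c where c: "weq m (wmon \<alpha> \<beta>) (\<lambda>f. pm_scale c (?u f))"
          using mon_weq[of m \<alpha> \<beta>] unfolding wt by blast
        show ?thesis
          using weq_act[OF c wmon_closed weyl_pm_scale[OF uc] b_weight[OF True]] act_scale[OF uc bc, of c]
            V.weq_act[OF c wmon_closed weyl_pm_scale[OF uc] y] V.act_scale[OF uc yc, of c] by auto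
      qed
      have lu: "lam (?u \<odot> b m) \<noteq> 0"
      proof -
        obtain \<alpha> \<beta> where "lam (wmon \<alpha> \<beta> \<odot> b m) \<noteq> 0" "wt \<alpha> \<beta> = (\<lambda>i. q i - m i)"
          using reach_mon[OF True] .
        with red_u[of \<alpha> \<beta>] show ?thesis using uc bc by (auto simp: scale)
      qed
      \<comment> \<open>Rescaling \<open>b m\<close> matches the value at \<open>?u\<close>; the
        denominator is nonzero by \<open>lu\<close>.\<close>
      define d where "d = \<nu> (?u \<odot>\<^bsub>V\<^esub> y) / lam (?u \<odot> b m)"
      have "lam (wmon \<alpha> \<beta> \<odot> (pm_scale d \<odot> b m)) = \<nu> (wmon \<alpha> \<beta> \<odot>\<^bsub>V\<^esub> y)" for \<alpha> \<beta>
      proof -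
        have 1: "lam (wmon \<alpha> \<beta> \<odot> (pm_scale d \<odot> b m)) = d * lam (wmon \<alpha> \<beta> \<odot> b m)"
          using bc scale by (simp add: act_scale_comm[OF wmon_closed bc])
        show ?thesis
        proof (cases "wt \<alpha> \<beta> = (\<lambda>i. q i - m i)")
          case wt: True
          obtain c where "wmon \<alpha> \<beta> \<odot> b m = pm_scale c \<odot> (?u \<odot> b m)"
              "wmon \<alpha> \<beta> \<odot>\<^bsub>V\<^esub> y = pm_scale c \<odot>\<^bsub>V\<^esub> (?u \<odot>\<^bsub>V\<^esub> y)"
            using red_u[OF wt] by blast
          then show ?thesis
            unfolding 1 using uc bc yc lu scale V.scale by (simp add: d_def)
        next
          case False
          then have "lam (wmon \<alpha> \<beta> \<odot> b m) = 0" using lam_mon[OF b_weight[OF True]] by blast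
          then show ?thesis unfolding 1 using nu_mon[OF False] by simp
        qed
      qed
      from red[OF _ this] show ?thesis using bc by auto
    next
      case False
      \<comment> \<open>Outside the coset no monomial shifts \<open>m\<close> to \<open>q\<close>,
        so both sides vanish and 0 represents \<open>y\<close>.\<close>
      have "wt \<alpha> \<beta> \<noteq> (\<lambda>i. q i - m i)" for \<alpha> \<beta>
      proof
        assume wt: "wt \<alpha> \<beta> = (\<lambda>i. q i - m i)"
        have "(\<lambda>i. - wt \<alpha> \<beta> i) \<in> (Zf :: ('i \<Rightarrow> 'k) set)" by (rule Zf_minus[OF Zf_wt])
        then show False using False by (simp add: wt pcoset_iff)
      qed
      with red[of \<zero>] nu_mon have "\<forall>a\<in>carrier weyl. lam (a \<odot> \<zero>) = \<nu> (a \<odot>\<^bsub>V\<^esub> y)"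
        by (simp add: functional_zero)
      then show ?thesis by blast
    qed
  qed
  show ?thesis
    using V.sums[OF y]
  proof induction
    case zero
    then show ?case
      by (intro bexI[of _ \<zero>]) (auto simp: functional_zero V.functional_zero)
  next
    case (step y r z)
    obtain x where x: "x \<in> carrier E" "\<forall>a\<in>carrier weyl. lam (a \<odot> x) = \<nu> (a \<odot>\<^bsub>V\<^esub> y)"
      using weight[OF step.hyps(1)] by blast
    obtain x' where x': "x' \<in> carrier E" "\<forall>a\<in>carrier weyl. lam (a \<odot> x') = \<nu> (a \<odot>\<^bsub>V\<^esub> z)"
      using step.IH by blast
    show ?case
      using x x' V.weight_space_closed[OF step.hyps(1)] V.weight_sums_closed[OF step.hyps(2)]
      by (intro bexI[of _ "x \<oplus> x'"]) (auto simp: smult_r_distr V.smult_r_distr add V.add)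
  qed
qed

theorem injective: "injective_in_W TYPE('u) TYPE('v) E"
  unfolding injective_in_W_def
proof (intro conjI allI impI ballI)
  show "weight_module E" by (rule weight_moduleI[OF sums])
  fix U :: "(('i, 'k) mpol_op, 'u) module" and V :: "(('i, 'k) mpol_op, 'v) module" and f g
  assume UV: "weight_module U \<and> weight_module V"
    and f: "f \<in> left_module_hom weyl U V" and g: "g \<in> left_module_hom weyl U E"
    and inj: "inj_on f (carrier U)"
  interpret U: weyl_module U using weight_moduleD(1) UV by blast
  note gE = left_module_hom_simps[OF g]
  have "weight_functional U q (\<lambda>u. lam (g u))"
    by unfold_locales
      (use UV in \<open>auto simp: weight_moduleD(2) gE add scale off[OF hom_weight_space[OF g]]\<close>)
  then obtain \<nu> where \<nu>: "weight_functional V q \<nu>" "\<And>u. u \<in> carrier U \<Longrightarrow> \<nu> (f u) = lam (g u)"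
    using functional_extension[OF _ conjunct2[OF UV] f inj] by metis
  interpret V: weight_functional V q \<nu> by (rule \<nu>(1))
  note fE = left_module_hom_simps[OF f]
  \<comment> \<open>Such an element is unique, and from uniqueness, as \<open>h_eqI\<close>, follow
    additivity, compatibility with \<open>A\<close> and the extension property.\<close>
  define h where "h y = (SOME x. x \<in> carrier E \<and> (\<forall>a\<in>carrier weyl. lam (a \<odot> x) = \<nu> (a \<odot>\<^bsub>V\<^esub> y)))" for y
  have "h y \<in> carrier E \<and> (\<forall>a\<in>carrier weyl. lam (a \<odot> h y) = \<nu> (a \<odot>\<^bsub>V\<^esub> y))" if "y \<in> carrier V" for y
    unfolding h_def by (rule someI_ex) (use represents[OF \<nu>(1) that] in blast)
  then have hc: "h y \<in> carrier E" and h: "a \<in> carrier weyl \<Longrightarrow> lam (a \<odot> h y) = \<nu> (a \<odot>\<^bsub>V\<^esub> y)"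
    if "y \<in> carrier V" for y a using that by auto
  have h_eqI: "h y = x" if "x \<in> carrier E" "y \<in> carrier V" "\<And>a. a \<in> carrier weyl \<Longrightarrow> lam (a \<odot> x) = \<nu> (a \<odot>\<^bsub>V\<^esub> y)" for x y
    using that by (intro lam_eqI) (auto simp: hc h)
  have "h \<in> left_module_hom weyl V E"
    unfolding left_module_hom_def
  proof safe
    fix y assume "y \<in> carrier V" then show "h y \<in> carrier E" by (rule hc)
  next
    fix y z assume "y \<in> carrier V" "z \<in> carrier V"
    then show "h (y \<oplus>\<^bsub>V\<^esub> z) = h y \<oplus> h z"
      by (intro h_eqI) (auto simp: hc h smult_r_distr V.smult_r_distr add V.add)
  next
    fix a :: "('i, 'k) mpol_op" and y assume a: "a \<in> carrier weyl" and y: "y \<in> carrier V"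
    show "h (a \<odot>\<^bsub>V\<^esub> y) = a \<odot> h y"
    proof (rule h_eqI)
      fix c :: "('i, 'k) mpol_op" assume c: "c \<in> carrier weyl"
      show "lam (c \<odot> (a \<odot> h y)) = \<nu> (c \<odot>\<^bsub>V\<^esub> (a \<odot>\<^bsub>V\<^esub> y))"
        using h[OF y weyl_closed(6)[OF c a]] act_mult[OF c a hc[OF y]] V.act_mult[OF c a y] by simp
    qed (use a y hc in auto)
  qed
  moreover have "h (f u) = g u" if u: "u \<in> carrier U" for u
  proof (rule h_eqI)
    fix a :: "('i, 'k) mpol_op" assume a: "a \<in> carrier weyl"
    show "lam (a \<odot> g u) = \<nu> (a \<odot>\<^bsub>V\<^esub> f u)"
      using \<nu>(2)[of "a \<odot>\<^bsub>U\<^esub> u"] fE(3)[OF u a] gE(3)[OF u a] a u by simp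
  qed (use u in \<open>auto simp: fE gE\<close>)
  ultimately show "\<exists>h\<in>left_module_hom weyl V E. \<forall>x\<in>carrier U. h (f x) = g x" by blast
qed

text \<open>A monomial of weight 0 maps the line of \<open>b q\<close> to itself, so
  \<open>reach\<close> at \<open>q\<close> is possible only if \<open>lam\<close> is nonzero on that
  line.\<close>

lemma lam_b_q: "lam (b q) \<noteq> 0"
proof -
  obtain \<alpha> \<beta> where l: "lam (wmon \<alpha> \<beta> \<odot> b q) \<noteq> 0" and wt: "wt \<alpha> \<beta> = (\<lambda>i. q i - q i)"
    using reach_mon[OF q_in_pcoset] .
  have "wmon \<alpha> \<beta> \<odot> b q \<in> weight_space E q"
    using mon_weight_space[OF b_weight[OF q_in_pcoset], of \<alpha> \<beta>] by (simp add: wt)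
  moreover have "wmon \<alpha> \<beta> \<odot> b q \<noteq> \<zero>" using l functional_zero by auto
  ultimately obtain c where "wmon \<alpha> \<beta> \<odot> b q = pm_scale c \<odot> b q" using b_span by blast
  then show ?thesis using l scale[OF b_closed[OF q_in_pcoset]] by auto
qed

text \<open>A nonzero element of \<open>N\<close> can be moved to one on which \<open>lam\<close> is
  nonzero; its component of weight \<open>q\<close> is again in \<open>N\<close> and a nonzero
  multiple of \<open>b q\<close>.\<close>

lemma submodule_contains_b_q:
  assumes N: "submodule N weyl E" "N \<noteq> {\<zero>}"
  shows "b q \<in> N"
proof -
  note NE = left_module_submoduleE[OF left_module_V N(1)]
  obtain n where n: "n \<in> N" "n \<noteq> \<zero>" using N(2) NE(2) by blast
  have nc: "n \<in> carrier E" using n(1) NE(1) by blast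
  obtain a where a: "a \<in> carrier weyl" "lam (a \<odot> n) \<noteq> 0" using lam_eq_0I[OF nc] n(2) by blast
  have an: "a \<odot> n \<in> carrier E" using a(1) nc by simp
  obtain \<pi> \<chi> where \<pi>: "projector \<pi> \<chi>" "\<chi> q = 1" "\<pi> \<odot> (a \<odot> n) \<in> weight_space E q"
    using weight_projection_ex[OF sums[OF an]] .
  have l: "lam (\<pi> \<odot> (a \<odot> n)) \<noteq> 0" using functional_projector[OF \<pi>(1,2) an] a(2) by simp
  then have "\<pi> \<odot> (a \<odot> n) \<noteq> \<zero>" using functional_zero by auto
  then obtain c where c: "\<pi> \<odot> (a \<odot> n) = pm_scale c \<odot> b q" using b_span[OF \<pi>(3)] by blast
  note bc = b_closed[OF q_in_pcoset]
  have "c \<noteq> 0" using l bc unfolding c by (auto simp: functional_zero)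
  have "pm_scale c \<odot> b q \<in> N" unfolding c[symmetric] by (intro NE(5) a(1) n(1) projector_closed[OF \<pi>(1)])
  from NE(5)[OF pm_scale_closed[of "1 / c"] this] show ?thesis using \<open>c \<noteq> 0\<close> bc by simp
qed

section \<open>The dual module\<close>

lemma dual_simps [simp]:
  "\<zero>\<^bsub>dual E\<^esub> = (\<lambda>x\<in>carrier E. 0)" "f \<oplus>\<^bsub>dual E\<^esub> g = (\<lambda>x\<in>carrier E. f x + g x)"
  "a \<odot>\<^bsub>dual E\<^esub> f = (\<lambda>x\<in>carrier E. f (diamond a \<odot> x))"
  by (simp_all add: dual_def)

lemma dual_carrier_iff: "f \<in> carrier (dual E) \<longleftrightarrow> f \<in> extensional (carrier E) \<and>
    (\<forall>x\<in>carrier E. \<forall>y\<in>carrier E. f (x \<oplus> y) = f x + f y) \<and>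
    (\<forall>c. \<forall>x\<in>carrier E. f (pm_scale c \<odot> x) = c * f x) \<and>
    finite {r. \<exists>x\<in>weight_space E r. f x \<noteq> 0}"
  by (simp add: dual_def scal_def)

lemma dual_zero_apply:
  assumes "f \<in> carrier (dual E)"
  shows "f \<zero> = 0"
proof -
  have "f (\<zero> \<oplus> \<zero>) = f \<zero> + f \<zero>"
    using assms M.zero_closed unfolding dual_carrier_iff by blast
  then show ?thesis by simp
qed

text \<open>Composing \<open>f\<close> with a monomial shifts its support by minus the weight of the
  monomial, and \<open>a\<close> is a finite combination of monomials.\<close>

lemma dual_support_finite:
  assumes f: "f \<in> carrier (dual E)" and "a \<in> carrier weyl"
  shows "finite {r. \<exists>x\<in>weight_space E r. f (a \<odot> x) \<noteq> 0}"
  using assms(2)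
proof (induction rule: weyl_mon_induct)
  case zero
  have "{r. \<exists>x\<in>weight_space E r. f ((\<lambda>_. 0) \<odot> x) \<noteq> 0} = {}"
    using dual_zero_apply[OF f] by (auto simp: weight_space_closed)
  then show ?case by (simp only: finite.emptyI)
next
  case (step c \<alpha> \<beta> a)
  let ?S = "{r. \<exists>x\<in>weight_space E r. f x \<noteq> 0}"
  have "{r. \<exists>x\<in>weight_space E r. f ((\<lambda>g. pm_scale c (wmon \<alpha> \<beta> g) + a g) \<odot> x) \<noteq> 0}
    \<subseteq> (\<lambda>r i. r i - wt \<alpha> \<beta> i) ` ?S \<union> {r. \<exists>x\<in>weight_space E r. f (a \<odot> x) \<noteq> 0}"
  proof (rule subsetI, rule UnCI)
    fix r assume "r \<in> {r. \<exists>x\<in>weight_space E r. f ((\<lambda>g. pm_scale c (wmon \<alpha> \<beta> g) + a g) \<odot> x) \<noteq> 0}"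
      and nex: "r \<notin> {r. \<exists>x\<in>weight_space E r. f (a \<odot> x) \<noteq> 0}"
    then obtain x where x: "x \<in> weight_space E r"
      and nz: "f ((\<lambda>g. pm_scale c (wmon \<alpha> \<beta> g) + a g) \<odot> x) \<noteq> 0"
      by blast
    have xc: "x \<in> carrier E" using x by (rule weight_space_closed)
    have "(\<lambda>g. pm_scale c (wmon \<alpha> \<beta> g) + a g) \<odot> x = pm_scale c \<odot> (wmon \<alpha> \<beta> \<odot> x) \<oplus> a \<odot> x"
      unfolding act_add[OF weyl_pm_scale[OF wmon_closed] step.hyps xc] act_scale[OF wmon_closed xc] ..
    moreover have "f (pm_scale c \<odot> (wmon \<alpha> \<beta> \<odot> x) \<oplus> a \<odot> x) = c * f (wmon \<alpha> \<beta> \<odot> x) + f (a \<odot> x)"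
      using f xc step.hyps by (simp add: dual_carrier_iff)
    ultimately have "f (wmon \<alpha> \<beta> \<odot> x) \<noteq> 0" using nz nex x by auto
    then have "(\<lambda>i. r i + wt \<alpha> \<beta> i) \<in> ?S" using mon_weight_space[OF x] by blast
    then show "r \<in> (\<lambda>r i. r i - wt \<alpha> \<beta> i) ` ?S" by (rule rev_image_eqI) simp
  qed
  moreover have "finite ?S" using f by (simp add: dual_carrier_iff)
  ultimately show ?case using step.IH by (meson finite_UnI finite_imageI finite_subset)
qed

lemma dual_act_closed:
  assumes f: "f \<in> carrier (dual E)" and a: "a \<in> carrier weyl"
  shows "a \<odot>\<^bsub>dual E\<^esub> f \<in> carrier (dual E)"
proof -
  have d: "diamond a \<in> carrier weyl" by (rule diamond_spec(1)[OF a])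
  have "{r. \<exists>x\<in>weight_space E r. (\<lambda>x\<in>carrier E. f (diamond a \<odot> x)) x \<noteq> 0}
      = {r. \<exists>x\<in>weight_space E r. f (diamond a \<odot> x) \<noteq> 0}"
    by (auto simp: weight_space_closed)
  then show ?thesis
    using f d dual_support_finite[OF f d]
    by (simp add: dual_carrier_iff smult_r_distr act_scale_comm[OF d])
qed

lemma diamond_scale: "diamond (pm_scale c) = (pm_scale c :: ('i, 'k) mpol_op)"
  using diamond_spec(6)[of c, where 'i='i] by (simp add: scal_def)

lemma dual_weyl_module: "weyl_module (dual E)"
proof (rule weyl_module.intro, intro left_module.intro ring_weyl left_module_axioms.intro abelian_groupI)
  fix f g assume f: "f \<in> carrier (dual E)" and g: "g \<in> carrier (dual E)"
  have "{r. \<exists>x\<in>weight_space E r. (\<lambda>x\<in>carrier E. f x + g x) x \<noteq> 0}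
      \<subseteq> {r. \<exists>x\<in>weight_space E r. f x \<noteq> 0} \<union> {r. \<exists>x\<in>weight_space E r. g x \<noteq> 0}"
    by (force simp: weight_space_closed)
  then have "finite {r. \<exists>x\<in>weight_space E r. (\<lambda>x\<in>carrier E. f x + g x) x \<noteq> 0}"
    by (rule finite_subset) (use f g in \<open>simp add: dual_carrier_iff\<close>)
  then show "f \<oplus>\<^bsub>dual E\<^esub> g \<in> carrier (dual E)"
    using f g by (simp add: dual_carrier_iff algebra_simps)
  show "f \<oplus>\<^bsub>dual E\<^esub> g = g \<oplus>\<^bsub>dual E\<^esub> f" by (simp add: add.commute)
next
  have "{r. \<exists>x\<in>weight_space E r. (\<lambda>x\<in>carrier E. 0) x \<noteq> (0::'k)} = {}"
    by (auto simp: weight_space_closed)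
  then show "\<zero>\<^bsub>dual E\<^esub> \<in> carrier (dual E)" by (simp add: dual_carrier_iff)
next
  fix f assume f: "f \<in> carrier (dual E)"
  show "\<zero>\<^bsub>dual E\<^esub> \<oplus>\<^bsub>dual E\<^esub> f = f"
    using f by (auto simp: dual_carrier_iff extensional_def restrict_def)
  show "\<exists>g\<in>carrier (dual E). g \<oplus>\<^bsub>dual E\<^esub> f = \<zero>\<^bsub>dual E\<^esub>"
  proof (intro bexI)
    show "pm_scale (-1) \<odot>\<^bsub>dual E\<^esub> f \<in> carrier (dual E)" by (rule dual_act_closed[OF f]) simp
    show "(pm_scale (-1) \<odot>\<^bsub>dual E\<^esub> f) \<oplus>\<^bsub>dual E\<^esub> f = \<zero>\<^bsub>dual E\<^esub>"
      using f by (auto simp: dual_carrier_iff diamond_scale)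
  qed
  show "\<one>\<^bsub>weyl\<^esub> \<odot>\<^bsub>dual E\<^esub> f = f"
    using f by (auto simp: diamond_spec(5) dual_carrier_iff extensional_def restrict_def)
next
  fix f g h show "(f \<oplus>\<^bsub>dual E\<^esub> g) \<oplus>\<^bsub>dual E\<^esub> h = f \<oplus>\<^bsub>dual E\<^esub> (g \<oplus>\<^bsub>dual E\<^esub> h)"
    by (auto simp: add.assoc)
next
  fix a f assume "a \<in> carrier (weyl :: ('i, 'k) mpol_op ring)" "f \<in> carrier (dual E)"
  then show "a \<odot>\<^bsub>dual E\<^esub> f \<in> carrier (dual E)" using dual_act_closed by blast
next
  fix a c :: "('i, 'k) mpol_op" and f assume a: "a \<in> carrier weyl" and c: "c \<in> carrier weyl" and f: "f \<in> carrier (dual E)"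
  note d = diamond_spec(1)[OF a] diamond_spec(1)[OF c]
  show "(a \<oplus>\<^bsub>weyl\<^esub> c) \<odot>\<^bsub>dual E\<^esub> f = (a \<odot>\<^bsub>dual E\<^esub> f) \<oplus>\<^bsub>dual E\<^esub> (c \<odot>\<^bsub>dual E\<^esub> f)"
    using f d by (auto simp: diamond_spec(4)[OF a c] act_add[OF d] dual_carrier_iff)
  show "(a \<otimes>\<^bsub>weyl\<^esub> c) \<odot>\<^bsub>dual E\<^esub> f = a \<odot>\<^bsub>dual E\<^esub> (c \<odot>\<^bsub>dual E\<^esub> f)"
    using d by (auto simp: diamond_spec(3)[OF a c] act_mult[OF d(2,1)])
next
  fix a :: "('i, 'k) mpol_op" and f g assume a: "a \<in> carrier weyl"
  show "a \<odot>\<^bsub>dual E\<^esub> (f \<oplus>\<^bsub>dual E\<^esub> g) = (a \<odot>\<^bsub>dual E\<^esub> f) \<oplus>\<^bsub>dual E\<^esub> (a \<odot>\<^bsub>dual E\<^esub> g)"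
    using diamond_spec(1)[OF a] by auto
qed

text \<open>\<open>lam\<close> as an element of the dual, whose functionals are extensional; it will
  be the generator.\<close>

definition eps :: "'m \<Rightarrow> 'k" where
  "eps = (\<lambda>x\<in>carrier E. lam x)"

lemma eps_closed: "eps \<in> carrier (dual E)"
proof -
  have "{r. \<exists>x\<in>weight_space E r. eps x \<noteq> 0} \<subseteq> {q}"
    using off by (auto simp: eps_def weight_space_closed)
  then have "finite {r. \<exists>x\<in>weight_space E r. eps x \<noteq> 0}" by (rule finite_subset) simp
  then show ?thesis by (auto simp: dual_carrier_iff eps_def add scale)
qed

lemma dual_act_eps: "a \<in> carrier weyl \<Longrightarrow> x \<in> carrier E \<Longrightarrow> (a \<odot>\<^bsub>dual E\<^esub> eps) x = lam (diamond a \<odot> x)"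
  using diamond_spec(1)[of a] by (simp add: eps_def)

text \<open>\<open>diamond\<close> reverses the product and exchanges its factors. As a consequence
  the dual of a weight space has the same weight.\<close>

lemma diamond_t: "diamond (t_op i) = (t_op i :: ('i, 'k) mpol_op)"
  by (simp add: t_op_apply diamond_spec(3)[OF weyl_closed(2,3)] diamond_spec(7,8))

lemma lam_t: "x \<in> carrier E \<Longrightarrow> lam (t_op i \<odot> x) = q i * lam x"
proof -
  assume "x \<in> carrier E"
  from sums[OF this] show ?thesis
  proof induction
    case zero
    then show ?case by (simp add: functional_zero)
  next
    case (step y r x)
    have c: "y \<in> carrier E" "x \<in> carrier E" using step weight_space_closed weight_sums_closed by auto
    have "lam (t_op i \<odot> y) = r i * lam y" using step.hyps(1) c(1) by (simp add: weight_space_iff scale)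
    then have "lam (t_op i \<odot> y) = q i * lam y" using off[OF step.hyps(1)] by (cases "r = q") auto
    then show ?case using c step.IH by (simp add: smult_r_distr add algebra_simps)
  qed
qed

lemma eps_weight: "eps \<in> weight_space (dual E) q"
proof -
  interpret D: weyl_module "dual E" by (rule dual_weyl_module)
  have "t_op i \<odot>\<^bsub>dual E\<^esub> eps = pm_scale (q i) \<odot>\<^bsub>dual E\<^esub> eps" for i
    by (auto simp: eps_def diamond_t diamond_scale lam_t scale)
  then show ?thesis using eps_closed by (simp add: D.weight_space_iff)
qed

lemma dual_weight_apply:
  assumes f: "f \<in> weight_space (dual E) r" and x: "x \<in> weight_space E m" and "m \<noteq> r"
  shows "f x = 0"
proof -
  interpret D: weyl_module "dual E" by (rule dual_weyl_module)
  obtain i where i: "m i \<noteq> r i" using assms(3) by auto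
  have xc: "x \<in> carrier E" using x by (rule weight_space_closed)
  have fc: "f \<in> carrier (dual E)" using f by (rule D.weight_space_closed)
  have "(t_op i \<odot>\<^bsub>dual E\<^esub> f) x = (pm_scale (r i) \<odot>\<^bsub>dual E\<^esub> f) x"
    using f unfolding D.weight_space_iff by metis
  then have "f (t_op i \<odot> x) = f (pm_scale (r i) \<odot> x)"
    using xc by (simp add: diamond_t diamond_scale)
  then have "m i * f x = r i * f x"
    using x xc fc by (simp add: weight_space_iff dual_carrier_iff)
  then show ?thesis using i by simp
qed

text \<open>A functional of finite support is built up one weight at a time: on the line of
  \<open>b m\<close> it is a multiple of \<open>a eps\<close>, where \<open>a\<close> is
  \<open>diamond\<close> of a monomial that moves \<open>b m\<close> into weight
  \<open>q\<close>.\<close>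

lemma dual_cyclic: "cyclic_on (dual E) eps"
  unfolding cyclic_on_def
proof (intro conjI ballI eps_closed)
  interpret D: weyl_module "dual E" by (rule dual_weyl_module)
  have gen: "\<exists>a\<in>carrier weyl. f = a \<odot>\<^bsub>dual E\<^esub> eps"
    if "finite M" "f \<in> carrier (dual E)" "{r. \<exists>x\<in>weight_space E r. f x \<noteq> 0} \<subseteq> M" for f M
    using that
  proof (induction M arbitrary: f)
    case empty
    have "f x = 0" if "x \<in> weight_sums E" for x
      using that
    proof induction
      case zero
      then show ?case by (rule dual_zero_apply[OF empty(1)])
    next
      case (step y r x)
      then show ?case
        using empty weight_space_closed[OF step.hyps(1)] weight_sums_closed[OF step.hyps(2)]
        by (auto simp: dual_carrier_iff)
    qed
    then have "f = \<zero>\<^bsub>dual E\<^esub>"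
      using empty(1) sums by (auto simp: dual_carrier_iff extensional_def restrict_def fun_eq_iff)
    then have "f = (\<lambda>_. 0) \<odot>\<^bsub>dual E\<^esub> eps"
      using D.act_zero_left[OF eps_closed] by metis
    then show ?case by (intro bexI[of _ "\<lambda>_. 0"]) auto
  next
    case (insert m M)
    show ?case
    proof (cases "m \<in> pcoset q")
      case False
      have "f x = 0" if "x \<in> weight_space E m" for x
        using b_span[OF that] False dual_zero_apply[OF insert.prems(1)] by (cases "x = \<zero>") auto
      then have "{r. \<exists>x\<in>weight_space E r. f x \<noteq> 0} \<subseteq> M" using insert.prems(2) by blast
      then show ?thesis using insert.IH[OF insert.prems(1)] by blast
    next
      case True
      obtain \<alpha> \<beta> where \<alpha>\<beta>: "lam (wmon \<alpha> \<beta> \<odot> b m) \<noteq> 0" "wt \<alpha> \<beta> = (\<lambda>i. q i - m i)"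
        using reach_mon[OF True] .
      define a :: "('i, 'k) mpol_op" where "a = diamond (wmon \<alpha> \<beta>)"
      have a: "a \<in> carrier weyl" "diamond a = wmon \<alpha> \<beta>"
        by (simp_all add: a_def diamond_spec(1,2))
      define c where "c = f (b m) / lam (wmon \<alpha> \<beta> \<odot> b m)"
      \<comment> \<open>\<open>a eps\<close> lives on the single weight \<open>m\<close>, so
        subtracting \<open>c\<close> times it removes \<open>m\<close> from the support without
        adding a weight.\<close>
      define f' where "f' = f \<oplus>\<^bsub>dual E\<^esub> pm_scale (- c) \<odot>\<^bsub>dual E\<^esub> (a \<odot>\<^bsub>dual E\<^esub> eps)"
      have ae: "a \<odot>\<^bsub>dual E\<^esub> eps \<in> carrier (dual E)" by (rule D.act_closed[OF a(1) eps_closed])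
      have f'c: "f' \<in> carrier (dual E)"
        unfolding f'_def by (intro D.M.a_closed insert.prems(1) D.act_closed[OF pm_scale_closed ae])
      have pm_ae: "(pm_scale d \<odot>\<^bsub>dual E\<^esub> (a \<odot>\<^bsub>dual E\<^esub> eps)) x = d * lam (wmon \<alpha> \<beta> \<odot> x)"
        if "x \<in> carrier E" for x d
        using that ae dual_act_eps[OF a(1) that] unfolding dual_carrier_iff
        by (simp add: diamond_scale a(2) eps_def act_scale_comm[OF wmon_closed that] scale)
      have f': "f' x = f x - c * lam (wmon \<alpha> \<beta> \<odot> x)" if "x \<in> carrier E" for x
        unfolding f'_def using pm_ae[OF that, of "- c"] that by simp
      have "{r. \<exists>x\<in>weight_space E r. f' x \<noteq> 0} \<subseteq> M"
      proof safe
        fix r x assume x: "x \<in> weight_space E r" and nz: "f' x \<noteq> 0"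
        have xc: "x \<in> carrier E" using x by (rule weight_space_closed)
        have "r \<noteq> m"
        proof
          assume "r = m"
          moreover have "x \<noteq> \<zero>" using nz dual_zero_apply[OF f'c] by auto
          ultimately obtain d where d: "x = pm_scale d \<odot> b m" using b_span x by blast
          have "f' (b m) = 0" using f'[OF b_closed[OF True]] \<alpha>\<beta>(1) by (simp add: c_def)
          then show False using nz f'c b_closed[OF True] by (simp add: d dual_carrier_iff)
        qed
        have "wt \<alpha> \<beta> \<noteq> (\<lambda>i. q i - r i)"
        proof
          assume "wt \<alpha> \<beta> = (\<lambda>i. q i - r i)"
          then have "(\<lambda>i. q i - r i) = (\<lambda>i. q i - m i)" using \<alpha>\<beta>(2) by simp
          then have "r i = m i" for i using fun_cong[of "\<lambda>i. q i - r i" _ i] by simp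
          then show False using \<open>r \<noteq> m\<close> by blast
        qed
        then have "f x \<noteq> 0" using nz f'[OF xc] lam_mon[OF x, of \<alpha> \<beta>] by auto
        then show "r \<in> M" using insert.prems(2) x \<open>r \<noteq> m\<close> by blast
      qed
      from insert.IH[OF f'c this] obtain a' where a': "a' \<in> carrier weyl" "f' = a' \<odot>\<^bsub>dual E\<^esub> eps" by blast
      have ca: "(\<lambda>g. pm_scale c (a g)) \<in> carrier weyl" by (rule weyl_pm_scale[OF a(1)])
      have "f = f' \<oplus>\<^bsub>dual E\<^esub> pm_scale c \<odot>\<^bsub>dual E\<^esub> (a \<odot>\<^bsub>dual E\<^esub> eps)"
      proof
        fix x
        show "f x = (f' \<oplus>\<^bsub>dual E\<^esub> pm_scale c \<odot>\<^bsub>dual E\<^esub> (a \<odot>\<^bsub>dual E\<^esub> eps)) x"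
        proof (cases "x \<in> carrier E")
          case True
          then show ?thesis using f'[OF True] pm_ae[OF True, of c] by simp
        next
          case False
          then show ?thesis using insert.prems(1) by (simp add: dual_carrier_iff extensional_def)
        qed
      qed
      also have "\<dots> = (\<lambda>g. a' g + pm_scale c (a g)) \<odot>\<^bsub>dual E\<^esub> eps"
        unfolding D.act_add[OF a'(1) ca eps_closed] D.act_scale[OF a(1) eps_closed] a'(2) ..
      finally show ?thesis using weyl_closed(7)[OF a'(1) ca] by blast
    qed
  qed
  fix f assume "f \<in> carrier (dual E)"
  then show "\<exists>a\<in>carrier weyl. f = a \<odot>\<^bsub>dual E\<^esub> eps"
    using gen[of "{r. \<exists>x\<in>weight_space E r. f x \<noteq> 0}" f] by (simp add: dual_carrier_iff)
qed

text \<open>Modulo \<open>A m_q\<close>, \<open>a\<close> is a combination of the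
  \<open>wunit \<delta>\<close>, each sending \<open>eps\<close> to a functional of weight
  \<open>q + \<delta>\<close>. Evaluation at the basis vector of that weight isolates one
  coefficient, so all vanish once these values are known to be nonzero.\<close>

lemma dual_annihilator:
  assumes a: "a \<in> carrier weyl" and zero: "a \<odot>\<^bsub>dual E\<^esub> eps = \<zero>\<^bsub>dual E\<^esub>"
  shows "a \<in> wideal q"
proof -
  interpret D: weyl_module "dual E" by (rule dual_weyl_module)
  have ev: "((\<lambda>f. \<Sum>\<delta>\<in>D. pm_scale (c \<delta>) (wunit \<delta> f)) \<odot>\<^bsub>dual E\<^esub> eps) (b m)
      = (if (\<lambda>i. m i - q i) \<in> D then c (\<lambda>i. m i - q i) * (wunit (\<lambda>i. m i - q i) \<odot>\<^bsub>dual E\<^esub> eps) (b m) else 0)"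
    if "finite D" "D \<subseteq> Zf" and m: "m \<in> pcoset q" for D c m
    using that(1,2)
  proof (induction D)
    case empty
    then show ?case using D.act_zero_left[OF eps_closed] b_closed[OF m] by simp
  next
    case (insert \<delta> D)
    let ?T = "\<lambda>f. \<Sum>\<delta>\<in>D. pm_scale (c \<delta>) (wunit \<delta> f)"
    have uc: "wunit \<delta> \<in> carrier (weyl :: ('i, 'k) mpol_op ring)" using insert.prems by (simp add: wunit_closed)
    have T: "?T \<in> carrier weyl"
      using insert.prems by (intro weyl_sum weyl_pm_scale wunit_closed) auto
    have "(\<lambda>f. \<Sum>\<delta>\<in>insert \<delta> D. pm_scale (c \<delta>) (wunit \<delta> f)) = (\<lambda>f. pm_scale (c \<delta>) (wunit \<delta> f) + ?T f)"
      using insert.hyps by simp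
    then have "(\<lambda>f. \<Sum>\<delta>\<in>insert \<delta> D. pm_scale (c \<delta>) (wunit \<delta> f)) \<odot>\<^bsub>dual E\<^esub> eps
        = pm_scale (c \<delta>) \<odot>\<^bsub>dual E\<^esub> (wunit \<delta> \<odot>\<^bsub>dual E\<^esub> eps) \<oplus>\<^bsub>dual E\<^esub> ?T \<odot>\<^bsub>dual E\<^esub> eps"
      using D.act_add[OF weyl_pm_scale[OF uc] T eps_closed] D.act_scale[OF uc eps_closed] by metis
    moreover have "(pm_scale (c \<delta>) \<odot>\<^bsub>dual E\<^esub> (wunit \<delta> \<odot>\<^bsub>dual E\<^esub> eps)) (b m)
        = c \<delta> * (wunit \<delta> \<odot>\<^bsub>dual E\<^esub> eps) (b m)"
    proof -
      have "wunit \<delta> \<odot>\<^bsub>dual E\<^esub> eps \<in> carrier (dual E)" by (rule D.act_closed[OF uc eps_closed])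
      then show ?thesis
        using b_closed[OF m] unfolding dual_carrier_iff dual_simps(3)[of "pm_scale (c \<delta>)"] diamond_scale
        by (simp del: dual_simps)
    qed
    moreover have "(wunit \<delta> \<odot>\<^bsub>dual E\<^esub> eps) (b m) = 0" if "\<delta> \<noteq> (\<lambda>i. m i - q i)"
    proof (rule dual_weight_apply[OF _ b_weight[OF m]])
      show "wunit \<delta> \<odot>\<^bsub>dual E\<^esub> eps \<in> weight_space (dual E) (\<lambda>i. q i + \<delta> i)"
        using insert.prems by (intro D.wunit_weight_space eps_weight) auto
      show "m \<noteq> (\<lambda>i. q i + \<delta> i)" using that by auto
    qed
    ultimately show ?case
      using insert.IH insert.prems insert.hyps b_closed[OF m]
      by (auto simp: dual_simps(2) simp del: dual_simps(3))
  qed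
  obtain D c where D: "finite D" "D \<subseteq> Zf" "weq q a (\<lambda>f. \<Sum>\<delta>\<in>D. pm_scale (c \<delta>) (wunit \<delta> f))"
    using weq_homogeneous[OF a] .
  let ?T = "\<lambda>f. \<Sum>\<delta>\<in>D. pm_scale (c \<delta>) (wunit \<delta> f)"
  have T: "?T \<in> carrier weyl" using D(2) by (intro weyl_sum weyl_pm_scale wunit_closed) auto
  have T0: "?T \<odot>\<^bsub>dual E\<^esub> eps = \<zero>\<^bsub>dual E\<^esub>"
    using D.weq_act[OF D(3) a T eps_weight] zero by (simp del: dual_simps)
  have "c \<delta> = 0" if \<delta>: "\<delta> \<in> D" for \<delta>
  proof -
    let ?m = "\<lambda>i. q i + \<delta> i"
    have m: "?m \<in> pcoset q" using D(2) \<delta> by (auto simp: pcoset_iff)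
    obtain \<alpha> \<beta> where \<alpha>\<beta>: "lam (wmon \<alpha> \<beta> \<odot> b ?m) \<noteq> 0" using reach_mon[OF m] .
    define a' :: "('i, 'k) mpol_op" where "a' = diamond (wmon \<alpha> \<beta>)"
    have a': "a' \<in> carrier weyl" "diamond a' = wmon \<alpha> \<beta>"
      by (simp_all add: a'_def diamond_spec(1,2))
    \<comment> \<open>\<open>a' eps\<close> does not vanish at \<open>b ?m\<close>. When
      \<open>a'\<close> is expanded in the same way, only the term of \<open>wunit \<delta>\<close>
      contributes there, so this term is nonzero.\<close>
    obtain D' c' where D': "finite D'" "D' \<subseteq> Zf" "weq q a' (\<lambda>f. \<Sum>\<delta>\<in>D'. pm_scale (c' \<delta>) (wunit \<delta> f))"
      using weq_homogeneous[OF a'(1)] .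
    have T': "(\<lambda>f. \<Sum>\<delta>\<in>D'. pm_scale (c' \<delta>) (wunit \<delta> f)) \<in> carrier weyl"
      using D'(2) by (intro weyl_sum weyl_pm_scale wunit_closed) auto
    have "(a' \<odot>\<^bsub>dual E\<^esub> eps) (b ?m) \<noteq> 0"
      using dual_act_eps[OF a'(1) b_closed[OF m]] \<alpha>\<beta> a'(2) by (simp del: dual_simps)
    then have "(wunit \<delta> \<odot>\<^bsub>dual E\<^esub> eps) (b ?m) \<noteq> 0"
      using ev[OF D'(1,2) m, of c'] D.weq_act[OF D'(3) a'(1) T' eps_weight]
      by (auto simp del: dual_simps split: if_splits)
    moreover have "c \<delta> * (wunit \<delta> \<odot>\<^bsub>dual E\<^esub> eps) (b ?m) = 0"
      using ev[OF D(1,2) m, of c] \<delta> b_closed[OF m] unfolding T0 by (simp del: dual_simps(3))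
    ultimately show ?thesis by simp
  qed
  then have "?T = (\<lambda>f. 0)" by (simp add: fun_eq_iff)
  then show ?thesis using D(3) by (simp add: weq_0)
qed

text \<open>By \<open>ann\<close>, \<open>L\<close> is a copy of the submodule of \<open>E\<close>
  generated by \<open>b q\<close>; nothing else about \<open>L\<close> enters.\<close>

theorem envelope_and_cover:
  assumes L: "weyl_module L" "cyclic_on L y"
    and ann: "\<And>a. a \<in> carrier weyl \<Longrightarrow> a \<odot>\<^bsub>L\<^esub> y = \<zero>\<^bsub>L\<^esub> \<longleftrightarrow> a \<odot> b q = \<zero>"
  shows "injective_envelope_in_W TYPE('u) TYPE('v) E L"
    and "projective_cover_in_W TYPE('u) TYPE('v) (dual E) L"
proof -
  interpret L: weyl_module L by fact
  note y = cyclic_onD(1)[OF L(2)] and bc = b_closed[OF q_in_pcoset] and bw = b_weight[OF q_in_pcoset]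
  have b_nz: "b q \<noteq> \<zero>" using lam_b_q functional_zero by auto
  then have y_nz: "y \<noteq> \<zero>\<^bsub>L\<^esub>" using ann[of "\<lambda>f. f"] y bc by auto
  \<comment> \<open>The weight is transferred from \<open>b q\<close>: the elements
    \<open>t_i - q_i\<close> annihilate \<open>b q\<close>, hence \<open>y\<close>.\<close>
  have yw: "y \<in> weight_space L q"
    unfolding L.weight_space_iff
  proof (intro conjI allI y)
    fix i
    have c: "(\<lambda>f. t_op i f - pm_scale (q i) f) \<in> carrier (weyl :: ('i, 'k) mpol_op ring)"
      by (simp add: weyl_diff)
    have "(\<lambda>f. t_op i f - pm_scale (q i) f) \<in> wideal q" using wideal_gen[of "\<lambda>f. f" i q] by simp
    then have "(\<lambda>f. t_op i f - pm_scale (q i) f) \<odot> b q = \<zero>" by (rule wideal_act[OF _ bw])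
    then have "(\<lambda>f. t_op i f - pm_scale (q i) f) \<odot>\<^bsub>L\<^esub> y = \<zero>\<^bsub>L\<^esub>" using ann[OF c] by simp
    then show "t_op i \<odot>\<^bsub>L\<^esub> y = pm_scale (q i) \<odot>\<^bsub>L\<^esub> y"
      unfolding L.act_diff[OF t_op_closed pm_scale_closed y]
      by (rule L.eq_if_diff_zero[OF L.act_closed[OF t_op_closed y] L.act_closed[OF pm_scale_closed y]])
  qed
  show "projective_cover_in_W TYPE('u) TYPE('v) (dual E) L"
    by (rule projective_coverI[OF dual_weyl_module dual_cyclic eps_weight dual_annihilator L yw y_nz])
  obtain \<iota> where \<iota>: "\<iota> \<in> left_module_hom weyl L E" "\<And>a. a \<in> carrier weyl \<Longrightarrow> \<iota> (a \<odot>\<^bsub>L\<^esub> y) = a \<odot> b q"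
    by (rule cyclic_hom[OF L(1) weyl_module_axioms L(2) bc]) (use ann in auto)
  have "inj_on \<iota> (carrier L)"
  proof (rule inj_onI)
    fix z z' assume z: "z \<in> carrier L" "z' \<in> carrier L" "\<iota> z = \<iota> z'"
    obtain a where a: "a \<in> carrier weyl" "z = a \<odot>\<^bsub>L\<^esub> y" using cyclic_onD(2)[OF L(2) z(1)] by blast
    obtain a' where a': "a' \<in> carrier weyl" "z' = a' \<odot>\<^bsub>L\<^esub> y" using cyclic_onD(2)[OF L(2) z(2)] by blast
    have "a \<odot> b q = a' \<odot> b q" using z(3) \<iota>(2)[OF a(1)] \<iota>(2)[OF a'(1)] a(2) a'(2) by simp
    then have "(\<lambda>f. a f - a' f) \<odot> b q = \<zero>"
      unfolding act_diff[OF a(1) a'(1) bc] using act_closed[OF a'(1) bc] by (simp add: a_minus_def M.r_neg)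
    then have "z \<ominus>\<^bsub>L\<^esub> z' = \<zero>\<^bsub>L\<^esub>"
      using ann[OF weyl_diff[OF a(1) a'(1)]] L.act_diff[OF a(1) a'(1) y] a(2) a'(2) by simp
    then show "z = z'" by (rule L.eq_if_diff_zero[OF z(1,2)])
  qed
  moreover have "N \<inter> \<iota> ` carrier L \<noteq> {\<zero>}" if "submodule N weyl E \<and> N \<noteq> {\<zero>}" for N
  proof -
    have "b q \<in> N" using submodule_contains_b_q that by blast
    moreover have "\<iota> y = b q" using \<iota>(2)[of "\<lambda>f. f"] y bc by simp
    then have "b q \<in> \<iota> ` carrier L" using y by (metis imageI)
    ultimately show ?thesis using b_nz by blast
  qed
  ultimately show "injective_envelope_in_W TYPE('u) TYPE('v) E L"
    using \<iota>(1) cyclic_weight_module[OF L yw] injective unfolding injective_envelope_in_W_def by blast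
qed

end

section \<open>Quotient modules\<close>

locale quotient = left_module R M for R :: "('a, 'r) ring_scheme" (structure)
    and M :: "('a, 'm, 'x) module_scheme" (structure) +
  fixes N :: "'m set"
  assumes submodule_N: "submodule N R M"
begin

lemmas N_simps = left_module_submoduleE[OF left_module_axioms submodule_N]

lemma abelian_subgroup_N: "abelian_subgroup N M"
proof (rule abelian_subgroupI3)
  show "additive_subgroup N M"
    using submodule_N by (simp add: additive_subgroup_def submodule_def)
  show "abelian_group M" by (rule M.abelian_group_axioms)
qed

definition cl :: "'m \<Rightarrow> 'm set" where
  "cl x = N +>\<^bsub>M\<^esub> x"

lemma quotient_carrier: "carrier (quotient_module M N) = cl ` carrier M"
  by (auto simp: quotient_module_def A_RCOSETS_def' cl_def)

lemma cl_add:
  "x \<in> carrier M \<Longrightarrow> y \<in> carrier M \<Longrightarrow>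
    cl x \<oplus>\<^bsub>quotient_module M N\<^esub> cl y = cl (x \<oplus>\<^bsub>M\<^esub> y)"
  using abelian_subgroup.a_rcos_sum[OF abelian_subgroup_N, of x y]
  by (simp add: quotient_module_def cl_def)

lemma cl_eq_iff:
  assumes "x \<in> carrier M" "y \<in> carrier M"
  shows "cl x = cl y \<longleftrightarrow> x \<ominus>\<^bsub>M\<^esub> y \<in> N"
proof
  assume "cl x = cl y"
  then have "x \<in> N +>\<^bsub>M\<^esub> y"
    using abelian_subgroup.a_rcos_self[OF abelian_subgroup_N assms(1)] by (simp add: cl_def)
  then show "x \<ominus>\<^bsub>M\<^esub> y \<in> N"
    using abelian_subgroup.a_rcos_module_imp[OF abelian_subgroup_N assms(2)] by (simp add: a_minus_def)
next
  assume "x \<ominus>\<^bsub>M\<^esub> y \<in> N"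
  then have "x \<in> N +>\<^bsub>M\<^esub> y"
    using abelian_subgroup.a_rcos_module_rev[OF abelian_subgroup_N assms(2,1)] by (simp add: a_minus_def)
  then show "cl x = cl y"
    using abelian_subgroup.a_repr_independence'[OF abelian_subgroup_N _ assms(2)] by (simp add: cl_def)
qed

lemma zero_quotient: "\<zero>\<^bsub>quotient_module M N\<^esub> = cl \<zero>\<^bsub>M\<^esub>"
  using abelian_subgroup.a_rcos_const[OF abelian_subgroup_N N_simps(2)]
  by (simp add: quotient_module_def cl_def)

lemma cl_zero_iff: "x \<in> carrier M \<Longrightarrow> cl x = \<zero>\<^bsub>quotient_module M N\<^esub> \<longleftrightarrow> x \<in> N"
proof -
  assume x: "x \<in> carrier M"
  have "\<ominus>\<^bsub>M\<^esub> \<zero>\<^bsub>M\<^esub> = \<zero>\<^bsub>M\<^esub>" by (rule M.minus_equality) simp_all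
  then have "x \<ominus>\<^bsub>M\<^esub> \<zero>\<^bsub>M\<^esub> = x" unfolding a_minus_def by (simp only: M.r_zero x)
  then show ?thesis using cl_eq_iff[OF x M.zero_closed] by (simp add: zero_quotient)
qed

text \<open>The union in the scalar action runs over cosets that all coincide, because
  \<open>a\<close> maps \<open>N\<close> into itself.\<close>

lemma cl_smult:
  assumes "a \<in> carrier R" "x \<in> carrier M"
  shows "a \<odot>\<^bsub>quotient_module M N\<^esub> cl x = cl (a \<odot>\<^bsub>M\<^esub> x)"
proof -
  have "N +>\<^bsub>M\<^esub> (a \<odot>\<^bsub>M\<^esub> z) = cl (a \<odot>\<^bsub>M\<^esub> x)" if z: "z \<in> N +>\<^bsub>M\<^esub> x" for z
  proof -
    obtain n where n: "n \<in> N" "z = n \<oplus>\<^bsub>M\<^esub> x" using z by (auto simp: a_r_coset_def')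
    have nc: "n \<in> carrier M" using n(1) N_simps(1) by blast
    have c: "a \<odot>\<^bsub>M\<^esub> n \<in> carrier M" "a \<odot>\<^bsub>M\<^esub> x \<in> carrier M"
      using assms nc by (auto simp: smult_closed)
    have "a \<odot>\<^bsub>M\<^esub> z \<ominus>\<^bsub>M\<^esub> a \<odot>\<^bsub>M\<^esub> x = a \<odot>\<^bsub>M\<^esub> n"
      using assms nc c by (simp add: n(2) smult_r_distr a_minus_def M.a_assoc M.r_neg)
    then show ?thesis
      using cl_eq_iff[of "a \<odot>\<^bsub>M\<^esub> z" "a \<odot>\<^bsub>M\<^esub> x"] N_simps(5)[OF assms(1) n(1)] assms nc c
      by (simp add: n(2) smult_r_distr cl_def)
  qed
  then have "(\<Union>z\<in>N +>\<^bsub>M\<^esub> x. N +>\<^bsub>M\<^esub> (a \<odot>\<^bsub>M\<^esub> z)) = (\<Union>z\<in>N +>\<^bsub>M\<^esub> x. cl (a \<odot>\<^bsub>M\<^esub> x))"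
    by (intro SUP_cong refl)
  also have "\<dots> = cl (a \<odot>\<^bsub>M\<^esub> x)"
    using abelian_subgroup.a_rcos_self[OF abelian_subgroup_N assms(2)] by (intro SUP_const) blast
  finally show ?thesis by (simp add: quotient_module_def cl_def)
qed

lemma quotient_left_module: "left_module R (quotient_module M N)"
proof (intro left_module.intro R.ring_axioms left_module_axioms.intro abelian_groupI)
  fix X assume "X \<in> carrier (quotient_module M N)"
  then obtain x where x: "x \<in> carrier M" "X = cl x" by (auto simp: quotient_carrier)
  show "\<exists>Y\<in>carrier (quotient_module M N). Y \<oplus>\<^bsub>quotient_module M N\<^esub> X = \<zero>\<^bsub>quotient_module M N\<^esub>"
    using x by (intro bexI[of _ "cl (\<ominus>\<^bsub>M\<^esub> x)"]) (auto simp: quotient_carrier cl_add zero_quotient M.l_neg)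
qed (auto simp: quotient_carrier cl_add zero_quotient cl_smult smult_closed smult_l_distr smult_r_distr
    smult_assoc smult_one M.a_ac)

end

section \<open>Twisted modules\<close>

lemma twist_simps [simp]:
  "carrier (twist \<phi> M) = carrier M" "\<zero>\<^bsub>twist \<phi> M\<^esub> = \<zero>\<^bsub>M\<^esub>" "x \<oplus>\<^bsub>twist \<phi> M\<^esub> y = x \<oplus>\<^bsub>M\<^esub> y"
  "a \<odot>\<^bsub>twist \<phi> M\<^esub> x = \<phi> a \<odot>\<^bsub>M\<^esub> x"
  by (simp_all add: twist_def)

lemma twist_id: "twist (\<lambda>a. a) M = M"
  by (simp add: twist_def)

lemma twist_abelian_group: "abelian_group M \<Longrightarrow> abelian_group (twist \<phi> M)"
proof -
  assume "abelian_group M"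
  then interpret abelian_group M .
  show ?thesis
  proof (rule abelian_groupI)
    fix x assume "x \<in> carrier (twist \<phi> M)"
    then show "\<exists>y\<in>carrier (twist \<phi> M). y \<oplus>\<^bsub>twist \<phi> M\<^esub> x = \<zero>\<^bsub>twist \<phi> M\<^esub>"
      by (intro bexI[of _ "\<ominus>\<^bsub>M\<^esub> x"]) (auto simp: l_neg)
  qed (auto simp: a_ac)
qed

lemma twist_weyl_module:
  fixes M :: "(('i, 'k::field_char_0) mpol_op, 'm) module"
  assumes "weyl_module M" "\<phi> \<in> ring_iso weyl weyl"
  shows "weyl_module (twist \<phi> M)"
proof -
  interpret weyl_module M by fact
  note \<phi> = ring_iso_memE[OF assms(2)]
  show ?thesis
    by (rule weyl_module.intro, intro left_module.intro ring_weyl left_module_axioms.intro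
        twist_abelian_group M.abelian_group_axioms)
      (simp_all only: twist_simps \<phi> smult_closed smult_l_distr smult_r_distr smult_assoc smult_one)
qed

lemma twist_cyclic:
  fixes M :: "(('i, 'k::field_char_0) mpol_op, 'm) module"
  assumes "cyclic_on M y" "\<phi> \<in> ring_iso weyl weyl"
  shows "cyclic_on (twist \<phi> M) y"
proof -
  have "\<phi> ` carrier weyl = carrier weyl"
    using ring_iso_memE(5)[OF assms(2)] by (simp add: bij_betw_def)
  then have img: "a \<in> \<phi> ` carrier weyl" if "a \<in> carrier weyl" for a
    using that by simp
  show ?thesis
    unfolding cyclic_on_def
  proof (intro conjI ballI)
    show "y \<in> carrier (twist \<phi> M)" using cyclic_onD(1)[OF assms(1)] by simp
    fix z assume "z \<in> carrier (twist \<phi> M)"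
    then obtain a where a: "a \<in> carrier weyl" "z = a \<odot>\<^bsub>M\<^esub> y" using cyclic_onD(2)[OF assms(1)] by auto
    obtain a' where "a' \<in> carrier weyl" "a = \<phi> a'" using img[OF a(1)] by blast
    then show "\<exists>a\<in>carrier weyl. z = a \<odot>\<^bsub>twist \<phi> M\<^esub> y" using a(2) by auto
  qed
qed

section \<open>The twisted modules \<open>B(p)\<close>\<close>

text \<open>The automorphism sends \<open>t\<^sub>j = X\<^sub>j Y\<^sub>j\<close> to \<open>Y\<^sub>j (- X\<^sub>j) = - t\<^sub>j - 1\<close> for \<open>j \<in> J\<close>.\<close>

definition twist_weight :: "'i set \<Rightarrow> ('i \<Rightarrow> 'k::field) \<Rightarrow> 'i \<Rightarrow> 'k" where
  "twist_weight J m i = (if i \<in> J then - m i - 1 else m i)"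

lemma twist_weight_involution [simp]: "twist_weight J (twist_weight J m) = m"
  by (auto simp: twist_weight_def)

lemma twist_weight_pcoset: "twist_weight J m \<in> pcoset (twist_weight J p) \<longleftrightarrow> m \<in> pcoset p"
proof -
  have *: "twist_weight J m \<in> pcoset (twist_weight J p)" if "m \<in> pcoset p" for m p :: "'a \<Rightarrow> 'b"
  proof -
    have z: "m i - p i \<in> \<int>" for i using that by (auto simp: pcoset_iff Zf_def)
    have fin: "finite {i. m i - p i \<noteq> 0}" using that by (auto simp: pcoset_iff Zf_def)
    have d: "twist_weight J m i - twist_weight J p i = (if i \<in> J then - (m i - p i) else m i - p i)" for i
      by (simp add: twist_weight_def)
    show ?thesis
      unfolding pcoset_iff Zf_def d using Ints_minus[OF z] z by (auto intro: finite_subset[OF _ fin])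
  qed
  show ?thesis using *[of m p] *[of "twist_weight J m" "twist_weight J p"] by auto
qed

definition diag_op :: "('e \<Rightarrow> 'k::field) \<Rightarrow> ('e \<Rightarrow>\<^sub>0 'k) \<Rightarrow> ('e \<Rightarrow>\<^sub>0 'k)" where
  "diag_op h = linear_ext (\<lambda>m. Poly_Mapping.single m (h m))"

lemma lookup_diag_op: "Poly_Mapping.lookup (diag_op h f) m = h m * Poly_Mapping.lookup f m"
proof -
  have "Poly_Mapping.lookup (diag_op h f) m
      = (\<Sum>n\<in>Poly_Mapping.keys f. if n = m then h m * Poly_Mapping.lookup f m else 0)"
    unfolding diag_op_def linear_ext_def lookup_sum
    by (rule sum.cong) (auto simp: lookup_single when_def mult.commute)
  then show ?thesis by (simp add: sum.delta in_keys_iff)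
qed

lemma B_XY: "B_X i (B_Y i f) = diag_op (\<lambda>m. m i) f"
proof (rule linear_op_eqI[OF linear_op_comp[OF B_X_linear B_Y_linear]])
  show "linear_op (diag_op (\<lambda>m. m i))" unfolding diag_op_def by (rule linear_op_linear_ext)
qed (simp add: diag_op_def)

lemma B_YX: "B_Y i (B_X i f) = diag_op (\<lambda>m. m i + 1) f"
proof (rule linear_op_eqI[OF linear_op_comp[OF B_Y_linear B_X_linear]])
  show "linear_op (diag_op (\<lambda>m. m i + 1))" unfolding diag_op_def by (rule linear_op_linear_ext)
qed (simp add: diag_op_def)

lemma B_weyl_module: "weyl_module (B_mod p)"
  by (rule weyl_module.intro[OF B_mod_spec(1)])

lemma B_scale: "f \<in> B_carrier p \<Longrightarrow> pm_scale c \<odot>\<^bsub>B_mod p\<^esub> f = pm_scale c f" for p :: "'i \<Rightarrow> 'k::field_char_0"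
  using B_mod_spec(2)[of f p c] by (simp add: scal_def)

text \<open>Write the exponent as \<open>p + \<alpha> - \<beta>\<close>. The \<open>X_op i\<close>
  raise it to \<open>p + \<alpha>\<close> with coefficients 1, then the \<open>Y_op i\<close> lower
  it to \<open>p\<close>; the lowering is proved first, as \<open>pos\<close>.\<close>

lemma B_reach:
  fixes p :: "'i \<Rightarrow> 'k::field_char_0"
  assumes "p \<in> kplus" "m \<in> pcoset p"
  shows "\<exists>a\<in>carrier weyl. Poly_Mapping.lookup (a \<odot>\<^bsub>B_mod p\<^esub> Poly_Mapping.single m 1) p \<noteq> 0"
proof -
  interpret B: weyl_module "B_mod p" by (rule B_weyl_module)
  have mem: "Poly_Mapping.single m 1 \<in> B_carrier p" if "m \<in> pcoset p" for m
    using that by (simp add: B_carrier_single)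
  have wt_mem: "(\<lambda>i. p i + wt \<alpha> \<beta> i) \<in> pcoset p" for \<alpha> \<beta>
    using Zf_wt[of \<alpha> \<beta>, where 'k='k] by (simp add: pcoset_iff)
  \<comment> \<open>Prepends one generator, which may introduce a coefficient \<open>c\<close> as
    long as it is nonzero.\<close>
  have step: "\<exists>a\<in>carrier weyl. Poly_Mapping.lookup (a \<odot>\<^bsub>B_mod p\<^esub> Poly_Mapping.single m 1) p \<noteq> 0"
    if "a \<in> carrier weyl" "g \<in> carrier weyl" "m \<in> pcoset p" "m' \<in> pcoset p" "c \<noteq> 0"
      and g: "g \<odot>\<^bsub>B_mod p\<^esub> Poly_Mapping.single m 1 = Poly_Mapping.single m' c"
      and a: "Poly_Mapping.lookup (a \<odot>\<^bsub>B_mod p\<^esub> Poly_Mapping.single m' 1) p \<noteq> 0" for a g m m' c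
  proof (rule bexI)
    have "(\<lambda>f. a (g f)) \<odot>\<^bsub>B_mod p\<^esub> Poly_Mapping.single m 1 = a \<odot>\<^bsub>B_mod p\<^esub> Poly_Mapping.single m' c"
      using B.act_mult[OF that(1,2), of "Poly_Mapping.single m 1"] mem[OF that(3)] g by simp
    also have "\<dots> = a \<odot>\<^bsub>B_mod p\<^esub> (pm_scale c \<odot>\<^bsub>B_mod p\<^esub> Poly_Mapping.single m' 1)"
      using mem[OF that(4)] by (simp add: B_scale)
    also have "\<dots> = pm_scale c \<odot>\<^bsub>B_mod p\<^esub> (a \<odot>\<^bsub>B_mod p\<^esub> Poly_Mapping.single m' 1)"
      by (rule B.act_scale_comm[OF that(1)]) (use mem[OF that(4)] in simp)
    also have "\<dots> = pm_scale c (a \<odot>\<^bsub>B_mod p\<^esub> Poly_Mapping.single m' 1)"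
      by (rule B_scale) (use B.act_closed[OF that(1), of "Poly_Mapping.single m' 1"] mem[OF that(4)] in simp)
    finally show "Poly_Mapping.lookup ((\<lambda>f. a (g f)) \<odot>\<^bsub>B_mod p\<^esub> Poly_Mapping.single m 1) p \<noteq> 0"
      using that(5) a by simp
    show "(\<lambda>f. a (g f)) \<in> carrier weyl" by (rule weyl_closed(6)[OF that(1,2)])
  qed
  have pos: "\<exists>a\<in>carrier weyl. Poly_Mapping.lookup (a \<odot>\<^bsub>B_mod p\<^esub> Poly_Mapping.single (\<lambda>i. p i + wt \<alpha> {#} i) 1) p \<noteq> 0" for \<alpha>
  proof (induction \<alpha>)
    case empty
    have "p \<in> pcoset p" by (simp add: pcoset_iff Zf_0)
    then show ?case using mem[of p] by (intro bexI[of _ "\<lambda>f. f"]) auto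
  next
    case (add i \<alpha>)
    let ?m = "\<lambda>j. p j + wt (add_mset i \<alpha>) {#} j" and ?m' = "\<lambda>j. p j + wt \<alpha> {#} j"
    obtain a where a: "a \<in> carrier weyl" "Poly_Mapping.lookup (a \<odot>\<^bsub>B_mod p\<^esub> Poly_Mapping.single ?m' 1) p \<noteq> 0"
      using add by blast
    have eq: "?m(i := ?m i - 1) = ?m'" by (auto simp: wt_def)
    \<comment> \<open>The coefficient of the derivative is
      \<open>p i + count \<alpha> i + 1\<close>. Were it 0, \<open>p i\<close> would be a negative
      integer, contrary to \<open>kplus\<close>.\<close>
    have "?m i \<noteq> 0"
    proof
      assume "?m i = 0"
      then have e: "p i = - of_nat (Suc (count \<alpha> i))"
        by (simp add: wt_def add_eq_0_iff2 del: of_nat_Suc)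
      then have "p i \<in> \<int>" by (simp del: of_nat_Suc)
      then have "p i \<in> \<nat>" using assms(1) by (simp add: kplus_def)
      then obtain n where n: "p i = of_nat n" by (auto simp: Nats_def)
      have "of_nat n + of_nat (Suc (count \<alpha> i)) = (0 :: 'k)"
        unfolding n[symmetric] e by (rule left_minus)
      then have "of_nat (n + Suc (count \<alpha> i)) = (0 :: 'k)" by (simp only: of_nat_add)
      then show False by (simp only: of_nat_eq_0_iff)
    qed
    moreover have "Y_op i \<odot>\<^bsub>B_mod p\<^esub> Poly_Mapping.single ?m 1 = Poly_Mapping.single ?m' (?m i)"
      using B_mod_spec(4)[OF mem[OF wt_mem[of "add_mset i \<alpha>" "{#}"]], of i] eq by simp
    ultimately show ?case
      using step[OF a(1) weyl_closed(3) wt_mem wt_mem _ _ a(2)] by blast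
  qed
  have "\<exists>a\<in>carrier weyl. Poly_Mapping.lookup (a \<odot>\<^bsub>B_mod p\<^esub> Poly_Mapping.single (\<lambda>i. p i + wt \<alpha> \<beta> i) 1) p \<noteq> 0" for \<alpha> \<beta>
  proof (induction \<beta>)
    case empty
    show ?case by (rule pos)
  next
    case (add i \<beta>)
    let ?m = "\<lambda>j. p j + wt \<alpha> (add_mset i \<beta>) j" and ?m' = "\<lambda>j. p j + wt \<alpha> \<beta> j"
    obtain a where a: "a \<in> carrier weyl" "Poly_Mapping.lookup (a \<odot>\<^bsub>B_mod p\<^esub> Poly_Mapping.single ?m' 1) p \<noteq> 0"
      using add by blast
    have eq: "?m(i := ?m i + 1) = ?m'" by (auto simp: wt_def)
    have "X_op i \<odot>\<^bsub>B_mod p\<^esub> Poly_Mapping.single ?m 1 = Poly_Mapping.single ?m' 1"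
      using B_mod_spec(3)[OF mem[OF wt_mem[of \<alpha> "add_mset i \<beta>"]], of i] eq by simp
    from step[OF a(1) weyl_closed(2) wt_mem wt_mem one_neq_zero this a(2)] show ?case .
  qed
  moreover obtain \<alpha> \<beta> where "(\<lambda>i. m i - p i) = wt \<alpha> \<beta>"
    using Zf_wtE assms(2) unfolding pcoset_iff by blast
  then have "m = (\<lambda>i. p i + wt \<alpha> \<beta> i)" by (auto simp: fun_eq_iff diff_eq_eq add.commute)
  ultimately show ?thesis by simp
qed

text \<open>Stated for an automorphism given on the generators, as the identity with empty
  \<open>J\<close> is needed for \<open>L(p)\<close>. The basis vector of weight \<open>m\<close>
  has exponent \<open>twist_weight J m\<close>, since \<open>twist_weight J\<close> is an
  involution.\<close>

lemma twisted_B_weyl_line: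
  fixes p :: "'i \<Rightarrow> 'k::field_char_0"
  assumes p: "p \<in> kplus" and \<phi>: "\<phi> \<in> ring_iso weyl weyl" "\<And>c. \<phi> (scal c) = scal c"
    and in_J: "\<And>j. j \<in> J \<Longrightarrow> \<phi> (X_op j) = Y_op j" "\<And>j. j \<in> J \<Longrightarrow> \<phi> (Y_op j) = (\<lambda>f. - X_op j f)"
    and not_J: "\<And>i. i \<notin> J \<Longrightarrow> \<phi> (X_op i) = X_op i" "\<And>i. i \<notin> J \<Longrightarrow> \<phi> (Y_op i) = Y_op i"
  shows "weyl_line (twist \<phi> (B_mod p)) (twist_weight J p) (\<lambda>f. Poly_Mapping.lookup f p)
    (\<lambda>m. Poly_Mapping.single (twist_weight J m) 1)"
proof -
  let ?E = "twist \<phi> (B_mod p)"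
  note \<phi>E = ring_iso_memE[OF \<phi>(1)]
  interpret B: weyl_module "B_mod p" by (rule B_weyl_module)
  interpret E: weyl_module ?E by (rule twist_weyl_module[OF B_weyl_module \<phi>(1)])
  have \<phi>_mult: "\<phi> (\<lambda>f. a (b f)) = (\<lambda>f. \<phi> a (\<phi> b f))" if "a \<in> carrier weyl" "b \<in> carrier weyl" for a b
    using \<phi>E(2)[OF that] by simp
  have scale: "pm_scale c \<odot>\<^bsub>?E\<^esub> f = pm_scale c f" if "f \<in> B_carrier p" for c f
    using \<phi>(2)[of c] B_scale[OF that] by (simp add: scal_def)
  have t: "t_op i \<odot>\<^bsub>?E\<^esub> f = diag_op (\<lambda>m. twist_weight J m i) f" if f: "f \<in> B_carrier p" for i f
  proof (cases "i \<in> J")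
    case False
    have "\<phi> (t_op i) = t_op i"
      unfolding t_op_apply \<phi>_mult[OF weyl_closed(2,3)] not_J[OF False] ..
    then have "t_op i \<odot>\<^bsub>?E\<^esub> f = X_op i \<odot>\<^bsub>B_mod p\<^esub> (Y_op i \<odot>\<^bsub>B_mod p\<^esub> f)"
      using B.act_mult[of "X_op i" "Y_op i" f] f by (simp add: t_op_apply)
    then show ?thesis
      using f False by (simp add: B_mod_spec B_carrier_XY B_XY twist_weight_def)
  next
    case True
    have "\<phi> (t_op i) = (\<lambda>f. Y_op i (- X_op i f))"
      unfolding t_op_apply \<phi>_mult[OF weyl_closed(2,3)] in_J[OF True] ..
    then have *: "\<phi> (t_op i) = (\<lambda>f. pm_scale (-1) (Y_op i (X_op i f)))"
      by (simp add: linear_op_minus[OF Y_op_linear] pm_scale_minus)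
    have "t_op i \<odot>\<^bsub>?E\<^esub> f = pm_scale (-1) \<odot>\<^bsub>B_mod p\<^esub> (Y_op i \<odot>\<^bsub>B_mod p\<^esub> (X_op i \<odot>\<^bsub>B_mod p\<^esub> f))"
      using B.act_scale[OF weyl_closed(6)[OF weyl_closed(3,2)[of i]], of f "-1"]
        B.act_mult[of "Y_op i" "X_op i" f] f * by simp
    also have "\<dots> = pm_scale (-1) (diag_op (\<lambda>m. m i + 1) f)"
      using f by (simp add: B_mod_spec B_carrier_XY B_YX[symmetric] B_scale)
    also have "\<dots> = diag_op (\<lambda>m. twist_weight J m i) f"
      using True by (intro poly_mapping_eqI) (simp add: lookup_diag_op twist_weight_def algebra_simps)
    finally show ?thesis .
  qed
  have weight: "x \<in> weight_space ?E r \<longleftrightarrow> x \<in> B_carrier p \<and>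
      (\<forall>m. Poly_Mapping.lookup x m \<noteq> 0 \<longrightarrow> twist_weight J m = r)" for x r
  proof -
    have "t_op i \<odot>\<^bsub>?E\<^esub> x = pm_scale (r i) \<odot>\<^bsub>?E\<^esub> x \<longleftrightarrow>
        (\<forall>m. Poly_Mapping.lookup x m \<noteq> 0 \<longrightarrow> twist_weight J m i = r i)" if "x \<in> B_carrier p" for i
      unfolding t[OF that] scale[OF that] poly_mapping_eq_iff fun_eq_iff lookup_diag_op lookup_pm_scale
      by auto
    then show ?thesis by (auto simp: E.weight_space_iff fun_eq_iff simp del: twist_simps(4))
  qed
  have sums: "x \<in> weight_sums ?E" if x: "x \<in> B_carrier p" for x
  proof -
    have "(\<Sum>m\<in>K. pm_scale (Poly_Mapping.lookup x m) (Poly_Mapping.single m 1)) \<in> weight_sums ?E"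
      if "finite K" "K \<subseteq> Poly_Mapping.keys x" for K
      using that
    proof (induction K)
      case empty
      then show ?case using weight_sums.zero[of ?E] by simp
    next
      case (insert m K)
      have "m \<in> pcoset p" using insert.prems x by (auto simp: B_carrier_iff)
      then have "Poly_Mapping.single m (Poly_Mapping.lookup x m) \<in> weight_space ?E (twist_weight J m)"
        by (auto simp: weight B_carrier_single lookup_single when_def)
      from weight_sums.step[OF this] insert show ?case by simp
    qed
    from this[of "Poly_Mapping.keys x"] show ?thesis
      using poly_mapping_sum_singles[of x] by simp
  qed
  show ?thesis
  proof unfold_locales
    fix x assume "x \<in> carrier ?E"
    then show "x \<in> weight_sums ?E" using sums by simp
    fix y assume "y \<in> carrier ?E"
    show "Poly_Mapping.lookup (x \<oplus>\<^bsub>?E\<^esub> y) p = Poly_Mapping.lookup x p + Poly_Mapping.lookup y p"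
      by (simp add: lookup_add)
  next
    fix x c assume "x \<in> carrier ?E"
    then have "x \<in> B_carrier p" by simp
    from scale[OF this, of c]
    show "Poly_Mapping.lookup (pm_scale c \<odot>\<^bsub>?E\<^esub> x) p = c * Poly_Mapping.lookup x p"
      by (simp only: lookup_pm_scale)
  next
    fix x r assume "x \<in> weight_space ?E r" "r \<noteq> twist_weight J p"
    then show "Poly_Mapping.lookup x p = 0" by (auto simp: weight)
  next
    fix m assume "m \<in> pcoset (twist_weight J p)"
    then have m: "twist_weight J m \<in> pcoset p" using twist_weight_pcoset[of J "twist_weight J m" p] by simp
    then show "Poly_Mapping.single (twist_weight J m) 1 \<in> weight_space ?E m"
      by (auto simp: weight B_carrier_single lookup_single when_def)
    obtain a where a: "a \<in> carrier weyl"
      "Poly_Mapping.lookup (a \<odot>\<^bsub>B_mod p\<^esub> Poly_Mapping.single (twist_weight J m) 1) p \<noteq> 0"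
      using B_reach[OF p m] by blast
    have "a \<in> \<phi> ` carrier weyl" using \<phi>E(5) a(1) by (simp add: bij_betw_def)
    then obtain a' where "a' \<in> carrier weyl" "\<phi> a' = a" by blast
    then show "\<exists>a\<in>carrier weyl. Poly_Mapping.lookup (a \<odot>\<^bsub>?E\<^esub> Poly_Mapping.single (twist_weight J m) 1) p \<noteq> 0"
      using a(2) by auto
  next
    fix x m assume x: "x \<in> weight_space ?E m" and nz: "x \<noteq> \<zero>\<^bsub>?E\<^esub>"
    obtain n where n: "Poly_Mapping.lookup x n \<noteq> 0"
      using nz by (metis B_mod_simps(2) lookup_zero poly_mapping_eqI twist_simps(2))
    have only: "k = twist_weight J m" if "Poly_Mapping.lookup x k \<noteq> 0" for k
      using x that by (auto simp: weight)
    then have n_eq: "n = twist_weight J m" using n by blast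
    have "n \<in> pcoset p" using x n by (auto simp: weight B_carrier_iff in_keys_iff subset_iff)
    then have "m \<in> pcoset (twist_weight J p)"
      using twist_weight_pcoset[of J n p] by (simp add: n_eq)
    moreover have "x = pm_scale (Poly_Mapping.lookup x n) (Poly_Mapping.single n 1)"
      using only n_eq by (intro poly_mapping_eqI) (auto simp: lookup_single when_def)
    then have "x = pm_scale (Poly_Mapping.lookup x n) \<odot>\<^bsub>?E\<^esub> Poly_Mapping.single (twist_weight J m) 1"
      using scale[of "Poly_Mapping.single n 1"] \<open>n \<in> pcoset p\<close> n_eq by (metis B_carrier_single)
    ultimately show "m \<in> pcoset (twist_weight J p) \<and>
        (\<exists>c. x = pm_scale c \<odot>\<^bsub>?E\<^esub> Poly_Mapping.single (twist_weight J m) 1)" by blast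
  qed
qed

section \<open>The simple module \<open>L(p)\<close>\<close>

text \<open>The classes of all \<open>a\<close> that annihilate \<open>x^p\<close> in
  \<open>B(p)\<close> form the unique maximal submodule of \<open>P(p)\<close>, so
  \<open>L(p)\<close> is a copy of the submodule of \<open>B(p)\<close> generated by
  \<open>x^p\<close>.\<close>

lemma L_mod_cyclic:
  fixes p :: "'i \<Rightarrow> 'k::field_char_0"
  assumes p: "p \<in> kplus"
  obtains y where "weyl_module (L_mod p)" "cyclic_on (L_mod p) y"
    "\<And>a. a \<in> carrier weyl \<Longrightarrow>
      a \<odot>\<^bsub>L_mod p\<^esub> y = \<zero>\<^bsub>L_mod p\<^esub> \<longleftrightarrow> a \<odot>\<^bsub>B_mod p\<^esub> Poly_Mapping.single p 1 = 0"
proof -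
  let ?e = "Poly_Mapping.single p (1 :: 'k)" and ?I = "wideal p"
  let ?A = "regular_module weyl :: (('i, 'k) mpol_op, _) module"
  have id: "(\<lambda>a. a) \<in> ring_iso weyl weyl" by (rule ring_iso_memI) (auto simp: bij_betw_def)
  have tw: "twist_weight {} m = m" for m :: "'i \<Rightarrow> 'k" by (auto simp: twist_weight_def)
  have "weyl_line (twist (\<lambda>a. a) (B_mod p)) (twist_weight {} p) (\<lambda>f. Poly_Mapping.lookup f p)
      (\<lambda>m. Poly_Mapping.single (twist_weight {} m) 1)"
    by (rule twisted_B_weyl_line[OF p id]) auto
  then interpret B: weyl_line "B_mod p" p "\<lambda>f. Poly_Mapping.lookup f p" "\<lambda>m. Poly_Mapping.single m 1"
    by (simp add: tw twist_id)
  have e: "?e \<in> weight_space (B_mod p) p" "?e \<in> carrier (B_mod p)"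
    using B.b_weight[OF B.q_in_pcoset] B.b_closed[OF B.q_in_pcoset] by auto
  interpret A: left_module weyl ?A by (rule regular_left_module)
  interpret P: quotient weyl ?A ?I
    by (intro quotient.intro quotient_axioms.intro regular_left_module wideal_submodule)
  have P_mod: "P_mod p = quotient_module ?A ?I"
    by (simp add: P_mod_def submodule_span_max_ideal)
  define N where "N = P.cl ` {a \<in> carrier weyl. a \<odot>\<^bsub>B_mod p\<^esub> ?e = 0}"
  have lm: "left_module weyl (P_mod p)" unfolding P_mod by (rule P.quotient_left_module)
  have P_carrier: "carrier (P_mod p) = P.cl ` carrier weyl" by (simp add: P_mod P.quotient_carrier)
  have P_add: "P.cl a \<oplus>\<^bsub>P_mod p\<^esub> P.cl b = P.cl (\<lambda>f. a f + b f)"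
    and P_smult: "a \<odot>\<^bsub>P_mod p\<^esub> P.cl b = P.cl (\<lambda>f. a (b f))"
    if "a \<in> carrier weyl" "b \<in> carrier weyl" for a b
    using P.cl_add[of a b] P.cl_smult[of a b] that by (simp_all add: P_mod)
  have P_eq: "P.cl a = P.cl b \<longleftrightarrow> weq p a b" if "a \<in> carrier weyl" "b \<in> carrier weyl" for a b
    using P.cl_eq_iff[of a b] that by (simp add: a_minus_def regular_minus weq_def)
  have cl_N: "P.cl a \<in> N \<longleftrightarrow> a \<odot>\<^bsub>B_mod p\<^esub> ?e = 0" if a: "a \<in> carrier weyl" for a
  proof
    assume "P.cl a \<in> N"
    then obtain b where b: "b \<in> carrier weyl" "b \<odot>\<^bsub>B_mod p\<^esub> ?e = 0" "P.cl a = P.cl b"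
      by (auto simp: N_def)
    then have "weq p a b" using P_eq a by blast
    from B.weq_act[OF this a b(1) e(1)] show "a \<odot>\<^bsub>B_mod p\<^esub> ?e = 0" using b(2) by simp
  qed (use a in \<open>auto simp: N_def\<close>)
  have N_sub: "submodule N weyl (P_mod p)"
  proof (rule left_module_submoduleI[OF lm])
    interpret PL: left_module weyl "P_mod p" by (rule lm)
    interpret PW: weyl_module "P_mod p" by (rule weyl_module.intro[OF lm])
    show N_carrier: "N \<subseteq> carrier (P_mod p)" by (auto simp: N_def P_carrier)
    have "\<zero>\<^bsub>P_mod p\<^esub> = P.cl (\<lambda>_. 0)" by (simp add: P_mod P.zero_quotient)
    then show "\<zero>\<^bsub>P_mod p\<^esub> \<in> N" using cl_N[of "\<lambda>_. 0"] B.act_zero_left[OF e(2)] by simp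
    show smult: "a \<odot>\<^bsub>P_mod p\<^esub> X \<in> N" if a: "a \<in> carrier weyl" and "X \<in> N" for a X
    proof -
      obtain b where b: "b \<in> carrier weyl" "b \<odot>\<^bsub>B_mod p\<^esub> ?e = 0" "X = P.cl b"
        using \<open>X \<in> N\<close> by (auto simp: N_def)
      have "(\<lambda>f. a (b f)) \<odot>\<^bsub>B_mod p\<^esub> ?e = 0"
        using B.act_mult[OF a b(1) e(2)] b(2) B.act_zero_right[OF a] by simp
      then show ?thesis using cl_N[OF weyl_closed(6)[OF a b(1)]] P_smult[OF a b(1)] b(3) by simp
    qed
    show "X \<oplus>\<^bsub>P_mod p\<^esub> Y \<in> N" if XY: "X \<in> N" "Y \<in> N" for X Y
    proof -
      obtain a where a: "a \<in> carrier weyl" "a \<odot>\<^bsub>B_mod p\<^esub> ?e = 0" "X = P.cl a"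
        using XY(1) by (auto simp: N_def)
      obtain b where b: "b \<in> carrier weyl" "b \<odot>\<^bsub>B_mod p\<^esub> ?e = 0" "Y = P.cl b"
        using XY(2) by (auto simp: N_def)
      show ?thesis
        using cl_N[OF weyl_closed(7)[OF a(1) b(1)]] B.act_add[OF a(1) b(1) e(2)] P_add[OF a(1) b(1)] a b by simp
    qed
    show "\<ominus>\<^bsub>P_mod p\<^esub> X \<in> N" if "X \<in> N" for X
      using smult[OF weyl_uminus[OF weyl_closed(4)] that] PW.act_minus_left[OF weyl_closed(4), of X] that N_carrier
      by auto
  qed
  \<comment> \<open>An element outside \<open>N\<close> does not kill \<open>x^p\<close>. A left
    multiple of it sends \<open>x^p\<close> to something with nonzero coefficient at
    \<open>p\<close>, and a projector turns this multiple into a nonzero multiple of the generator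
    of \<open>P(p)\<close>.\<close>
  have whole: "N' = carrier (P_mod p)" if N': "submodule N' weyl (P_mod p)" and nsub: "\<not> N' \<subseteq> N" for N'
  proof -
    note N'E = left_module_submoduleE[OF lm N']
    obtain X where X: "X \<in> N'" "X \<notin> N" using nsub by blast
    then obtain a where a: "a \<in> carrier weyl" "X = P.cl a" using N'E(1) by (auto simp: P_carrier)
    have "a \<odot>\<^bsub>B_mod p\<^esub> ?e \<noteq> \<zero>\<^bsub>B_mod p\<^esub>" using cl_N[OF a(1)] X(2) a(2) by simp
    then obtain b where b: "b \<in> carrier weyl" "Poly_Mapping.lookup (b \<odot>\<^bsub>B_mod p\<^esub> (a \<odot>\<^bsub>B_mod p\<^esub> ?e)) p \<noteq> 0"
      using B.lam_eq_0I[OF B.act_closed[OF a(1) e(2)]] by blast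
    let ?ba = "\<lambda>f. b (a f)"
    have ba: "?ba \<in> carrier weyl" by (rule weyl_closed(6)[OF b(1) a(1)])
    obtain \<pi> \<chi> c where \<pi>: "projector \<pi> \<chi>" "\<chi> p = 1" "weq p (\<lambda>f. \<pi> (?ba f)) (pm_scale c)"
      using scalar_part[OF ba] .
    note \<pi>c = B.projector_closed[OF \<pi>(1)]
    have \<pi>ba: "(\<lambda>f. \<pi> (?ba f)) \<in> carrier weyl" by (rule weyl_closed(6)[OF \<pi>c ba])
    have bae: "?ba \<odot>\<^bsub>B_mod p\<^esub> ?e \<in> carrier (B_mod p)" by (rule B.act_closed[OF ba e(2)])
    have "pm_scale c \<odot>\<^bsub>B_mod p\<^esub> ?e = \<pi> \<odot>\<^bsub>B_mod p\<^esub> (?ba \<odot>\<^bsub>B_mod p\<^esub> ?e)"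
      using B.weq_act[OF \<pi>(3) \<pi>ba pm_scale_closed e(1)] B.act_mult[OF \<pi>c ba e(2)] by simp
    \<comment> \<open>The scalar \<open>c\<close>, found in \<open>P(p)\<close>, is read off in
      \<open>B(p)\<close>, since the projector does not change the coefficient at
      \<open>p\<close>.\<close>
    then have "Poly_Mapping.lookup (pm_scale c \<odot>\<^bsub>B_mod p\<^esub> ?e) p = Poly_Mapping.lookup (?ba \<odot>\<^bsub>B_mod p\<^esub> ?e) p"
      using B.functional_projector[OF \<pi>(1,2) bae] by simp
    then have "c \<noteq> 0" using b(2) B.act_mult[OF b(1) a(1) e(2)] B.scale[OF e(2), of c] by auto
    have "P.cl (pm_scale c) = P.cl (\<lambda>f. \<pi> (?ba f))"
      by (rule sym[OF iffD2[OF P_eq[OF \<pi>ba pm_scale_closed] \<pi>(3)]])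
    also have "\<dots> = \<pi> \<odot>\<^bsub>P_mod p\<^esub> (b \<odot>\<^bsub>P_mod p\<^esub> X)"
      unfolding a(2) P_smult[OF b(1) a(1)] P_smult[OF \<pi>c ba] ..
    finally have cN: "P.cl (pm_scale c) \<in> N'" using N'E(5)[OF \<pi>c N'E(5)[OF b(1) X(1)]] by simp
    have "P.cl d \<in> N'" if d: "d \<in> carrier weyl" for d
    proof -
      have "(\<lambda>f. pm_scale (1 / c) (pm_scale c f)) = (\<lambda>f :: ('i, 'k) mpol. f)" using \<open>c \<noteq> 0\<close> by simp
      then have "P.cl (\<lambda>f. f) \<in> N'"
        using N'E(5)[OF pm_scale_closed[of "1 / c"] cN] P_smult[OF pm_scale_closed pm_scale_closed, of "1 / c" c] by simp
      from N'E(5)[OF d this] show ?thesis using P_smult[OF d weyl_closed(4)] by simp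
    qed
    then show ?thesis using N'E(1) by (auto simp: P_carrier)
  qed
  have one: "P.cl (\<lambda>f. f) \<in> carrier (P_mod p)" "P.cl (\<lambda>f. f) \<notin> N"
  proof -
    show "P.cl (\<lambda>f. f) \<in> carrier (P_mod p)" by (simp add: P_carrier)
    have "?e \<noteq> 0" by (metis lookup_single_eq lookup_zero one_neq_zero)
    then show "P.cl (\<lambda>f. f) \<notin> N" using cl_N[of "\<lambda>f. f"] B.act_id[OF e(2)] by simp
  qed
  have maxi: "maximal_submodule N weyl (P_mod p)"
    unfolding maximal_submodule_def using N_sub one whole by blast
  have "(THE N. maximal_submodule N weyl (P_mod p)) = N"
  proof (rule the_equality)
    show "maximal_submodule N weyl (P_mod p)" by (rule maxi)
    \<comment> \<open>A proper submodule is contained in \<open>N\<close> by \<open>whole\<close>,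
      so a maximal one equals \<open>N\<close>.\<close>
    fix N' assume "maximal_submodule N' weyl (P_mod p)"
    then show "N' = N"
      using whole[of N'] N_sub one unfolding maximal_submodule_def by blast
  qed
  then have L_mod: "L_mod p = quotient_module (P_mod p) N" by (simp add: L_mod_def)
  interpret PL: left_module weyl "P_mod p" by (rule lm)
  interpret L: quotient weyl "P_mod p" N by (intro quotient.intro quotient_axioms.intro lm N_sub)
  let ?y = "L.cl (P.cl (\<lambda>f. f))"
  have act_y: "a \<odot>\<^bsub>L_mod p\<^esub> ?y = L.cl (P.cl a)" if a: "a \<in> carrier weyl" for a
    using L.cl_smult[OF a one(1)] P_smult[OF a weyl_closed(4)] by (simp add: L_mod)
  show ?thesis
  proof (rule that)
    show "weyl_module (L_mod p)" unfolding L_mod by (rule weyl_module.intro[OF L.quotient_left_module])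
    show "cyclic_on (L_mod p) ?y"
      unfolding cyclic_on_def
    proof (intro conjI ballI)
      show "?y \<in> carrier (L_mod p)" using one(1) by (simp add: L_mod L.quotient_carrier)
      fix z assume "z \<in> carrier (L_mod p)"
      then obtain a where "a \<in> carrier weyl" "z = L.cl (P.cl a)"
        by (auto simp: L_mod L.quotient_carrier P_carrier)
      then show "\<exists>a\<in>carrier weyl. z = a \<odot>\<^bsub>L_mod p\<^esub> ?y" using act_y by metis
    qed
    fix a :: "('i, 'k) mpol_op" assume a: "a \<in> carrier weyl"
    then have "P.cl a \<in> carrier (P_mod p)" by (simp add: P_carrier)
    from L.cl_zero_iff[OF this] show "a \<odot>\<^bsub>L_mod p\<^esub> ?y = \<zero>\<^bsub>L_mod p\<^esub> \<longleftrightarrow> a \<odot>\<^bsub>B_mod p\<^esub> ?e = 0"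
      using cl_N[OF a] act_y[OF a] by (simp add: L_mod)
  qed
qed

theorem corollary9:
  fixes p :: "'i \<Rightarrow> 'k :: {alg_closed_field, field_char_0}" and J :: "'i set"
  assumes "infinite (UNIV :: 'i set)"
    and "(UNIV :: 'i set) \<prec> (UNIV :: 'k set)"
    and "p \<in> kplus"
    and "J \<subseteq> J_of p"
  shows "injective_envelope_in_W TYPE('u) TYPE('v) (twist (theta J) (B_mod p)) (twist (theta J) (L_mod p)) \<and>
    projective_cover_in_W TYPE('u) TYPE('v) (dual (twist (theta J) (B_mod p))) (twist (theta J) (L_mod p))"
proof -
  note \<theta> = theta_spec[where J = J and 'k = 'k]
  interpret E: weyl_line "twist (theta J) (B_mod p)" "twist_weight J p" "\<lambda>f. Poly_Mapping.lookup f p"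
    "\<lambda>m. Poly_Mapping.single (twist_weight J m) 1"
    by (rule twisted_B_weyl_line[OF assms(3) \<theta>])
  obtain y where L: "weyl_module (L_mod p)" "cyclic_on (L_mod p) y"
    and ann: "\<And>a. a \<in> carrier weyl \<Longrightarrow>
      a \<odot>\<^bsub>L_mod p\<^esub> y = \<zero>\<^bsub>L_mod p\<^esub> \<longleftrightarrow> a \<odot>\<^bsub>B_mod p\<^esub> Poly_Mapping.single p 1 = 0"
    by (rule L_mod_cyclic[OF assms(3)]) (rule that)
  have "theta J a \<in> carrier weyl" if "a \<in> carrier weyl" for a :: "('i, 'k) mpol_op"
    using ring_iso_memE(1)[OF \<theta>(1) that] .
  \<comment> \<open>The twist replaces \<open>a\<close> by \<open>theta J a\<close> in both
    annihilators, and applying \<open>twist_weight J\<close> twice returns the exponent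
    \<open>p\<close>.\<close>
  then have ann': "a \<odot>\<^bsub>twist (theta J) (L_mod p)\<^esub> y = \<zero>\<^bsub>twist (theta J) (L_mod p)\<^esub> \<longleftrightarrow>
      a \<odot>\<^bsub>twist (theta J) (B_mod p)\<^esub> Poly_Mapping.single (twist_weight J (twist_weight J p)) 1
        = \<zero>\<^bsub>twist (theta J) (B_mod p)\<^esub>" if "a \<in> carrier weyl" for a
    using ann that by simp
  show ?thesis
    by (intro conjI E.envelope_and_cover[OF twist_weyl_module[OF L(1) \<theta>(1)] twist_cyclic[OF L(2) \<theta>(1)] ann'])
qed

end
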